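(* Let $N_t$ be the self-exciting point process with rate function $\lambda$ and initial condition $\gamma\ge 0$. Assume that $\lambda(\cdot)\le C_0$ for some constant $C_0<\infty$ and that $\lambda$ is $K$-Lipschitz for some $0<K<\infty$. Then $\mathbb{P}(N_t/t\in\cdot)$ satisfies, as $t\to\infty$ with speed $t$, a large deviation principle with rate function $$I(x)=\inf_{f\in\mathcal{AC}_0^+[0,1],\,f(1)=x}\left\{\int_0^1\log\left(\frac{f'(\alpha)}{\lambda(f(\alpha)/\alpha)}\right)f'(\alpha)\,d\alpha-\int_0^1\left[f'(\alpha)-\lambda(f(\alpha)/\alpha)\right]d\alpha\right\}.$$
   Context: Model: $\lambda:\mathbb{R}_{\ge 0}\to\mathbb{R}_{\ge 0}$ and $\gamma\ge 0$ are given; $N_t$ is a simple point process with empty past history ($N(-\infty,0]=0$) whose intensity at time $t$ with respect to its natural filtration is $\lambda_t=\lambda\left(\frac{N_{t-}+\gamma}{t+1}\right)$. Standing assumptions: $\lambda$ is increasing and continuously differentiable; the equation $x=\lambda(x)$ has finitely many solutions, and each solution $x^*$ satisfies either $\lambda'(x^* )<1$ or $\lambda'(x^* )>1$. $\mathcal{AC}_0^+[0,1]$ is the set of absolutely continuous, nondecreasing functions $f:[0,1]\to\mathbb{R}$ with $f(0)=0$. Usual conventions: $\inf\emptyset=+\infty$, $0\log 0=0$ (including $0\log(0/0)=0$) and $y\log(y/0)=+\infty$ for $y>0$; the two integrals are read as one integral of the nonnegative integrand $y\log(y/\ell)-y+\ell$ with $y=f'(\alpha)$, $\ell=\lambda(f(\alpha)/\alpha)$.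 Large deviation principle with speed $t$ and rate function $\mathcal I$ (here on $\mathbb{R}$): $\mathcal I$ is nonnegative and lower semicontinuous, and for every measurable set $A$, $-\inf_{x\in A^{o}}\mathcal I(x)\le\liminf_{t\to\infty}\frac1t\log P_t(A)\le\limsup_{t\to\infty}\frac1t\log P_t(A)\le-\inf_{x\in\overline A}\mathcal I(x)$, where $A^o$ and $\overline A$ are the interior and closure of $A$.
   Formalization: Added assumption: if λ(γ)=0 then λ is identically 0 on [0,∞). Otherwise λ(γ)=0 forces N_t=0 almost surely while I(x) is finite wherever λ(x)>0, so the claim fails (e.g. γ=0, λ(z)=2(1−e^{−z})). *)

theory Defs
  imports "HOL-Probability.Probability"
begin

section \<open>Large deviation principles\<close>

definition ereal_log :: "real \<Rightarrow> ereal" where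
  "ereal_log p = (if p = 0 then - \<infinity> else ereal (ln p))"

definition lower_semicont :: "('b::topological_space \<Rightarrow> ereal) \<Rightarrow> bool" where
  "lower_semicont I \<longleftrightarrow> (\<forall>c. closed {x. I x \<le> c})"

text \<open>Speed \<open>t\<close> as \<open>t \<rightarrow> \<infinity>\<close> along the reals. In \<open>ereal\<close> the infimum over the empty set is \<open>\<infinity>\<close>.\<close>

definition large_deviation_principle ::
  "(real \<Rightarrow> ('b::topological_space) measure) \<Rightarrow> ('b \<Rightarrow> ereal) \<Rightarrow> bool" where
  "large_deviation_principle P I \<longleftrightarrow>
     (\<forall>x. 0 \<le> I x) \<and> lower_semicont I \<and>
     (\<forall>A\<in>sets borel.
        - (INF x\<in>interior A. I x) \<le> Liminf at_top (\<lambda>t. ereal (1 / t) * ereal_log (measure (P t) A)) \<and>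
        Limsup at_top (\<lambda>t. ereal (1 / t) * ereal_log (measure (P t) A)) \<le> - (INF x\<in>closure A. I x))"


section \<open>Simple point processes and their intensities\<close>

text \<open>A simple point process on the line is a random locally finite set of points: \<open>N \<omega>\<close> is the
  set of event times in the outcome \<open>\<omega>\<close>, and \<open>count_in N B \<omega>\<close> is the number \<open>N(B)\<close> of events in \<open>B\<close>.\<close>

definition count_in :: "('a \<Rightarrow> real set) \<Rightarrow> real set \<Rightarrow> 'a \<Rightarrow> nat" where
  "count_in N B \<omega> = card (N \<omega> \<inter> B)"

definition simple_point_process :: "'a measure \<Rightarrow> ('a \<Rightarrow> real set) \<Rightarrow> bool" where
  "simple_point_process M N \<longleftrightarrow>
     prob_space M \<and>
     (\<forall>\<omega>\<in>space M. \<forall>a b. finite (N \<omega> \<inter> {a..b})) \<and>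
     (\<forall>B\<in>sets borel. bounded B \<longrightarrow> count_in N B \<in> measurable M (count_space UNIV))"

definition empty_past :: "'a measure \<Rightarrow> ('a \<Rightarrow> real set) \<Rightarrow> bool" where
  "empty_past M N \<longleftrightarrow> (\<forall>\<omega>\<in>space M. N \<omega> \<inter> {..0} = {})"

definition natural_filtration :: "'a measure \<Rightarrow> ('a \<Rightarrow> real set) \<Rightarrow> real \<Rightarrow> 'a measure" where
  "natural_filtration M N t =
     sigma (space M) {count_in N B -` S \<inter> space M |B S. B \<in> sets borel \<and> bounded B \<and> B \<subseteq> {..t}}"

text \<open>\<open>L\<close> is an intensity of \<open>N\<close> on the half-line with respect to \<open>F\<close>: it is nonnegative,
  \<open>F\<close>-progressively measurable, and \<open>E[N(a,b] | F\<^sub>a] = E[\<integral>\<^sub>a\<^sup>b L\<^sub>s ds | F\<^sub>a]\<close> almost surely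
  for all \<open>0 \<le> a \<le> b\<close>.\<close>

definition has_intensity ::
  "'a measure \<Rightarrow> (real \<Rightarrow> 'a measure) \<Rightarrow> ('a \<Rightarrow> real set) \<Rightarrow> (real \<Rightarrow> 'a \<Rightarrow> real) \<Rightarrow> bool" where
  "has_intensity M F N L \<longleftrightarrow>
     (\<forall>t\<ge>0. \<forall>\<omega>\<in>space M. 0 \<le> L t \<omega>) \<and>
     (\<forall>t\<ge>0. (\<lambda>(s, \<omega>). L s \<omega>) \<in> borel_measurable (restrict_space borel {0..t} \<Otimes>\<^sub>M F t)) \<and>
     (\<forall>a b. 0 \<le> a \<longrightarrow> a \<le> b \<longrightarrow>
        (AE \<omega> in M.
           nn_cond_exp M (F a) (\<lambda>\<omega>'. ennreal (real (count_in N {a<..b} \<omega>'))) \<omega> =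
           nn_cond_exp M (F a) (\<lambda>\<omega>'. \<integral>\<^sup>+ s\<in>{a<..b}. ennreal (L s \<omega>') \<partial>lborel) \<omega>))"

text \<open>With empty past, \<open>N\<^sub>t = N(0,t]\<close>, and the left limit \<open>N\<^sub>t\<^sub>-\<close> is \<open>N(0,t)\<close>.\<close>

definition self_exciting_process ::
  "(real \<Rightarrow> real) \<Rightarrow> real \<Rightarrow> 'a measure \<Rightarrow> ('a \<Rightarrow> real set) \<Rightarrow> bool" where
  "self_exciting_process lam \<gamma> M N \<longleftrightarrow>
     simple_point_process M N \<and> empty_past M N \<and>
     has_intensity M (natural_filtration M N) N
       (\<lambda>t \<omega>. lam ((real (count_in N {0<..<t} \<omega>) + \<gamma>) / (t + 1)))"


section \<open>The rate function\<close>

definition absolutely_continuous_on :: "real \<Rightarrow> real \<Rightarrow> (real \<Rightarrow> real) \<Rightarrow> bool" where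
  "absolutely_continuous_on a b f \<longleftrightarrow>
     (\<forall>\<epsilon>>0. \<exists>\<delta>>0. \<forall>D :: (real \<times> real) set.
        finite D \<and> (\<forall>(u, v)\<in>D. a \<le> u \<and> u \<le> v \<and> v \<le> b) \<and>
        pairwise (\<lambda>(u, v) (u', v'). {u<..<v} \<inter> {u'<..<v'} = {}) D \<and>
        (\<Sum>(u, v)\<in>D. v - u) < \<delta> \<longrightarrow>
        (\<Sum>(u, v)\<in>D. \<bar>f v - f u\<bar>) < \<epsilon>)"

definition AC0_plus :: "(real \<Rightarrow> real) set" where
  "AC0_plus = {f. absolutely_continuous_on 0 1 f \<and> mono_on {0..1} f \<and> f 0 = 0}"

text \<open>The integrand \<open>y log (y/l) - y + l\<close> for \<open>y, l \<ge> 0\<close>, with \<open>0 log 0 = 0 log (0/0) = 0\<close> and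
  \<open>y log (y/0) = \<infinity>\<close> for \<open>y > 0\<close>. It is nonnegative, so that \<open>ennreal\<close> truncates nothing.\<close>

definition local_cost :: "real \<Rightarrow> real \<Rightarrow> ennreal" where
  "local_cost y l =
     (if y = 0 then ennreal l
      else if l = 0 then \<infinity>
      else ennreal (y * ln (y / l) - y + l))"

text \<open>A member of \<open>AC0_plus\<close> is differentiable almost everywhere on \<open>[0,1]\<close>, and there \<open>deriv\<close> is
  its derivative; the value of \<open>deriv\<close> on the remaining null set does not affect the integral.\<close>

definition path_cost :: "(real \<Rightarrow> real) \<Rightarrow> (real \<Rightarrow> real) \<Rightarrow> ennreal" where
  "path_cost lam f = (\<integral>\<^sup>+ \<alpha>\<in>{0..1}. local_cost (deriv f \<alpha>) (lam (f \<alpha> / \<alpha>)) \<partial>lborel)"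

definition self_exciting_rate :: "(real \<Rightarrow> real) \<Rightarrow> real \<Rightarrow> ereal" where
  "self_exciting_rate lam x = enn2ereal (INF f\<in>{f \<in> AC0_plus. f 1 = x}. path_cost lam f)"

end

theory Submission
  imports Defs "HOL-Real_Asymp.Real_Asymp"
begin

text \<open>
  Only the one-dimensional marginals \<open>p n t = P(N\<^sub>t = n)\<close> matter. The intensity condition says that they
  solve the forward equations of a pure birth process whose jump rate is
  \<open>lam ((n + \<gamma>) / (t + 1))\<close> in state \<open>n\<close> at time \<open>t\<close>. On a time interval \<open>[t \<alpha>, t (\<alpha> + \<Delta>)]\<close> the rate is
  frozen between two bounds, so that transition probabilities are compared from both sides with
  Poisson weights; by Stirling their exponents are the costs of linear pieces of a path.

  For the lower bound a given path is replaced by a polygon, whose cost is no larger by convexity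
  (in its dual form). For the upper bound \<open>p n t\<close> is at most a polynomial factor times the best product of
  such weights over grid paths. In both comparisons the rates at the ends of a grid cell differ, and a
  small rate in the logarithm would be fatal. Both times the path is therefore raised by a
  small \<open>h\<close> after a short initial time \<open>\<eta>\<close>: this changes the logarithm in the favourable direction and costs
  only \<open>O(K h / \<eta>)\<close> in the linear term. The raised path starts with a steep linear piece, which is cheap
  because its slope keeps the rate at least \<open>lam \<gamma>\<close>. Truncating a path at a lower end height is
  also cheap, and the two perturbations together give lower semicontinuity of the rate function without
  a compactness argument.
\<close>

section \<open>Absolutely continuous functions and Lebesgue differentiation\<close>

text \<open>The obstacle is a mismatch of frozen rates. The cost of a path controls the logarithm in
  a cell only with the largest rate there, whereas a lower bound for a probability needs the
  smallest; the upper bound has the same conflict in reverse. Where \<open>lam\<close> may vanish,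
  the quotient of the two rates is not close to 1, and no continuity estimate closes the gap.
  Raising makes the smallest ratio of height to time on the new path at least the largest one on the
  old path, so no quotient of rates is ever estimated. The price falls on the linear term, where the
  Lipschitz constant is enough. This fixes the order of choices: \<eta> before h, with
  \<open>h \<le> \<eta>\<^sup>2\<close> so that h / \<eta> is small, h before the mesh, and t last.
  A raised path ends too high. In the lower bound an open set leaves room for that; in the upper
  bound the path is truncated afterwards. The cost is written with \<open>deriv\<close>, while
  estimates need increments of the path. Differentiation of absolutely continuous functions almost
  everywhere connects the two.\<close>

lemma AE_zero_density_of_null_set:
  fixes \<nu> :: "real measure"
  assumes fin: "finite_measure \<nu>" and sets_\<nu>: "sets \<nu> = sets borel"
    and E: "E \<in> sets borel" and null: "emeasure \<nu> E = 0"
  shows "AE x in lborel. x \<in> E \<longrightarrow>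
    (\<forall>e>0. \<exists>d>0. \<forall>r. 0 < r \<and> r < d \<longrightarrow> measure \<nu> (cball x r) \<le> e * r)"
proof -
  interpret finite_measure \<nu> by fact
  have sp: "space \<nu> = UNIV" using sets_eq_imp_space_eq[OF sets_\<nu>] by simp
  have ms: "A \<in> sets borel \<Longrightarrow> A \<in> sets \<nu>" for A using sets_\<nu> by simp
  \<comment> \<open>Points of E where the mass of small balls exceeds q times their radius for
    arbitrarily small radii. Vitali's lemma picks disjoint balls whose fivefold enlargements cover
    these points. Each ball has length at most a multiple of its mass over q, and all of them lie in
    one open set of small mass.\<close>
  define B where "B q = {x\<in>E. \<forall>d>0. \<exists>r. 0 < r \<and> r < d \<and> measure \<nu> (cball x r) > q * r}" for q
  have neg: "negligible (B q)" if q: "q > 0" for q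
    unfolding negligible_outer_le
  proof (intro allI impI)
    fix e :: real assume e: "e > 0"
    \<comment> \<open>An enlarged ball has length 10 r while its core has mass above q r, so a total
      mass of t yields total length at most \<open>10 / q * t = e\<close>.\<close>
    define t where "t = q * e / 10"
    have t: "t > 0" using q e by (simp add: t_def)
    have "(INF U \<in> {U. E \<subseteq> U \<and> open U}. emeasure \<nu> U) < ennreal t"
      using outer_regular[OF sets_\<nu> _ E] null t emeasure_finite[of "space \<nu>"] by (simp add: sp)
    then obtain U where U: "E \<subseteq> U" "open U" "emeasure \<nu> U < ennreal t"
      by (auto simp: INF_less_iff)
    have mU: "measure \<nu> U \<le> t"
      using U(3) t by (simp add: emeasure_eq_measure ennreal_less_iff)
    define J where "J = {(x, r). x \<in> B q \<and> 0 < r \<and> r < 1 \<and> cball x r \<subseteq> U \<and> measure \<nu> (cball x r) > q * r}"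
    have cov: "B q \<subseteq> (\<Union>i\<in>J. cball (fst i) (snd i))"
    proof
      fix x assume x: "x \<in> B q"
      then have "x \<in> U" using U by (auto simp: B_def)
      then obtain d where d: "d > 0" "cball x d \<subseteq> U" using U(2) open_contains_cball by blast
      obtain r where r: "0 < r" "r < min d 1" "measure \<nu> (cball x r) > q * r"
      proof -
        have "min d 1 > 0" using d by simp
        with x show ?thesis using that unfolding B_def by blast
      qed
      have "cball x r \<subseteq> cball x d" using r by auto
      then have "(x, r) \<in> J" using x r d by (auto simp: J_def)
      then show "x \<in> (\<Union>i\<in>J. cball (fst i) (snd i))" using r by force
    qed
    have rJ: "0 < snd i \<and> snd i \<le> 1" if "i \<in> J" for i using that by (auto simp: J_def)
    obtain C where C: "countable C" "C \<subseteq> J"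
      "pairwise (\<lambda>i j. disjnt (cball (fst i) (snd i)) (cball (fst j) (snd j))) C"
      "B q \<subseteq> (\<Union>i\<in>C. cball (fst i) (5 * snd i))"
      by (rule Vitali_covering_lemma_cballs[OF cov rJ])
    have bound: "(\<Sum>i\<in>I. measure lebesgue (cball (fst i) (5 * snd i))) \<le> e"
      if I: "I \<subseteq> C" "finite I" for I
    proof -
      have "(\<Sum>i\<in>I. measure lebesgue (cball (fst i) (5 * snd i))) \<le> (\<Sum>i\<in>I. 10 / q * measure \<nu> (cball (fst i) (snd i)))"
      proof (rule sum_mono)
        fix i assume "i \<in> I"
        then have i: "0 < snd i" "measure \<nu> (cball (fst i) (snd i)) > q * snd i"
          using I C(2) by (auto simp: J_def)
        have "measure lebesgue (cball (fst i) (5 * snd i)) = 10 * snd i"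
          using i by (simp add: cball_eq_atLeastAtMost)
        also have "\<dots> \<le> 10 / q * measure \<nu> (cball (fst i) (snd i))"
          using i q by (simp add: field_simps)
        finally show "measure lebesgue (cball (fst i) (5 * snd i)) \<le> 10 / q * measure \<nu> (cball (fst i) (snd i))" .
      qed
      also have "\<dots> = 10 / q * (\<Sum>i\<in>I. measure \<nu> (cball (fst i) (snd i)))"
        by (simp add: sum_distrib_left)
      also have "(\<Sum>i\<in>I. measure \<nu> (cball (fst i) (snd i))) = measure \<nu> (\<Union>i\<in>I. cball (fst i) (snd i))"
      proof (rule finite_measure_finite_Union[symmetric, OF I(2)])
        show "(\<lambda>i. cball (fst i) (snd i)) ` I \<subseteq> sets \<nu>" by (auto intro!: ms)
        show "disjoint_family_on (\<lambda>i. cball (fst i) (snd i)) I"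
          using C(3) I(1) unfolding pairwise_def disjoint_family_on_def disjnt_def by blast
      qed
      also have "\<dots> \<le> measure \<nu> U"
      proof (intro finite_measure_mono ms)
        have "cball (fst i) (snd i) \<subseteq> U" if "i \<in> I" for i
        proof -
          have "i \<in> J" using that I(1) C(2) by blast
          then show ?thesis by (auto simp: J_def)
        qed
        then show "(\<Union>i\<in>I. cball (fst i) (snd i)) \<subseteq> U" by blast
      qed (use U in auto)
      finally have "(\<Sum>i\<in>I. measure lebesgue (cball (fst i) (5 * snd i))) \<le> 10 / q * measure \<nu> U"
        using q by (simp add: divide_right_mono)
      also have "\<dots> \<le> 10 / q * t" using mU q by (intro mult_left_mono) auto
      also have "\<dots> = e" using q by (simp add: t_def)
      finally show ?thesis .
    qed
    have bound': "measure lebesgue (\<Union>i\<in>I. cball (fst i) (5 * snd i)) \<le> e" if I: "I \<subseteq> C" "finite I" for I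
      using measure_UNION_le[OF I(2), of "\<lambda>i. cball (fst i) (5 * snd i)" lebesgue] bound[OF I] by force
    show "\<exists>T. B q \<subseteq> T \<and> T \<in> lmeasurable \<and> measure lebesgue T \<le> e"
    proof (intro exI conjI)
      show "B q \<subseteq> (\<Union>i\<in>C. cball (fst i) (5 * snd i))" by fact
      show "(\<Union>i\<in>C. cball (fst i) (5 * snd i)) \<in> lmeasurable"
        by (rule fmeasurable_UN_bound[OF C(1) _ bound']) auto
      show "measure lebesgue (\<Union>i\<in>C. cball (fst i) (5 * snd i)) \<le> e"
        by (rule measure_UN_bound[OF C(1) _ bound']) auto
    qed
  qed
  have "negligible (\<Union>n. B (1 / Suc n))"
    by (rule negligible_countable_Union) (auto intro!: neg)
  then have "AE x in lebesgue. x \<notin> (\<Union>n. B (1 / Suc n))"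
    using AE_not_in unfolding negligible_iff_null_sets by blast
  then have ae: "AE x in lborel. x \<notin> (\<Union>n. B (1 / Suc n))"
    by (simp add: AE_completion_iff)
  have sub: "\<forall>e>0. \<exists>d>0. \<forall>r. 0 < r \<and> r < d \<longrightarrow> measure \<nu> (cball x r) \<le> e * r"
    if x: "x \<notin> (\<Union>n. B (1 / Suc n))" "x \<in> E" for x
  proof (intro allI impI)
    fix e :: real assume "e > 0"
    then obtain n where n: "1 / Suc n < e" using nat_approx_posE by blast
    have "x \<notin> B (1 / Suc n)" using x by auto
    then have "\<exists>d>0. \<forall>r. \<not> (0 < r \<and> r < d \<and> measure \<nu> (cball x r) > 1 / Suc n * r)"
      using x(2) unfolding B_def by blast
    then obtain d where d: "d > 0" "\<And>r. 0 < r \<Longrightarrow> r < d \<Longrightarrow> measure \<nu> (cball x r) \<le> 1 / Suc n * r"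
      by (meson not_le)
    have "measure \<nu> (cball x r) \<le> e * r" if "0 < r" "r < d" for r
    proof -
      have "measure \<nu> (cball x r) \<le> 1 / Suc n * r" using d that by blast
      also have "\<dots> \<le> e * r" using n that by (intro mult_right_mono) auto
      finally show ?thesis .
    qed
    with d show "\<exists>d>0. \<forall>r. 0 < r \<and> r < d \<longrightarrow> measure \<nu> (cball x r) \<le> e * r" by blast
  qed
  show ?thesis using ae by eventually_elim (use sub in blast)
qed

text \<open>The excess of h over a level c, used as a density, gives a measure that does not charge
  \<open>{x. h x \<le> c}\<close>. It therefore has density zero at almost every point of that set,
  and rational levels slightly above \<open>h x\<close> bound the averages near x. One side
  suffices, as the lemma can be applied to a function and to its negative.\<close>

lemma AE_upper_average:
  fixes h :: "real \<Rightarrow> real"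
  assumes h: "integrable lborel h"
  shows "AE x in lborel. \<forall>e>0. \<exists>d>0. \<forall>u v. x - d < u \<and> u \<le> x \<and> x \<le> v \<and> v < x + d \<and> u < v \<and> {u<..v} \<subseteq> {0..1} \<longrightarrow>
     (LINT y:{u<..v}|lborel. h y) \<le> (h x + e) * (v - u)"
proof -
  have hm[measurable]: "h \<in> borel_measurable borel" using h by auto
  define k where "k c y = indicator {0..1} y * max 0 (h y - c)" for c y :: real
  have km[measurable]: "k c \<in> borel_measurable borel" for c unfolding k_def by measurable
  have ki: "integrable lborel (k c)" for c
  proof (rule Bochner_Integration.integrable_bound)
    show "integrable lborel (\<lambda>y. \<bar>h y\<bar> + \<bar>c\<bar> * indicator {0..1} y)"
      using h by (intro Bochner_Integration.integrable_add integrable_abs) auto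
    show "AE y in lborel. norm (k c y) \<le> norm (\<bar>h y\<bar> + \<bar>c\<bar> * indicator {0..1} y)"
      by (auto simp: k_def indicator_def)
  qed simp
  have k0: "k c y \<ge> 0" for c y by (simp add: k_def)
  define \<nu> where "\<nu> c = density lborel (\<lambda>y. ennreal (k c y))" for c
  have fin: "finite_measure (\<nu> c)" for c
  proof
    have "emeasure (\<nu> c) (space (\<nu> c)) = ennreal (LINT y|lborel. k c y)"
      using k0 by (simp add: \<nu>_def emeasure_density nn_integral_eq_integral[OF ki])
    then show "emeasure (\<nu> c) (space (\<nu> c)) \<noteq> \<infinity>" by simp
  qed
  have m\<nu>: "measure (\<nu> c) A = (LINT y:A|lborel. k c y)" if "A \<in> sets borel" for A c
  proof -
    have "emeasure (\<nu> c) A = ennreal (LINT y:A|lborel. k c y)"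
      using that k0 integrable_mult_indicator[OF _ ki, of A c] unfolding \<nu>_def set_lebesgue_integral_def
      by (subst nn_integral_eq_integral[symmetric])
        (auto simp: emeasure_density intro!: nn_integral_cong split: split_indicator)
    then show ?thesis using k0 by (simp add: measure_def set_lebesgue_integral_def)
  qed
  have "AE x in lborel. x \<in> {x. h x \<le> c} \<longrightarrow>
    (\<forall>e>0. \<exists>d>0. \<forall>r. 0 < r \<and> r < d \<longrightarrow> measure (\<nu> c) (cball x r) \<le> e * r)" for c
  proof (rule AE_zero_density_of_null_set[OF fin])
    show "sets (\<nu> c) = sets borel" by (simp add: \<nu>_def)
    show "{x. h x \<le> c} \<in> sets borel" by measurable
    have "emeasure (\<nu> c) {x. h x \<le> c} = (\<integral>\<^sup>+y. ennreal (k c y) * indicator {x. h x \<le> c} y \<partial>lborel)"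
      unfolding \<nu>_def by (rule emeasure_density) auto
    also have "\<dots> = (\<integral>\<^sup>+(y::real). 0 \<partial>lborel)"
      by (rule nn_integral_cong) (auto simp: k_def indicator_def max_def)
    finally show "emeasure (\<nu> c) {x. h x \<le> c} = 0" by simp
  qed
  then have "AE x in lborel. \<forall>c\<in>\<rat>. x \<in> {x. h x \<le> c} \<longrightarrow>
    (\<forall>e>0. \<exists>d>0. \<forall>r. 0 < r \<and> r < d \<longrightarrow> measure (\<nu> c) (cball x r) \<le> e * r)"
    by (simp add: AE_ball_countable countable_rat)
  then show ?thesis
  proof eventually_elim
    case (elim x)
    show ?case
    proof (intro allI impI)
      fix e :: real assume e: "e > 0"
      obtain c where c: "c \<in> \<rat>" "h x < c" "c < h x + e / 2"
        using Rats_dense_in_real[of "h x" "h x + e/2"] e by auto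
      have "e/2 > 0" using e by simp
      with elim c obtain d where d: "d > 0" "\<And>r. 0 < r \<Longrightarrow> r < d \<Longrightarrow> measure (\<nu> c) (cball x r) \<le> e/2 * r"
        by (metis less_imp_le mem_Collect_eq)
      \<comment> \<open>Halving d ensures \<open>v - u < d\<close>, and \<open>{u<..v}\<close> lies
        in the ball of radius \<open>v - u\<close> around x.\<close>
      have "(LINT y:{u<..v}|lborel. h y) \<le> (h x + e) * (v - u)"
        if uv: "x - d/2 < u" "u \<le> x" "x \<le> v" "v < x + d/2" "u < v" "{u<..v} \<subseteq> {0..1}" for u v
      proof -
        have hi: "set_integrable lborel A h" if "A \<in> sets borel" for A
          using integrable_mult_indicator[of A lborel, OF _ h] that by (simp add: set_integrable_def)
        have kI: "set_integrable lborel A (k c)" if "A \<in> sets borel" for A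
          using integrable_mult_indicator[of A lborel, OF _ ki] that by (simp add: set_integrable_def)
        have ci: "set_integrable lborel {u<..v} (\<lambda>_. c)" using uv
          by (auto simp: set_integrable_def)
        have "(LINT y:{u<..v}|lborel. h y) \<le> (LINT y:{u<..v}|lborel. c + k c y)"
        proof (rule set_integral_mono)
          show "set_integrable lborel {u<..v} (\<lambda>y. c + k c y)" using ci kI by auto
          show "h y \<le> c + k c y" if "y \<in> {u<..v}" for y
            using that uv(6) by (auto simp: k_def)
        qed (simp add: hi)
        also have "\<dots> = (LINT y:{u<..v}|lborel. c) + (LINT y:{u<..v}|lborel. k c y)"
          using ci kI by (intro set_integral_add) auto
        also have "(LINT y:{u<..v}|lborel. c) = c * (v - u)"
          using uv by (simp add: set_lebesgue_integral_def)
        also have "(LINT y:{u<..v}|lborel. k c y) \<le> (LINT y:cball x (v - u)|lborel. k c y)"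
          unfolding set_lebesgue_integral_def
          using uv k0 kI[of "{u<..v}"] kI[of "cball x (v-u)"]
          by (intro integral_mono) (auto simp: set_integrable_def dist_real_def split: split_indicator)
        also have "\<dots> = measure (\<nu> c) (cball x (v - u))" by (simp add: m\<nu>)
        also have "\<dots> \<le> e/2 * (v - u)" using uv by (intro d) auto
        finally have "(LINT y:{u<..v}|lborel. h y) \<le> (c + e/2) * (v - u)" by (simp add: algebra_simps)
        also have "\<dots> \<le> (h x + e) * (v - u)" using c uv by (intro mult_right_mono) auto
        finally show ?thesis .
      qed
      then show "\<exists>d>0. \<forall>u v. x - d < u \<and> u \<le> x \<and> x \<le> v \<and> v < x + d \<and> u < v \<and> {u<..v} \<subseteq> {0..1} \<longrightarrow>
         (LINT y:{u<..v}|lborel. h y) \<le> (h x + e) * (v - u)"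
        using d(1) by (intro exI[of _ "d/2"]) auto
    qed
  qed
qed

text \<open>The upper averages of g and of -g squeeze the difference quotient. They admit intervals
  with x at either end, so both one-sided quotients are covered.\<close>

lemma AE_has_derivative_indefinite_integral:
  fixes g F :: "real \<Rightarrow> real"
  assumes g: "integrable lborel g"
    and F: "\<And>u v. 0 \<le> u \<Longrightarrow> u \<le> v \<Longrightarrow> v \<le> 1 \<Longrightarrow> F v - F u = (LINT y:{u<..v}|lborel. g y)"
  shows "AE x in lborel. x \<in> {0<..<1} \<longrightarrow> (F has_real_derivative g x) (at x)"
proof -
  have "integrable lborel (\<lambda>y. - g y)" using g by simp
  from AE_upper_average[OF g] AE_upper_average[OF this] show ?thesis
  proof eventually_elim
    case (elim x)
    show ?case
    proof
      assume x: "x \<in> {0<..<1}"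
      show "(F has_real_derivative g x) (at x)"
        unfolding has_field_derivative_def has_derivative_within_alt
      proof (intro conjI allI impI)
        show "bounded_linear ((*) (g x))" by (rule bounded_linear_mult_right)
        fix e :: real assume e: "e > 0"
        obtain d1 where d1: "d1 > 0 \<and> (\<forall>u v. x - d1 < u \<and> u \<le> x \<and> x \<le> v \<and> v < x + d1 \<and> u < v \<and> {u<..v} \<subseteq> {0..1} \<longrightarrow>
          (LINT y:{u<..v}|lborel. g y) \<le> (g x + e) * (v - u))"
          using spec[OF elim(1), THEN mp, OF e] by (rule exE)
        obtain d2 where d2: "d2 > 0 \<and> (\<forall>u v. x - d2 < u \<and> u \<le> x \<and> x \<le> v \<and> v < x + d2 \<and> u < v \<and> {u<..v} \<subseteq> {0..1} \<longrightarrow>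
          (LINT y:{u<..v}|lborel. - g y) \<le> (- g x + e) * (v - u))"
          using spec[OF elim(2), THEN mp, OF e] by (rule exE)
        define d where "d = min (min d1 d2) (min x (1 - x))"
        have d: "d > 0" using d1 d2 x by (auto simp: d_def)
        have key: "\<bar>F v - F u - g x * (v - u)\<bar> \<le> e * (v - u)"
          if uv: "x - d < u" "u \<le> x" "x \<le> v" "v < x + d" "u < v" for u v
        proof -
          have 01: "{u<..v} \<subseteq> {0..1}" "0 \<le> u" "v \<le> 1" using uv by (auto simp: d_def)
          have near: "x - d1 < u" "v < x + d1" "x - d2 < u" "v < x + d2" using uv by (auto simp: d_def)
          have "F v - F u \<le> (g x + e) * (v - u)"
            using d1[THEN conjunct2, rule_format, of u v] uv near 01 F[of u v] by auto
          moreover have "- (F v - F u) \<le> (- g x + e) * (v - u)"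
            using d2[THEN conjunct2, rule_format, of u v] uv near 01 F[of u v] by (auto simp: set_lebesgue_integral_def)
          ultimately show ?thesis by (auto simp: abs_le_iff algebra_simps)
        qed
        have "norm (F y - F x - g x * (y - x)) \<le> e * norm (y - x)" if y: "norm (y - x) < d" for y
        proof (cases "y = x")
          case False
          then consider "x < y" | "y < x" by linarith
          then show ?thesis
          proof cases
            case 1 then show ?thesis using key[of x y] y by auto
          next
            case 2 then show ?thesis using key[of y x] y
              by (auto simp: abs_le_iff algebra_simps)
          qed
        qed simp
        then show "\<exists>d>0. \<forall>y\<in>UNIV. norm (y - x) < d \<longrightarrow> norm (F y - F x - g x * (y - x)) \<le> e * norm (y - x)"
          using d by blast
      qed
    qed
  qed
qed

section \<open>Densities of absolutely continuous paths\<close>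

lemma AC0_plusD:
  assumes "f \<in> AC0_plus"
  shows "absolutely_continuous_on 0 1 f" "mono_on {0..1} f" "f 0 = 0"
  using assms by (auto simp: AC0_plus_def)

lemma absolutely_continuous_onE:
  assumes "absolutely_continuous_on a b f" "e > 0"
  obtains d where "d > 0" "\<And>D :: (real \<times> real) set.
        finite D \<and> (\<forall>(u, v)\<in>D. a \<le> u \<and> u \<le> v \<and> v \<le> b) \<and>
        pairwise (\<lambda>(u, v) (u', v'). {u<..<v} \<inter> {u'<..<v'} = {}) D \<and>
        (\<Sum>(u, v)\<in>D. v - u) < d \<Longrightarrow> (\<Sum>(u, v)\<in>D. \<bar>f v - f u\<bar>) < e"
proof -
  obtain d where d: "d > 0 \<and> (\<forall>D :: (real \<times> real) set.
        finite D \<and> (\<forall>(u, v)\<in>D. a \<le> u \<and> u \<le> v \<and> v \<le> b) \<and>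
        pairwise (\<lambda>(u, v) (u', v'). {u<..<v} \<inter> {u'<..<v'} = {}) D \<and>
        (\<Sum>(u, v)\<in>D. v - u) < d \<longrightarrow> (\<Sum>(u, v)\<in>D. \<bar>f v - f u\<bar>) < e)"
    using assms(1)[unfolded absolutely_continuous_on_def, rule_format, OF assms(2)] by (rule exE)
  show ?thesis
    by (rule that[OF d[THEN conjunct1] d[THEN conjunct2, THEN spec, THEN mp]])
qed

lemma absolutely_continuous_on_imp_continuous_on:
  assumes "absolutely_continuous_on a b f"
  shows "continuous_on {a..b} f"
  unfolding continuous_on_iff
proof (intro ballI allI impI)
  fix x e :: real assume x: "x \<in> {a..b}" and e: "e > 0"
  obtain d where d: "d > 0" and D: "\<And>D :: (real \<times> real) set.
        finite D \<and> (\<forall>(u, v)\<in>D. a \<le> u \<and> u \<le> v \<and> v \<le> b) \<and>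
        pairwise (\<lambda>(u, v) (u', v'). {u<..<v} \<inter> {u'<..<v'} = {}) D \<and>
        (\<Sum>(u, v)\<in>D. v - u) < d \<Longrightarrow> (\<Sum>(u, v)\<in>D. \<bar>f v - f u\<bar>) < e"
    by (rule absolutely_continuous_onE[OF assms e]) (rule that)
  have "dist (f y) (f x) < e" if y: "y \<in> {a..b}" "dist y x < d" for y
  proof (cases "x \<le> y")
    case True
    then show ?thesis using D[of "{(x, y)}"] x y by (auto simp: dist_real_def)
  next
    case False
    then show ?thesis using D[of "{(y, x)}"] x y by (auto simp: dist_real_def)
  qed
  then show "\<exists>d>0. \<forall>y\<in>{a..b}. dist y x < d \<longrightarrow> dist (f y) (f x) < e"
    using d by blast
qed

text \<open>A null set in [0,1] is covered by countably many nonoverlapping intervals of total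
  length below \<delta>. Absolute continuity of f concerns finite families, so it bounds the measure
  of every finite subfamily by e, and the whole union inherits the bound. Extension by constants
  turns f into the distribution function of a measure that charges nothing outside [0,1].\<close>

lemma absolutely_continuous_interval_measure:
  assumes f: "f \<in> AC0_plus"
  defines "F \<equiv> \<lambda>x. f (max 0 (min 1 x))"
  shows "absolutely_continuous lborel (interval_measure F)"
proof -
  have F01: "F x = f x" if "x \<in> {0..1}" for x using that by (auto simp: F_def)
  have F0: "F x = f 0" if "x \<le> 0" for x using that by (auto simp: F_def)
  have F1: "F x = f 1" if "x \<ge> 1" for x using that by (auto simp: F_def)
  have mono: "F x \<le> F y" if "x \<le> y" for x y
    using mono_onD[OF AC0_plusD(2)[OF f], of "max 0 (min 1 x)" "max 0 (min 1 y)"] that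
    by (auto simp: F_def)
  have cont: "continuous_on UNIV F"
    unfolding F_def
    by (rule continuous_on_compose2[OF absolutely_continuous_on_imp_continuous_on[OF AC0_plusD(1)[OF f]]])
      (auto intro!: continuous_intros)
  have contR: "continuous (at_right a) F" for a
    using cont by (simp add: continuous_on_eq_continuous_within continuous_at_imp_continuous_at_within)
  let ?\<mu> = "interval_measure F"
  have Ioc: "emeasure ?\<mu> {a<..b} = ennreal (F b - F a)" if "a \<le> b" for a b
    by (rule emeasure_interval_measure_Ioc[OF that mono contR])
  have Icc: "emeasure ?\<mu> {a..b} = ennreal (F b - F a)" if "a \<le> b" for a b
    by (rule emeasure_interval_measure_Icc[OF that mono cont])
  have a: "emeasure ?\<mu> (\<Union>n. {- real n<..0}) = 0"
    by (rule emeasure_UN_eq_0) (auto simp: Ioc F0 F1)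
  have b: "{..<0} \<subseteq> (\<Union>n. {- real n<..0})"
  proof
    fix x :: real assume "x \<in> {..<0}"
    then show "x \<in> (\<Union>n. {- real n<..0})" using reals_Archimedean2[of "- x"] by (auto simp: minus_less_iff)
  qed
  have left: "{..<0} \<in> null_sets ?\<mu>"
    using emeasure_eq_0[OF _ a b] by (intro null_setsI) simp_all
  have a': "emeasure ?\<mu> (\<Union>n. {1<..real (Suc n)}) = 0"
    by (rule emeasure_UN_eq_0) (auto simp: Ioc F0 F1)
  have b': "{1<..} \<subseteq> (\<Union>n. {1<..real (Suc n)})"
  proof
    fix x :: real assume "x \<in> {1<..}"
    then show "x \<in> (\<Union>n. {1<..real (Suc n)})"
    proof -
      obtain n where "x \<le> real n" using real_arch_simple by blast
      then have "x \<in> {1<..real (Suc n)}" using \<open>x \<in> {1<..}\<close> by simp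
      then show ?thesis by blast
    qed
  qed
  have right: "{1<..} \<in> null_sets ?\<mu>"
    using emeasure_eq_0[OF _ a' b'] by (intro null_setsI) simp_all
  have mid: "Z \<inter> {0..1} \<in> null_sets ?\<mu>" if Z: "Z \<in> null_sets lborel" for Z
  proof -
    have Zb: "Z \<in> sets borel" using Z by (auto simp: null_sets_def)
    let ?S = "Z \<inter> {0..1}"
    have S0: "?S \<in> null_sets lborel" using Z by (auto intro: null_set_Int2)
    have "measure ?\<mu> ?S \<le> e" if e: "e > 0" for e
    proof -
      obtain \<delta> where \<delta>: "\<delta> > 0" and D: "\<And>D :: (real \<times> real) set.
        finite D \<and> (\<forall>(u, v)\<in>D. 0 \<le> u \<and> u \<le> v \<and> v \<le> 1) \<and>
        pairwise (\<lambda>(u, v) (u', v'). {u<..<v} \<inter> {u'<..<v'} = {}) D \<and>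
        (\<Sum>(u, v)\<in>D. v - u) < \<delta> \<Longrightarrow> (\<Sum>(u, v)\<in>D. \<bar>f v - f u\<bar>) < e"
        by (rule absolutely_continuous_onE[OF AC0_plusD(1)[OF f] e]) (rule that)
      have Sl: "?S \<in> null_sets lebesgue" using S0 null_sets_completionI by blast
      then have "?S \<in> lmeasurable" by (simp add: fmeasurable_def null_sets_def)
      moreover have "?S \<subseteq> cbox 0 1" by auto
      ultimately obtain \<D> where \<D>: "countable \<D>"
        "\<And>K. K \<in> \<D> \<Longrightarrow> K \<subseteq> cbox 0 1 \<and> K \<noteq> {} \<and> (\<exists>c d. K = cbox c d)"
        "pairwise (\<lambda>A B. interior A \<inter> interior B = {}) \<D>"
        "\<And>u v. cbox u v \<in> \<D> \<Longrightarrow> \<exists>n. \<forall>i \<in> Basis. v \<bullet> i - u \<bullet> i = (1 \<bullet> i - 0 \<bullet> i)/2^n"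
        "\<And>K. \<lbrakk>K \<in> \<D>; box 0 (1::real) \<noteq> {}\<rbrakk> \<Longrightarrow> interior K \<noteq> {}"
        "?S \<subseteq> \<Union>\<D>" "\<Union>\<D> \<in> lmeasurable" "measure lebesgue (\<Union>\<D>) \<le> measure lebesgue ?S + \<delta>/2"
        by (rule measurable_outer_intervals_bounded[OF _ _ half_gt_zero[OF \<delta>]]) (rule that)
      have m\<D>: "measure lebesgue (\<Union>\<D>) < \<delta>"
        using \<D>(8) Sl \<delta> by (simp add: null_sets_def measure_def)
      have K: "K = {Inf K..Sup K}" "0 \<le> Inf K" "Inf K \<le> Sup K" "Sup K \<le> 1" if "K \<in> \<D>" for K
      proof -
        obtain c d where cd: "K = {c..d}" "K \<noteq> {}" "K \<subseteq> {0..1}" using \<D>(2)[OF \<open>K \<in> \<D>\<close>] by (auto simp: cbox_interval)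
        then show "K = {Inf K..Sup K}" "0 \<le> Inf K" "Inf K \<le> Sup K" "Sup K \<le> 1" by auto
      qed
      have fin: "measure ?\<mu> (\<Union>I) \<le> e" if I: "I \<subseteq> \<D>" "finite I" for I
      proof -
        \<comment> \<open>Absolute continuity sums over a set of pairs of endpoints, so the
          subfamily is encoded that way; injectivity keeps terms of the sums from merging.\<close>
        let ?p = "\<lambda>K. (Inf K :: real, Sup K :: real)"
        have inj: "inj_on ?p I"
        proof (rule inj_onI)
          fix A B assume "A \<in> I" "B \<in> I" "?p A = ?p B"
          then show "A = B" using K(1)[of A] K(1)[of B] I(1) by auto
        qed
        have "(\<Sum>(u, v)\<in>?p ` I. \<bar>f v - f u\<bar>) < e"
        proof (rule D, intro conjI)
          show "finite (?p ` I)" using I by simp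
          show "\<forall>(u, v)\<in>?p ` I. 0 \<le> u \<and> u \<le> v \<and> v \<le> 1" using K I(1) by auto
          show "pairwise (\<lambda>(u, v) (u', v'). {u<..<v} \<inter> {u'<..<v'} = {}) (?p ` I)"
          proof (rule pairwiseI)
            fix a b assume ab: "a \<in> ?p ` I" "b \<in> ?p ` I" "a \<noteq> b"
            then obtain A B where AB: "a = ?p A" "b = ?p B" "A \<in> I" "B \<in> I" "A \<noteq> B" by auto
            then have "interior A \<inter> interior B = {}"
              using \<D>(3) I(1) unfolding pairwise_def by blast
            moreover have "interior A = {Inf A<..<Sup A}" "interior B = {Inf B<..<Sup B}"
              using arg_cong[OF K(1)[of A], of interior] arg_cong[OF K(1)[of B], of interior] AB I(1) by auto
            ultimately show "(case a of (u, v) \<Rightarrow> \<lambda>(u', v'). {u<..<v} \<inter> {u'<..<v'} = {}) b"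
              using AB by simp
          qed
          have "(\<Sum>(u, v)\<in>?p ` I. v - u) = (\<Sum>K\<in>I. Sup K - Inf K)"
            by (simp add: sum.reindex[OF inj])
          also have "\<dots> = (\<Sum>K\<in>I. measure lebesgue K)"
          proof (rule sum.cong[OF refl])
            fix A assume "A \<in> I"
            then have "A \<in> \<D>" using I(1) by blast
            note k = K[OF this]
            have "measure lebesgue {Inf A..Sup A} = Sup A - Inf A" using k(3) by simp
            then show "Sup A - Inf A = measure lebesgue A" using k(1) by simp
          qed
          also have "\<dots> = measure lebesgue (\<Union>I)"
          proof (rule measure_negligible_finite_Union[symmetric])
            show "finite I" by fact
            show "S \<in> lmeasurable" if "S \<in> I" for S
              using \<D>(2) that I(1) by (metis lmeasurable_cbox subsetD)
            show "pairwise (\<lambda>S T. negligible (S \<inter> T)) I"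
            proof (rule pairwiseI)
              fix A B assume AB: "A \<in> I" "B \<in> I" "A \<noteq> B"
              then have "A \<in> \<D>" "B \<in> \<D>" using I(1) by auto
              note k = K[OF this(1)] K[OF this(2)]
              have "interior A \<inter> interior B = {}" using \<D>(3) I(1) AB unfolding pairwise_def by blast
              moreover have "interior A = {Inf A<..<Sup A}" "interior B = {Inf B<..<Sup B}"
                using arg_cong[OF k(1), of interior] arg_cong[OF k(5), of interior] by simp_all
              ultimately have *: "{Inf A<..<Sup A} \<inter> {Inf B<..<Sup B} = {}" by simp
              have "A \<inter> B \<subseteq> {Inf A, Sup A, Inf B, Sup B}"
              proof
                fix x assume "x \<in> A \<inter> B"
                then have "x \<in> {Inf A..Sup A}" "x \<in> {Inf B..Sup B}" using k(1,5) by auto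
                moreover have "x \<notin> {Inf A<..<Sup A} \<inter> {Inf B<..<Sup B}" using * by simp
                ultimately show "x \<in> {Inf A, Sup A, Inf B, Sup B}" by auto
              qed
              then show "negligible (A \<inter> B)"
                by (meson finite.emptyI finite.insertI negligible_finite negligible_subset)
            qed
          qed
          also have "\<dots> \<le> measure lebesgue (\<Union>\<D>)"
          proof (rule measure_mono_fmeasurable[OF _ _ \<D>(7)])
            show "\<Union>I \<in> sets lebesgue"
            proof (rule sets.finite_Union[OF I(2)], rule subsetI)
              fix S assume "S \<in> I"
              then show "S \<in> sets lebesgue"
                using \<D>(2) I(1) by (metis lmeasurable_cbox fmeasurableD subsetD)
            qed
          qed (use I in auto)
          finally show "(\<Sum>(u, v)\<in>?p ` I. v - u) < \<delta>" using m\<D> by simp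
        qed
        then have 1: "(\<Sum>K\<in>I. \<bar>f (Sup K) - f (Inf K)\<bar>) < e" by (simp add: sum.reindex[OF inj])
        have "measure ?\<mu> (\<Union>I) \<le> (\<Sum>K\<in>I. measure ?\<mu> K)"
        proof -
          have "K \<in> sets ?\<mu>" if "K \<in> I" for K
          proof -
            have "K \<in> \<D>" using that I(1) by blast
            then obtain c d where "K = cbox c d" using \<D>(2) by blast
            then show ?thesis by simp
          qed
          then show ?thesis using measure_UNION_le[OF I(2), of "\<lambda>K. K" ?\<mu>] by simp
        qed
        also have "\<dots> = (\<Sum>K\<in>I. \<bar>f (Sup K) - f (Inf K)\<bar>)"
        proof (rule sum.cong[OF refl])
          fix A assume "A \<in> I"
          then have "A \<in> \<D>" using I(1) by blast
          note k = K[OF this]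
          have "emeasure ?\<mu> A = ennreal (F (Sup A) - F (Inf A))" using Icc[OF k(3)] k(1) by simp
          also have "F (Sup A) - F (Inf A) = \<bar>f (Sup A) - f (Inf A)\<bar>"
            using mono[OF k(3)] k by (simp add: F01)
          finally show "measure ?\<mu> A = \<bar>f (Sup A) - f (Inf A)\<bar>" by (simp add: measure_def)
        qed
        finally show ?thesis using 1 by simp
      qed
      have fm: "K \<in> fmeasurable ?\<mu>" if KD: "K \<in> \<D>" for K
      proof (rule fmeasurableI)
        obtain c d where "K = cbox c d" using \<D>(2)[OF KD] by blast
        then show "K \<in> sets ?\<mu>" by simp
        show "emeasure ?\<mu> K < \<infinity>" using Icc[OF K(3)[OF KD]] K(1)[OF KD] by simp
      qed
      have "\<Union>\<D> \<in> fmeasurable ?\<mu>"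
        using fmeasurable_UN_bound[OF \<D>(1), of "\<lambda>K. K" ?\<mu> e] fm fin by simp
      moreover have "measure ?\<mu> (\<Union>\<D>) \<le> e"
        using measure_UN_bound[OF \<D>(1), of "\<lambda>K. K" ?\<mu> e] fm fin by simp
      ultimately show ?thesis
        using measure_mono_fmeasurable[OF \<D>(6), of ?\<mu>] Zb by force
    qed
    then have "measure ?\<mu> ?S \<le> 0" by (rule field_le_epsilon) simp
    moreover have "emeasure ?\<mu> ?S < \<infinity>"
    proof -
      have "emeasure ?\<mu> ?S \<le> emeasure ?\<mu> {0..1}" using Zb by (intro emeasure_mono) auto
      then show ?thesis using Icc[of 0 1] by (auto simp: less_top[symmetric] top_unique)
    qed
    ultimately show ?thesis using Zb
      by (intro null_setsI) (auto simp: emeasure_eq_ennreal_measure measure_le_0_iff)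
  qed
  show ?thesis
    unfolding absolutely_continuous_def
  proof
    fix Z :: "real set" assume Z: "Z \<in> null_sets lborel"
    have "(Z \<inter> {0..1}) \<union> {..<0} \<union> {1<..} \<in> null_sets ?\<mu>"
      using mid[OF Z] left right by auto
    moreover have "Z \<subseteq> (Z \<inter> {0..1}) \<union> {..<0} \<union> {1<..}" by auto
    ultimately show "Z \<in> null_sets ?\<mu>" using Z
      by (metis (no_types, lifting) null_sets_subset null_setsD2 sets_lborel sets_interval_measure)
  qed
qed

lemma AC0_plus_density:
  assumes f: "f \<in> AC0_plus"
  obtains g :: "real \<Rightarrow> real" where "g \<in> borel_measurable borel" "\<And>x. 0 \<le> g x" "integrable lborel g"
    "\<And>u v. 0 \<le> u \<Longrightarrow> u \<le> v \<Longrightarrow> v \<le> 1 \<Longrightarrow> (\<integral>\<^sup>+y\<in>{u<..v}. ennreal (g y) \<partial>lborel) = ennreal (f v - f u)"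
    "\<And>u v. 0 \<le> u \<Longrightarrow> u \<le> v \<Longrightarrow> v \<le> 1 \<Longrightarrow> f v - f u = (LINT y:{u<..v}|lborel. g y)"
proof -
  define F where "F x = f (max 0 (min 1 x))" for x
  have F01: "F x = f x" if "x \<in> {0..1}" for x using that by (auto simp: F_def)
  have F0: "F x = f 0" if "x \<le> 0" for x using that by (auto simp: F_def)
  have F1: "F x = f 1" if "x \<ge> 1" for x using that by (auto simp: F_def)
  have mono: "F x \<le> F y" if "x \<le> y" for x y
    using mono_onD[OF AC0_plusD(2)[OF f], of "max 0 (min 1 x)" "max 0 (min 1 y)"] that
    by (auto simp: F_def)
  have cont: "continuous_on UNIV F"
    unfolding F_def
    by (rule continuous_on_compose2[OF absolutely_continuous_on_imp_continuous_on[OF AC0_plusD(1)[OF f]]])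
      (auto intro!: continuous_intros)
  have contR: "continuous (at_right a) F" for a
    using cont by (simp add: continuous_on_eq_continuous_within continuous_at_imp_continuous_at_within)
  let ?\<mu> = "interval_measure F"
  have Ioc: "emeasure ?\<mu> {a<..b} = ennreal (F b - F a)" if "a \<le> b" for a b
    by (rule emeasure_interval_measure_Ioc[OF that mono contR])
  have ac: "absolutely_continuous lborel ?\<mu>"
    using absolutely_continuous_interval_measure[OF f] by (simp add: F_def[abs_def])
  obtain G where G: "G \<in> borel_measurable lborel" "density lborel G = ?\<mu>"
    using sigma_finite_measure.Radon_Nikodym[OF sigma_finite_lborel ac] by auto
  have Gm[measurable]: "G \<in> borel_measurable borel" using G(1) by simp
  have Gint: "(\<integral>\<^sup>+y\<in>{u<..v}. G y \<partial>lborel) = ennreal (F v - F u)" if "u \<le> v" for u v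
    using Ioc[OF that] by (simp add: emeasure_density flip: G(2))
  \<comment> \<open>The Radon-Nikodym density may be infinite on a null set, where
    \<open>enn2real\<close> puts a real value; the indicator restricts it to the unit
    interval.\<close>
  define g where "g y = enn2real (G y * indicator {0<..1} y)" for y
  have gm[measurable]: "g \<in> borel_measurable borel" unfolding g_def by measurable
  have "(\<integral>\<^sup>+y. G y * indicator {0<..1} y \<partial>lborel) \<noteq> \<infinity>"
    using Gint[of 0 1] by simp
  then have "AE y in lborel. G y * indicator {0<..1} y \<noteq> \<infinity>"
    by (intro nn_integral_PInf_AE) auto
  then have ae: "AE y in lborel. ennreal (g y) = G y * indicator {0<..1} y"
    by eventually_elim (simp add: g_def less_top)
  have A: "(\<integral>\<^sup>+y\<in>{u<..v}. ennreal (g y) \<partial>lborel) = ennreal (f v - f u)" if uv: "0 \<le> u" "u \<le> v" "v \<le> 1" for u v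
  proof -
    have "(\<integral>\<^sup>+y\<in>{u<..v}. ennreal (g y) \<partial>lborel) = (\<integral>\<^sup>+y\<in>{u<..v}. G y \<partial>lborel)"
    proof (rule nn_integral_cong_AE)
      show "AE y in lborel. ennreal (g y) * indicator {u<..v} y = G y * indicator {u<..v} y"
        using ae by eventually_elim (use uv in \<open>auto simp: indicator_def\<close>)
    qed
    also have "\<dots> = ennreal (f v - f u)" using Gint[OF uv(2)] uv by (simp add: F01)
    finally show ?thesis .
  qed
  have g0: "0 \<le> g y" for y by (simp add: g_def)
  have gi: "integrable lborel g"
  proof (rule integrableI_nonneg)
    have "(\<integral>\<^sup>+y. ennreal (g y) \<partial>lborel) = (\<integral>\<^sup>+y\<in>{0<..1}. ennreal (g y) \<partial>lborel)"
      by (rule nn_integral_cong) (auto simp: g_def indicator_def)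
    then show "(\<integral>\<^sup>+y. ennreal (g y) \<partial>lborel) < \<infinity>" using A[of 0 1] by simp
  qed (use g0 in auto)
  have B: "f v - f u = (LINT y:{u<..v}|lborel. g y)" if uv: "0 \<le> u" "u \<le> v" "v \<le> 1" for u v
  proof -
    have "integrable lborel (\<lambda>y. indicator {u<..v} y *\<^sub>R g y)"
      by (rule integrable_mult_indicator[OF _ gi]) simp
    then have "ennreal (LINT y:{u<..v}|lborel. g y) = (\<integral>\<^sup>+y. ennreal (indicator {u<..v} y *\<^sub>R g y) \<partial>lborel)"
      unfolding set_lebesgue_integral_def using g0 by (intro nn_integral_eq_integral[symmetric]) auto
    also have "\<dots> = (\<integral>\<^sup>+y\<in>{u<..v}. ennreal (g y) \<partial>lborel)"
      by (rule nn_integral_cong) (auto simp: indicator_def)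
    finally have "ennreal (LINT y:{u<..v}|lborel. g y) = ennreal (f v - f u)" using A[OF uv] by simp
    moreover have "0 \<le> (LINT y:{u<..v}|lborel. g y)"
      unfolding set_lebesgue_integral_def using g0 by (intro integral_nonneg_AE) auto
    moreover have "0 \<le> f v - f u" using mono_onD[OF AC0_plusD(2)[OF f], of u v] uv by auto
    ultimately show ?thesis by (simp add: ennreal_inj)
  qed
  show ?thesis by (rule that[OF gm g0 gi A B])
qed

section \<open>The cost of a path\<close>

lemma AC0_plus_derivative:
  assumes f: "f \<in> AC0_plus"
  obtains g :: "real \<Rightarrow> real" where "g \<in> borel_measurable borel" "\<And>x. 0 \<le> g x"
    "AE x in lborel. x \<in> {0<..<1} \<longrightarrow> (f has_real_derivative g x) (at x)"
    "\<And>u v. 0 \<le> u \<Longrightarrow> u \<le> v \<Longrightarrow> v \<le> 1 \<Longrightarrow> (\<integral>\<^sup>+y\<in>{u<..v}. ennreal (g y) \<partial>lborel) = ennreal (f v - f u)"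
proof -
  obtain g where g: "g \<in> borel_measurable borel" "\<And>x. 0 \<le> g x" "integrable lborel g"
    "\<And>u v. 0 \<le> u \<Longrightarrow> u \<le> v \<Longrightarrow> v \<le> 1 \<Longrightarrow> (\<integral>\<^sup>+y\<in>{u<..v}. ennreal (g y) \<partial>lborel) = ennreal (f v - f u)"
    "\<And>u v. 0 \<le> u \<Longrightarrow> u \<le> v \<Longrightarrow> v \<le> 1 \<Longrightarrow> f v - f u = (LINT y:{u<..v}|lborel. g y)"
    by (rule AC0_plus_density[OF f]) (rule that)
  show ?thesis
    by (rule that[OF g(1,2) AE_has_derivative_indefinite_integral[OF g(3,5)] g(4)])
qed

text \<open>Young's inequality for the Legendre pair:
  \<open>\<theta> * y - l * (exp \<theta> - 1)\<close> is at most the cost, by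
  \<open>ln x \<le> x - 1\<close> at \<open>x = l * exp \<theta> / y\<close>. Every term stands on
  the side where it is nonnegative, and \<theta> is split into its positive and negative part,
  because subtraction in \<open>ennreal\<close> truncates. The rate is enlarged to h only in the
  exponential term.\<close>

lemma local_cost_dual:
  fixes y l h \<theta> :: real
  assumes "0 \<le> y" "0 \<le> l" "l \<le> h"
  shows "ennreal (max 0 \<theta> * y) + ennreal l \<le> ennreal (max 0 (- \<theta>) * y) + ennreal (h * exp \<theta>) + local_cost y l"
proof -
  consider "y = 0" | "y > 0" "l = 0" | "y > 0" "l > 0" using assms by linarith
  then show ?thesis
  proof cases
    case 1
    then show ?thesis by (simp add: local_cost_def)
  next
    case 2
    then show ?thesis by (simp add: local_cost_def)
  next
    case 3
    have "ln (l * exp \<theta> / y) \<le> l * exp \<theta> / y - 1"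
      using 3 by (intro ln_le_minus_one) simp
    moreover have "ln (l * exp \<theta> / y) = \<theta> - ln (y / l)"
      using 3 by (simp add: ln_div ln_mult)
    ultimately have "y * (\<theta> - ln (y / l)) \<le> y * (l * exp \<theta> / y - 1)"
      using 3 by (intro mult_left_mono) auto
    also have "\<dots> = l * exp \<theta> - y" using 3 by (simp add: field_simps)
    also have "\<dots> \<le> h * exp \<theta> - y" using assms by (simp add: mult_right_mono)
    finally have *: "\<theta> * y \<le> y * ln (y / l) - y + h * exp \<theta>" by (simp add: algebra_simps)
    have "ln (l / y) \<le> l / y - 1" using 3 by (intro ln_le_minus_one) simp
    then have "y * ln (l / y) \<le> y * (l / y - 1)" using 3 by (intro mult_left_mono) auto
    then have nn: "0 \<le> y * ln (y / l) - y + l"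
      using 3 by (simp add: ln_div algebra_simps)
    have "max 0 \<theta> * y - max 0 (- \<theta>) * y = \<theta> * y" by (auto simp: max_def)
    with * have "max 0 \<theta> * y + l \<le> max 0 (- \<theta>) * y + h * exp \<theta> + (y * ln (y / l) - y + l)" by simp
    then show ?thesis using 3 assms nn
      by (simp add: local_cost_def flip: ennreal_plus)
  qed
qed

text \<open>Optimising over \<theta> turns the linear bounds back into an entropy, with optimum
  \<open>ln (m / (h * d))\<close>. For m = 0 the supremum is only approached as \<theta> tends to
  minus infinity. For h = 0 < m it would be infinite, which gives the first conclusion.\<close>

lemma legendre_bound:
  fixes m l h d C :: real
  assumes bound: "\<And>\<theta>. \<theta> * m + l * d \<le> h * exp \<theta> * d + C"
    and m: "0 \<le> m" and h: "0 \<le> h" and d: "0 < d"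
  shows "m = 0 \<or> 0 < h" "m * ln (m / (h * d)) - m + l * d \<le> C"
proof -
  show *: "m = 0 \<or> 0 < h"
  proof (rule ccontr)
    assume "\<not> (m = 0 \<or> 0 < h)"
    then have "m > 0" "h = 0" using m h by auto
    then show False using bound[of "(C - l * d + 1) / m"] by simp
  qed
  show "m * ln (m / (h * d)) - m + l * d \<le> C"
  proof (cases "m = 0")
    case False
    then show ?thesis using bound[of "ln (m / (h * d))"] m d * by (simp add: field_simps)
  next
    case True
    have "l * d \<le> C"
    proof (cases "h = 0")
      case True
      then show ?thesis using bound[of 0] \<open>m = 0\<close> by simp
    next
      case False
      then have hd: "h * d > 0" using h d by simp
      show ?thesis
      proof (rule ccontr)
        assume "\<not> l * d \<le> C"
        then have p: "0 < (l * d - C) / (2 * (h * d))" using hd by simp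
        \<comment> \<open>This \<theta> makes the exponential term half of the supposed gap
          \<open>l * d - C\<close>.\<close>
        have "h * exp (ln ((l * d - C) / (2 * (h * d)))) * d = (l * d - C) / 2"
          unfolding exp_ln[OF p] using \<open>h \<noteq> 0\<close> d by simp
        then show False using bound[of "ln ((l * d - C) / (2 * (h * d)))"] True \<open>\<not> l * d \<le> C\<close> by simp
      qed
    qed
    then show ?thesis using True by simp
  qed
qed

definition cost_on :: "(real \<Rightarrow> real) \<Rightarrow> (real \<Rightarrow> real) \<Rightarrow> real \<Rightarrow> real \<Rightarrow> ennreal" where
  "cost_on lam f a b = (\<integral>\<^sup>+ \<alpha>\<in>{a..b}. local_cost (deriv f \<alpha>) (lam (f \<alpha> / \<alpha>)) \<partial>lborel)"

lemma path_cost_eq_cost_on: "path_cost lam f = cost_on lam f 0 1"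
  by (simp add: path_cost_def cost_on_def)

lemma AC0_plus_nonneg: "f \<in> AC0_plus \<Longrightarrow> x \<in> {0..1} \<Longrightarrow> 0 \<le> f x"
  using mono_onD[OF AC0_plusD(2), of f 0 x] AC0_plusD(3)[of f] by auto

locale bounded_rate =
  fixes lam :: "real \<Rightarrow> real" and C\<^sub>0 K :: real
  assumes lam_nonneg: "\<And>x. 0 \<le> x \<Longrightarrow> 0 \<le> lam x"
    and lam_incr: "mono_on {0..} lam"
    and lam_bounded: "\<And>x. 0 \<le> x \<Longrightarrow> lam x \<le> C\<^sub>0"
    and K_pos: "0 < K"
    and lam_lipschitz: "K-lipschitz_on {0..} lam"
begin

lemma lam_mono: "0 \<le> x \<Longrightarrow> x \<le> y \<Longrightarrow> lam x \<le> lam y"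
  using mono_onD[OF lam_incr] by simp

lemma lam_diff: "0 \<le> x \<Longrightarrow> x \<le> y \<Longrightarrow> lam y - lam x \<le> K * (y - x)"
  using lipschitz_onD[OF lam_lipschitz, of y x] lam_mono[of x y] by (auto simp: dist_real_def)

lemma C0_nonneg: "0 \<le> C\<^sub>0"
  using lam_nonneg[of 0] lam_bounded[of 0] by simp

text \<open>Replaces \<open>deriv f\<close> by the density g and the rate along the path by a Borel
  function l on the whole line, so that cost integrals can be split and added. Clamping the argument
  of f to [0,1] makes l measurable everywhere.\<close>

lemma cost_representation:
  assumes f: "f \<in> AC0_plus"
  obtains g l :: "real \<Rightarrow> real" where "g \<in> borel_measurable borel" "\<And>x. 0 \<le> g x"
    "l \<in> borel_measurable borel" "\<And>x. 0 \<le> l x" "\<And>x. x \<in> {0..1} \<Longrightarrow> l x = lam (f x / x)"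
    "(\<lambda>x. local_cost (g x) (l x)) \<in> borel_measurable borel"
    "AE x in lborel. x \<in> {0<..<1} \<longrightarrow> (f has_real_derivative g x) (at x)"
    "\<And>u v. 0 \<le> u \<Longrightarrow> u \<le> v \<Longrightarrow> v \<le> 1 \<Longrightarrow> (\<integral>\<^sup>+y\<in>{u<..v}. ennreal (g y) \<partial>lborel) = ennreal (f v - f u)"
    "\<And>a b. 0 \<le> a \<Longrightarrow> b \<le> 1 \<Longrightarrow> cost_on lam f a b = (\<integral>\<^sup>+ x\<in>{a..b}. local_cost (g x) (l x) \<partial>lborel)"
proof -
  obtain g where g[measurable]: "g \<in> borel_measurable borel" and g0: "\<And>x. 0 \<le> g x"
    and gd: "AE x in lborel. x \<in> {0<..<1} \<longrightarrow> (f has_real_derivative g x) (at x)"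
    and gi: "\<And>u v. 0 \<le> u \<Longrightarrow> u \<le> v \<Longrightarrow> v \<le> 1 \<Longrightarrow> (\<integral>\<^sup>+y\<in>{u<..v}. ennreal (g y) \<partial>lborel) = ennreal (f v - f u)"
    by (rule AC0_plus_derivative[OF f]) (rule that)
  define F where "F x = f (max 0 (min 1 x))" for x
  have "continuous_on UNIV F"
    unfolding F_def
    by (rule continuous_on_compose2[OF absolutely_continuous_on_imp_continuous_on[OF AC0_plusD(1)[OF f]]])
      (auto intro!: continuous_intros)
  then have [measurable]: "F \<in> borel_measurable borel" by (rule borel_measurable_continuous_onI)
  have "continuous_on UNIV (\<lambda>x. lam (max 0 x))"
    by (rule continuous_on_compose2[OF lipschitz_on_continuous_on[OF lam_lipschitz]])
      (auto intro!: continuous_intros)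
  then have lm: "(\<lambda>x. lam (max 0 x)) \<in> borel_measurable borel" by (rule borel_measurable_continuous_onI)
  define l where "l x = lam (max 0 (F x / x))" for x
  have l[measurable]: "l \<in> borel_measurable borel"
    unfolding l_def by (rule measurable_compose[OF _ lm]) measurable
  have l0: "0 \<le> l x" for x by (simp add: l_def lam_nonneg)
  have l1: "l x = lam (f x / x)" if "x \<in> {0..1}" for x
    using that AC0_plus_nonneg[OF f that] by (auto simp: l_def F_def max_def)
  have cm: "(\<lambda>x. local_cost (g x) (l x)) \<in> borel_measurable borel"
    unfolding local_cost_def by measurable
  have "{0, 1::real} \<in> null_sets lborel" by (intro finite_imp_null_set_lborel) auto
  then have "AE x in lborel. x \<notin> {0, 1::real}" by (rule AE_not_in)
  then have c: "cost_on lam f a b = (\<integral>\<^sup>+ x\<in>{a..b}. local_cost (g x) (l x) \<partial>lborel)" if "0 \<le> a" "b \<le> 1" for a b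
    unfolding cost_on_def
  proof (intro nn_integral_cong_AE)
    show "AE x in lborel. local_cost (deriv f x) (lam (f x / x)) * indicator {a..b} x = local_cost (g x) (l x) * indicator {a..b} x"
      using gd \<open>AE x in lborel. x \<notin> {0, 1::real}\<close>
      by eventually_elim (use that l1 in \<open>auto simp: indicator_def DERIV_imp_deriv\<close>)
  qed
  show ?thesis by (rule that[OF g g0 l l0 l1 cm gd gi c])
qed

lemma cost_on_split:
  assumes f: "f \<in> AC0_plus" and abc: "0 \<le> a" "a \<le> b" "b \<le> c" "c \<le> 1"
  shows "cost_on lam f a c = cost_on lam f a b + cost_on lam f b c"
proof -
  obtain g l where gl: "(\<lambda>x. local_cost (g x) (l x)) \<in> borel_measurable borel"
    "\<And>a b. 0 \<le> a \<Longrightarrow> b \<le> 1 \<Longrightarrow> cost_on lam f a b = (\<integral>\<^sup>+ x\<in>{a..b}. local_cost (g x) (l x) \<partial>lborel)"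
    by (rule cost_representation[OF f]) (rule that)
  let ?c = "\<lambda>x. local_cost (g x) (l x)"
  note [measurable] = gl(1)
  have b: "AE x in lborel. x \<noteq> b" by (rule AE_lborel_singleton)
  have "(\<integral>\<^sup>+ x\<in>{a..c}. ?c x \<partial>lborel) = (\<integral>\<^sup>+ x. ?c x * indicator {a..b} x + ?c x * indicator {b..c} x \<partial>lborel)"
  proof (intro nn_integral_cong_AE)
    show "AE x in lborel. ?c x * indicator {a..c} x = ?c x * indicator {a..b} x + ?c x * indicator {b..c} x"
      using b by eventually_elim (use abc in \<open>auto simp: indicator_def\<close>)
  qed
  also have "\<dots> = (\<integral>\<^sup>+ x\<in>{a..b}. ?c x \<partial>lborel) + (\<integral>\<^sup>+ x\<in>{b..c}. ?c x \<partial>lborel)"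
    by (rule nn_integral_add) measurable
  finally show ?thesis using abc by (simp add: gl(2))
qed

text \<open>Integrates the pointwise dual inequality with one constant \<theta>, so that only the
  increment of f enters: Jensen's inequality before optimisation. The integral of the rate is kept
  as it is, because truncating a path saves precisely this quantity.\<close>

lemma cost_on_dual:
  assumes f: "f \<in> AC0_plus" and ab: "0 \<le> a" "a \<le> b" "b \<le> 1"
    and h: "\<And>x. a < x \<Longrightarrow> x \<le> b \<Longrightarrow> lam (f x / x) \<le> h"
  shows "ennreal (max 0 \<theta> * (f b - f a)) + (\<integral>\<^sup>+x\<in>{a..b}. ennreal (lam (f x / x)) \<partial>lborel)
     \<le> ennreal (max 0 (- \<theta>) * (f b - f a)) + ennreal (h * exp \<theta> * (b - a)) + cost_on lam f a b"
proof (cases "a = b")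
  case True
  then show ?thesis by simp
next
  case False
  obtain g l where [measurable]: "g \<in> borel_measurable borel" "l \<in> borel_measurable borel"
    "(\<lambda>x. local_cost (g x) (l x)) \<in> borel_measurable borel"
    and g0: "\<And>x. 0 \<le> g x" and l0: "\<And>x. 0 \<le> l x" and l: "\<And>x. x \<in> {0..1} \<Longrightarrow> l x = lam (f x / x)"
    and gi: "\<And>u v. 0 \<le> u \<Longrightarrow> u \<le> v \<Longrightarrow> v \<le> 1 \<Longrightarrow> (\<integral>\<^sup>+y\<in>{u<..v}. ennreal (g y) \<partial>lborel) = ennreal (f v - f u)"
    and c: "\<And>a b. 0 \<le> a \<Longrightarrow> b \<le> 1 \<Longrightarrow> cost_on lam f a b = (\<integral>\<^sup>+ x\<in>{a..b}. local_cost (g x) (l x) \<partial>lborel)"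
    by (rule cost_representation[OF f]) (rule that)
  have h0: "0 \<le> h"
    using h[of b] False ab lam_nonneg[of "f b / b"] AC0_plus_nonneg[OF f, of b] by auto
  let ?I = "\<lambda>u. (\<integral>\<^sup>+x\<in>{a<..b}. u x \<partial>lborel)"
  have half: "(\<integral>\<^sup>+x\<in>{a..b}. u x \<partial>lborel) = ?I u" for u
  proof (intro nn_integral_cong_AE)
    have "AE x in lborel. x \<noteq> a" by (rule AE_lborel_singleton)
    then show "AE x in lborel. u x * indicator {a..b} x = u x * indicator {a<..b} x"
      by eventually_elim (auto simp: indicator_def)
  qed
  have gint: "?I (\<lambda>x. ennreal (q * g x)) = ennreal (q * (f b - f a))" if "q \<ge> 0" for q
  proof -
    have "?I (\<lambda>x. ennreal (q * g x)) = (\<integral>\<^sup>+x. ennreal q * (ennreal (g x) * indicator {a<..b} x) \<partial>lborel)"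
      using that g0 by (simp add: ennreal_mult mult.assoc)
    also have "\<dots> = ennreal q * ?I (\<lambda>x. ennreal (g x))" by (rule nn_integral_cmult) measurable
    also have "\<dots> = ennreal (q * (f b - f a))"
      using that mono_onD[OF AC0_plusD(2)[OF f], of a b] ab by (subst gi) (auto simp: ennreal_mult)
    finally show ?thesis .
  qed
  have "ennreal (max 0 \<theta> * (f b - f a)) + (\<integral>\<^sup>+x\<in>{a..b}. ennreal (lam (f x / x)) \<partial>lborel)
    = ?I (\<lambda>x. ennreal (max 0 \<theta> * g x)) + ?I (\<lambda>x. ennreal (l x))"
  proof -
    have "?I (\<lambda>x. ennreal (lam (f x / x))) = ?I (\<lambda>x. ennreal (l x))"
      by (rule nn_integral_cong) (use ab l in \<open>auto simp: indicator_def\<close>)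
    then show ?thesis by (simp add: gint half)
  qed
  also have "\<dots> = (\<integral>\<^sup>+x. ennreal (max 0 \<theta> * g x) * indicator {a<..b} x + ennreal (l x) * indicator {a<..b} x \<partial>lborel)"
    by (rule nn_integral_add[symmetric]) measurable
  also have "\<dots> \<le> (\<integral>\<^sup>+x. (ennreal (max 0 (- \<theta>) * g x) * indicator {a<..b} x + ennreal (h * exp \<theta>) * indicator {a<..b} x)
      + local_cost (g x) (l x) * indicator {a<..b} x \<partial>lborel)"
  proof (rule nn_integral_mono)
    fix x
    have "ennreal (max 0 \<theta> * g x) + ennreal (l x) \<le> ennreal (max 0 (- \<theta>) * g x) + ennreal (h * exp \<theta>) + local_cost (g x) (l x)"
      if "x \<in> {a<..b}"
      using that ab l[of x] h[of x] g0 l0[of x] by (intro local_cost_dual) auto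
    then show "ennreal (max 0 \<theta> * g x) * indicator {a<..b} x + ennreal (l x) * indicator {a<..b} x
      \<le> (ennreal (max 0 (- \<theta>) * g x) * indicator {a<..b} x + ennreal (h * exp \<theta>) * indicator {a<..b} x)
      + local_cost (g x) (l x) * indicator {a<..b} x"
      by (auto simp: indicator_def)
  qed
  also have "\<dots> = (\<integral>\<^sup>+x. ennreal (max 0 (- \<theta>) * g x) * indicator {a<..b} x + ennreal (h * exp \<theta>) * indicator {a<..b} x \<partial>lborel)
      + ?I (\<lambda>x. local_cost (g x) (l x))"
    by (rule nn_integral_add) measurable
  also have "(\<integral>\<^sup>+x. ennreal (max 0 (- \<theta>) * g x) * indicator {a<..b} x + ennreal (h * exp \<theta>) * indicator {a<..b} x \<partial>lborel)
    = ?I (\<lambda>x. ennreal (max 0 (- \<theta>) * g x)) + ?I (\<lambda>x. ennreal (h * exp \<theta>))"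
    by (rule nn_integral_add) measurable
  also have "?I (\<lambda>x. ennreal (h * exp \<theta>)) = ennreal (h * exp \<theta> * (b - a))"
    using ab h0 by (simp add: nn_integral_cmult_indicator ennreal_mult)
  also have "?I (\<lambda>x. local_cost (g x) (l x)) = cost_on lam f a b"
    using ab by (simp add: c half)
  finally show ?thesis by (simp add: gint)
qed

text \<open>Once the rate is frozen, a straight segment is the cheapest way to gain a given
  increment; optimising \<theta> in the dual bound replaces a convexity argument. The upper bound h
  of the rate enters the logarithm, the lower bound l the linear term.\<close>

lemma cost_on_ge_segment:
  assumes f: "f \<in> AC0_plus" and ab: "0 \<le> a" "a < b" "b \<le> 1"
    and h: "\<And>x. a < x \<Longrightarrow> x \<le> b \<Longrightarrow> lam (f x / x) \<le> h"
    and l: "\<And>x. a < x \<Longrightarrow> x \<le> b \<Longrightarrow> l \<le> lam (f x / x)" and l0: "0 \<le> l"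
    and C: "cost_on lam f a b \<le> ennreal C" "0 \<le> C"
  shows "f a = f b \<or> 0 < h"
    "(f b - f a) * ln ((f b - f a) / (h * (b - a))) - (f b - f a) + l * (b - a) \<le> C"
proof -
  have m: "0 \<le> f b - f a" using mono_onD[OF AC0_plusD(2)[OF f], of a b] ab by auto
  have h0: "0 \<le> h" using h[of b] l[of b] l0 ab by auto
  have "\<theta> * (f b - f a) + l * (b - a) \<le> h * exp \<theta> * (b - a) + C" for \<theta>
  proof -
    have "ennreal (l * (b - a)) = (\<integral>\<^sup>+x\<in>{a<..b}. ennreal l \<partial>lborel)"
      using ab l0 by (simp add: nn_integral_cmult_indicator ennreal_mult)
    also have "\<dots> \<le> (\<integral>\<^sup>+x\<in>{a..b}. ennreal (lam (f x / x)) \<partial>lborel)"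
      by (rule nn_integral_mono) (use l in \<open>auto simp: indicator_def intro!: ennreal_leI\<close>)
    finally have "ennreal (max 0 \<theta> * (f b - f a)) + ennreal (l * (b - a)) \<le>
      ennreal (max 0 (- \<theta>) * (f b - f a)) + ennreal (h * exp \<theta> * (b - a)) + ennreal C"
      using cost_on_dual[OF f ab(1) less_imp_le[OF ab(2)] ab(3) h, of \<theta>] C(1)
      by (meson add_left_mono order_trans)
    then have "max 0 \<theta> * (f b - f a) + l * (b - a) \<le> max 0 (- \<theta>) * (f b - f a) + h * exp \<theta> * (b - a) + C"
      using m h0 l0 ab C(2) by (simp flip: ennreal_plus add: ennreal_le_iff)
    moreover have "max 0 \<theta> * (f b - f a) - max 0 (- \<theta>) * (f b - f a) = \<theta> * (f b - f a)" by (auto simp: max_def)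
    ultimately show ?thesis by linarith
  qed
  note * = legendre_bound[of "f b - f a" l "b - a" h C, OF this m h0]
  show "f a = f b \<or> 0 < h" using *(1) ab by auto
  show "(f b - f a) * ln ((f b - f a) / (h * (b - a))) - (f b - f a) + l * (b - a) \<le> C"
    using *(2) ab by auto
qed

lemma cost_on_cong:
  assumes "\<And>x. a < x \<Longrightarrow> x < b \<Longrightarrow> f x = f' x"
  shows "cost_on lam f a b = cost_on lam f' a b"
  unfolding cost_on_def
proof (intro nn_integral_cong_AE)
  have "AE x in lborel. x \<noteq> a" "AE x in lborel. x \<noteq> b" by (rule AE_lborel_singleton)+
  then show "AE x in lborel. local_cost (deriv f x) (lam (f x / x)) * indicator {a..b} x =
      local_cost (deriv f' x) (lam (f' x / x)) * indicator {a..b} x"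
  proof eventually_elim
    case (elim x)
    have "deriv f x = deriv f' x" if "a < x" "x < b"
    proof (rule deriv_cong_ev[OF _ refl])
      show "\<forall>\<^sub>F y in nhds x. f y = f' y"
        unfolding eventually_nhds using that assms by (intro exI[of _ "{a<..<b}"]) auto
    qed
    then show ?case using elim assms by (auto simp: indicator_def)
  qed
qed

lemma cost_on_le_const:
  assumes "\<And>x. a < x \<Longrightarrow> x < b \<Longrightarrow> local_cost (deriv f x) (lam (f x / x)) \<le> ennreal B"
    and "a \<le> b" "0 \<le> B"
  shows "cost_on lam f a b \<le> ennreal (B * (b - a))"
proof -
  have "cost_on lam f a b \<le> (\<integral>\<^sup>+x\<in>{a..b}. ennreal B \<partial>lborel)"
    unfolding cost_on_def
  proof (intro nn_integral_mono_AE)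
    have "AE x in lborel. x \<noteq> a" "AE x in lborel. x \<noteq> b" by (rule AE_lborel_singleton)+
    then show "AE x in lborel. local_cost (deriv f x) (lam (f x / x)) * indicator {a..b} x
      \<le> ennreal B * indicator {a..b} x"
      by eventually_elim (use assms(1) in \<open>auto simp: indicator_def\<close>)
  qed
  also have "\<dots> = ennreal (B * (b - a))"
    using assms by (simp add: nn_integral_cmult_indicator ennreal_mult)
  finally show ?thesis .
qed

text \<open>Following a path to height \<open>x + h\<close> until it reaches \<open>x\<close> and then stopping saves almost all of
  the cost of the remaining part: by duality that part costs at least
  \<open>\<integral> lam (f \<alpha> / \<alpha>) d\<alpha>\<close> minus a small error.\<close>

lemma truncate_path:
  assumes f: "f \<in> AC0_plus" "f 1 = x + h" and x: "0 \<le> x" and h: "0 < h" and C0: "0 < C\<^sub>0"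
  obtains f' where "f' \<in> AC0_plus" "f' 1 = x"
    "path_cost lam f' \<le> path_cost lam f + ennreal (h * \<bar>ln (h / C\<^sub>0)\<bar> + h)"
proof -
  have mono: "f u \<le> f v" if "0 \<le> u" "u \<le> v" "v \<le> 1" for u v
    using mono_onD[OF AC0_plusD(2)[OF f(1)], of u v] that by auto
  have "\<exists>t\<ge>0. t \<le> 1 \<and> f t = x"
    using AC0_plusD(3)[OF f(1)] absolutely_continuous_on_imp_continuous_on[OF AC0_plusD(1)[OF f(1)]] f(2) x h
    by (intro IVT') auto
  then obtain t where t: "0 \<le> t" "t \<le> 1" "f t = x" by blast
  define f' where "f' s = (if s \<le> t then f s else x)" for s
  \<comment> \<open>As a minimum with a constant, \<open>f'\<close> has increments no larger than
    those of f, so it inherits absolute continuity.\<close>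
  have f'm: "f' s = min (f s) x" if "0 \<le> s" "s \<le> 1" for s
    using mono[of s t] mono[of t s] that t by (auto simp: f'_def min_def)
  have "f' \<in> AC0_plus"
    unfolding AC0_plus_def
  proof (intro CollectI conjI)
    show "mono_on {0..1} f'"
    proof (rule mono_onI)
      fix r s :: real assume "r \<in> {0..1}" "s \<in> {0..1}" "r \<le> s"
      then show "f' r \<le> f' s" using mono[of r s] by (auto simp: f'm min_def)
    qed
    show "f' 0 = 0" using t AC0_plusD(3)[OF f(1)] by (simp add: f'_def)
    show "absolutely_continuous_on 0 1 f'"
      unfolding absolutely_continuous_on_def
    proof (intro allI impI)
      fix e :: real assume e: "e > 0"
      obtain d where d: "d > 0" and D: "\<And>D :: (real \<times> real) set.
        finite D \<and> (\<forall>(u, v)\<in>D. 0 \<le> u \<and> u \<le> v \<and> v \<le> 1) \<and>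
        pairwise (\<lambda>(u, v) (u', v'). {u<..<v} \<inter> {u'<..<v'} = {}) D \<and>
        (\<Sum>(u, v)\<in>D. v - u) < d \<Longrightarrow> (\<Sum>(u, v)\<in>D. \<bar>f v - f u\<bar>) < e"
        by (rule absolutely_continuous_onE[OF AC0_plusD(1)[OF f(1)] e]) (rule that)
      have "(\<Sum>(u, v)\<in>D. \<bar>f' v - f' u\<bar>) < e" if H: "finite D \<and> (\<forall>(u, v)\<in>D. 0 \<le> u \<and> u \<le> v \<and> v \<le> 1) \<and>
        pairwise (\<lambda>(u, v) (u', v'). {u<..<v} \<inter> {u'<..<v'} = {}) D \<and>
        (\<Sum>(u, v)\<in>D. v - u) < d" for D
      proof -
        have "(\<Sum>(u, v)\<in>D. \<bar>f' v - f' u\<bar>) \<le> (\<Sum>(u, v)\<in>D. \<bar>f v - f u\<bar>)"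
        proof (rule sum_mono)
          fix p assume "p \<in> D"
          moreover obtain u v where p: "p = (u, v)" by (cases p)
          ultimately have "0 \<le> u" "u \<le> v" "v \<le> 1" using H by auto
          then show "(case p of (u, v) \<Rightarrow> \<bar>f' v - f' u\<bar>) \<le> (case p of (u, v) \<Rightarrow> \<bar>f v - f u\<bar>)"
            by (simp add: p f'm min_def)
        qed
        also have "\<dots> < e" by (rule D[OF H])
        finally show ?thesis .
      qed
      with d show "\<exists>d>0. \<forall>D. finite D \<and> (\<forall>(u, v)\<in>D. 0 \<le> u \<and> u \<le> v \<and> v \<le> 1) \<and>
        pairwise (\<lambda>(u, v) (u', v'). {u<..<v} \<inter> {u'<..<v'} = {}) D \<and>
        (\<Sum>(u, v)\<in>D. v - u) < d \<longrightarrow> (\<Sum>(u, v)\<in>D. \<bar>f' v - f' u\<bar>) < e" by (intro exI[of _ d] conjI allI impI)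
    qed
  qed
  moreover have "f' 1 = x" using f'm[of 1] f(2) h by simp
  moreover have "path_cost lam f' \<le> path_cost lam f + ennreal (h * \<bar>ln (h / C\<^sub>0)\<bar> + h)"
  proof -
    \<comment> \<open>With this \<theta> the exponential term of the dual bound is at most
      \<open>C\<^sub>0 * exp \<theta> = h\<close> and the linear one at most
      \<open>h * \<bar>\<theta>\<bar>\<close>; these are the two error terms of the claim.\<close>
    define \<theta> where "\<theta> = ln (h / C\<^sub>0)"
    have "C\<^sub>0 * exp \<theta> = h" using h C0 by (simp add: \<theta>_def)
    have "cost_on lam f' t 1 \<le> (\<integral>\<^sup>+s\<in>{t..1}. ennreal (lam (f s / s)) \<partial>lborel)"
      unfolding cost_on_def
    proof (intro nn_integral_mono_AE)
      have "AE s in lborel. s \<noteq> t" "AE s in lborel. s \<noteq> 1" by (rule AE_lborel_singleton)+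
      then show "AE s in lborel. local_cost (deriv f' s) (lam (f' s / s)) * indicator {t..1} s
          \<le> ennreal (lam (f s / s)) * indicator {t..1} s"
      proof eventually_elim
        case (elim s)
        show ?case
        proof (cases "t < s \<and> s < 1")
          case True
          have "(f' has_real_derivative 0) (at s)"
          proof (rule has_field_derivative_transform_within_open[of "\<lambda>_. x" _ _ "{t<..}"])
            show "x = f' y" if "y \<in> {t<..}" for y using that by (simp add: f'_def)
          qed (use True in auto)
          then have "deriv f' s = 0" by (rule DERIV_imp_deriv)
          moreover have "lam (f' s / s) \<le> lam (f s / s)"
            using True t x mono[of t s] by (intro lam_mono) (auto simp: f'_def divide_right_mono)
          ultimately show ?thesis using True by (simp add: local_cost_def indicator_def ennreal_leI)
        qed (use elim in \<open>auto simp: indicator_def\<close>)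
      qed
    qed
    \<comment> \<open>A nonnegative term is added to reach the left side of the dual bound.\<close>
    also have "\<dots> \<le> ennreal (max 0 \<theta> * (f 1 - f t)) + (\<integral>\<^sup>+s\<in>{t..1}. ennreal (lam (f s / s)) \<partial>lborel)"
      by simp
    also have "\<dots> \<le> ennreal (max 0 (- \<theta>) * (f 1 - f t)) + ennreal (C\<^sub>0 * exp \<theta> * (1 - t)) + cost_on lam f t 1"
    proof (rule cost_on_dual[OF f(1) t(1,2) order_refl])
      fix s assume "t < s" "s \<le> 1"
      then show "lam (f s / s) \<le> C\<^sub>0" using t AC0_plus_nonneg[OF f(1), of s] by (intro lam_bounded) auto
    qed
    also have "ennreal (max 0 (- \<theta>) * (f 1 - f t)) + ennreal (C\<^sub>0 * exp \<theta> * (1 - t)) \<le> ennreal (h * \<bar>\<theta>\<bar> + h)"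
    proof -
      have "max 0 (- \<theta>) * (f 1 - f t) \<le> h * \<bar>\<theta>\<bar>"
        using f(2) t(3) h by (auto simp: max_def)
      moreover have "C\<^sub>0 * exp \<theta> * (1 - t) \<le> h"
        using \<open>C\<^sub>0 * exp \<theta> = h\<close> h t by (simp add: mult_left_le)
      moreover have "0 \<le> max 0 (- \<theta>) * (f 1 - f t)" using f(2) t(3) h by simp
      moreover have "0 \<le> C\<^sub>0 * exp \<theta> * (1 - t)" using C0 t by simp
      ultimately show ?thesis by (simp flip: ennreal_plus add: ennreal_leI)
    qed
    finally have *: "cost_on lam f' t 1 \<le> ennreal (h * \<bar>\<theta>\<bar> + h) + cost_on lam f t 1"
      by (simp add: add_right_mono)
    have "cost_on lam f' 0 t = cost_on lam f 0 t"
      by (rule cost_on_cong) (simp add: f'_def)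
    with * have "cost_on lam f' 0 1 \<le> cost_on lam f 0 t + (ennreal (h * \<bar>\<theta>\<bar> + h) + cost_on lam f t 1)"
      using cost_on_split[OF \<open>f' \<in> AC0_plus\<close>, of 0 t 1] t by (simp add: add_left_mono)
    also have "\<dots> = cost_on lam f 0 1 + ennreal (h * \<bar>\<theta>\<bar> + h)"
      using cost_on_split[OF f(1), of 0 t 1] t by (simp add: ac_simps)
    finally show ?thesis by (simp add: path_cost_eq_cost_on \<theta>_def)
  qed
  ultimately show ?thesis by (rule that)
qed
end

section \<open>Entropy and factorial estimates\<close>

lemma power_over_fact_le_exp:
  fixes x :: real
  assumes "0 \<le> x"
  shows "x ^ n / fact n \<le> exp x"
proof -
  have s: "(\<lambda>k. inverse (fact k) * x ^ k) sums exp x"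
    using exp_converges[of x] by (simp add: scaleR_conv_of_real)
  have "inverse (fact n) * x ^ n = (\<Sum>k\<in>{n}. inverse (fact k) * x ^ k)" by simp
  also have "\<dots> \<le> exp x"
    using sum_le_suminf[OF sums_summable[OF s], of "{n}"] s assms by (simp add: sums_iff)
  finally show ?thesis by (simp add: field_simps)
qed

text \<open>A single term of the exponential series gives \<open>m ^ m / fact m \<le> exp m\<close>,
  the half of Stirling's formula that serves upper bounds.\<close>

lemma poisson_weight_le:
  fixes z :: real
  assumes "0 < z"
  shows "z ^ m / fact m \<le> exp (- (m * ln (m / z) - m))"
proof (cases "m = 0")
  case False
  then have m: "real m > 0" by simp
  have "exp (- (m * ln (m / z) - m)) = exp (real m) * exp (ln (z / m)) ^ m"
    using m assms by (simp add: ln_div exp_add[symmetric] exp_of_nat_mult[symmetric] algebra_simps)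
  also have "\<dots> = exp (real m) * (z / m) ^ m" using m assms by simp
  also have "\<dots> \<ge> real m ^ m / fact m * (z / m) ^ m"
    using power_over_fact_le_exp[of "real m" m] assms by (intro mult_right_mono) auto
  moreover have "real m ^ m / fact m * (z / m) ^ m = z ^ m / fact m"
    using m by (simp add: power_divide)
  ultimately show ?thesis by simp
qed simp

text \<open>The other half of Stirling's formula. The shift to m + 1 makes it exact at m = 0, and
  the induction step is \<open>1 \<le> (x + 1) * (ln (x + 1) - ln x)\<close> for x = m + 1.\<close>

lemma ln_fact_le: "ln (fact m) \<le> (real m + 1) * ln (real m + 1) - real m"
proof (induction m)
  case (Suc m)
  let ?x = "real m + 1"
  have x: "?x > 0" by simp
  have "ln (?x / (?x + 1)) \<le> ?x / (?x + 1) - 1" using x by (intro ln_le_minus_one) simp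
  also have "\<dots> = - 1 / (?x + 1)" using x by (simp add: field_simps)
  finally have "1 / (?x + 1) \<le> ln (?x + 1) - ln ?x" using x by (simp add: ln_div)
  then have "1 \<le> (?x + 1) * (ln (?x + 1) - ln ?x)" using x by (simp add: field_simps)
  moreover have "ln (fact (Suc m)) = ln ?x + ln (fact m)"
    by (simp add: fact_Suc ln_mult add.commute)
  ultimately show ?case using Suc by (simp add: algebra_simps)
qed simp

lemma entropy_ge:
  fixes w z :: real
  assumes "0 \<le> w" "0 < z"
  shows "- z \<le> w * ln (w / z) - w"
proof (cases "w = 0")
  case False
  then have w: "w > 0" using assms by simp
  have "ln (z / w) \<le> z / w - 1" using w assms by (intro ln_le_minus_one) simp
  then have "w * ln (z / w) \<le> w * (z / w - 1)" using w by (intro mult_left_mono) auto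
  then show ?thesis using w assms by (simp add: ln_div algebra_simps)
qed (use assms in simp)

lemma entropy_antimono:
  fixes w z z' :: real
  assumes "0 \<le> w" "w = 0 \<or> 0 < z" "z \<le> z'"
  shows "w * ln (w / z') \<le> w * ln (w / z)"
proof (cases "w = 0")
  case False
  then have "w / z' \<le> w / z" "0 < w / z'" using assms by (auto intro!: divide_left_mono)
  then have "ln (w / z') \<le> ln (w / z)" using ln_mono by (metis order_less_le_trans)
  then show ?thesis using assms by (intro mult_left_mono) auto
qed simp

text \<open>Entropy grows faster than linearly, so an increment of bounded cost in a short time must
  be small. This uniform modulus of continuity does the work of compact level sets. The choice of
  \<open>d0\<close> makes \<open>ln (\<delta> / (C * d))\<close> exceed
  \<open>1 + \<bar>c\<bar> / \<delta>\<close>.\<close>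

lemma small_if_entropy_bounded:
  fixes C c \<delta> :: real
  assumes "0 < C" "0 < \<delta>"
  obtains d0 where "0 < d0" "\<And>d w. 0 < d \<Longrightarrow> d < d0 \<Longrightarrow> 0 \<le> w \<Longrightarrow> w * ln (w / (C * d)) - w \<le> c \<Longrightarrow> w \<le> \<delta>"
proof -
  define d0 where "d0 = \<delta> / (C * exp (1 + \<bar>c\<bar> / \<delta>))"
  have "0 < d0" using assms by (simp add: d0_def)
  moreover have "w \<le> \<delta>" if d: "0 < d" "d < d0" and w: "0 \<le> w" "w * ln (w / (C * d)) - w \<le> c" for d w
  proof (rule ccontr)
    assume "\<not> w \<le> \<delta>"
    then have w\<delta>: "\<delta> < w" by simp
    have "exp (1 + \<bar>c\<bar> / \<delta>) < \<delta> / (C * d)"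
      using d assms by (simp add: d0_def field_simps)
    then have "1 + \<bar>c\<bar> / \<delta> < ln (\<delta> / (C * d))"
      using assms d by (metis exp_gt_zero ln_exp ln_less_cancel_iff order_less_trans)
    also have "\<dots> < ln (w / (C * d))" using w\<delta> assms d by (simp add: divide_strict_right_mono)
    finally have l: "\<bar>c\<bar> / \<delta> < ln (w / (C * d)) - 1" by simp
    have "\<bar>c\<bar> = \<delta> * (\<bar>c\<bar> / \<delta>)" using assms by simp
    also have "\<dots> \<le> w * (\<bar>c\<bar> / \<delta>)" using w\<delta> assms by (intro mult_right_mono) auto
    also have "\<dots> < w * (ln (w / (C * d)) - 1)" using l w\<delta> assms by (intro mult_strict_left_mono) auto
    finally show False using w by (simp add: algebra_simps)
  qed
  ultimately show ?thesis by (rule that)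
qed

text \<open>The left-hand side is the cost of climbing to height \<open>w + h\<close> at slope \<open>g\<close> within time \<open>\<eta>\<close>
  and then waiting; the first term on the right is a lower bound for the cost of any way to reach
  \<open>w\<close> in that time.\<close>

lemma initial_excess:
  fixes g\<^sub>0 l C \<eta> w h :: real
  assumes "0 < C" "1 \<le> g\<^sub>0" "0 < \<eta>" "\<eta> \<le> 1" "0 \<le> w" "0 < h" "h \<le> \<eta>\<^sup>2"
  defines "g \<equiv> g\<^sub>0 + (w + h) / \<eta>"
  shows "(w + h) * (ln g - ln l) + C * \<eta> \<le>
    (w * ln (w / (C * \<eta>)) - w) + (2 * g\<^sub>0 + 4 + \<bar>ln C\<bar> + \<bar>ln l\<bar> + C) * (\<eta> + w)"
proof -
  have h\<eta>: "h \<le> \<eta>" using assms by (smt (verit) mult_left_le power2_eq_square)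
  have "h / \<eta> \<le> 1" using h\<eta> assms by simp
  then have g: "g \<le> g\<^sub>0 + 1 + w / \<eta>" by (simp add: g_def add_divide_distrib)
  have "0 \<le> (w + h) / \<eta>" using assms by simp
  then have "1 \<le> g" using assms(2) unfolding g_def by linarith
  note g = g this
  define G where "G = g\<^sub>0 + 1 + w / \<eta>"
  have G: "1 \<le> G" "g \<le> G" using g assms by (auto simp: G_def)
  have lnG: "0 \<le> ln G" "ln G \<le> G" using G by (auto intro: ln_bound)
  have "(w + h) * ln g \<le> w * ln G + h * ln G"
    using G g assms by (simp add: distrib_right add_mono mult_left_mono)
  moreover have "h * ln G \<le> (g\<^sub>0 + 1) * \<eta> + w"
  proof -
    have "h * ln G \<le> h * G" using lnG assms by (intro mult_left_mono) auto
    also have "\<dots> = h * (g\<^sub>0 + 1) + h / \<eta> * w" by (simp add: G_def algebra_simps)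
    also have "\<dots> \<le> \<eta> * (g\<^sub>0 + 1) + 1 * w"
      using h\<eta> assms \<open>h / \<eta> \<le> 1\<close> by (intro add_mono mult_right_mono) auto
    finally show ?thesis by (simp add: mult.commute)
  qed
  moreover have "w * ln G \<le> w * ln (w / (C * \<eta>)) + w * \<bar>ln C\<bar> + (g\<^sub>0 + 1) * \<eta>"
  proof (cases "w = 0")
    case True
    then show ?thesis using assms by simp
  next
    case False
    then have w: "w > 0" using assms by simp
    \<comment> \<open>Replacing G by w / \<eta> in the logarithm costs
      \<open>(g\<^sub>0 + 1) * \<eta> / w\<close>, which the factor w makes harmless even for w near
      0.\<close>
    have "ln (G / (w / \<eta>)) \<le> G / (w / \<eta>) - 1" using w G assms by (intro ln_le_minus_one) auto
    also have "G / (w / \<eta>) - 1 = (g\<^sub>0 + 1) * \<eta> / w" using w assms by (simp add: G_def field_simps)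
    moreover have "ln (G / (w / \<eta>)) = ln G - ln (w / \<eta>)" proof (rule ln_divide_pos)
      show "0 < G" using G by linarith
      show "0 < w / \<eta>" using w assms(3) by simp
    qed
    ultimately have "ln G - ln (w / \<eta>) \<le> (g\<^sub>0 + 1) * \<eta> / w" by simp
    then have "w * (ln G - ln (w / \<eta>)) \<le> w * ((g\<^sub>0 + 1) * \<eta> / w)" using w by (intro mult_left_mono) auto
    moreover have "w * ((g\<^sub>0 + 1) * \<eta> / w) = (g\<^sub>0 + 1) * \<eta>" using w by simp
    ultimately have "w * ln G \<le> w * ln (w / \<eta>) + (g\<^sub>0 + 1) * \<eta>" by (simp add: right_diff_distrib)
    moreover have "ln (w / \<eta>) = ln (w / (C * \<eta>)) + ln C" using w assms by (simp add: ln_div ln_mult)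
    moreover have "w * ln C \<le> w * \<bar>ln C\<bar>" using w by (intro mult_left_mono) auto
    ultimately show ?thesis by (simp add: distrib_left)
  qed
  moreover have "- (w + h) * ln l \<le> (w + \<eta>) * \<bar>ln l\<bar>"
  proof -
    have "- (w + h) * ln l \<le> (w + h) * \<bar>ln l\<bar>"
      using assms by (smt (verit) abs_ge_minus_self mult_left_mono mult_minus_left mult_minus_right)
    also have "\<dots> \<le> (w + \<eta>) * \<bar>ln l\<bar>" using h\<eta> by (intro mult_right_mono) auto
    finally show ?thesis .
  qed
  ultimately have "(w + h) * (ln g - ln l) + C * \<eta> \<le> (w * ln (w / (C * \<eta>)) - w) + w * \<bar>ln C\<bar> + 2 * (g\<^sub>0 + 1) * \<eta> + 2 * w
      + (w + \<eta>) * \<bar>ln l\<bar> + C * \<eta>"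
    by (simp add: algebra_simps)
  also have "\<dots> \<le> (w * ln (w / (C * \<eta>)) - w) + (2 * g\<^sub>0 + 4 + \<bar>ln C\<bar> + \<bar>ln l\<bar> + C) * (\<eta> + w)"
  proof -
    have "0 \<le> \<bar>ln C\<bar> * \<eta>" "0 \<le> C * w" "0 \<le> g\<^sub>0 * w" using assms by auto
    then show ?thesis using assms by (simp add: algebra_simps)
  qed
  finally show ?thesis .
qed

text \<open>The path climbs from y0 to y1 in a cell of length \<Delta>, and e absorbs rounding, the
  summand \<gamma> and the shift of time by 1. Raising by h outweighs the climb of at most h / 4,
  the errors and the change of the denominator, so the largest old ratio stays below the smallest
  raised one. Since \<alpha> is at least \<eta>, the whole spread is still of order h /
  \<eta>.\<close>

lemma raised_ratio_bounds:
  fixes y0 y1 Y h e \<alpha> \<Delta> \<eta> :: real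
  assumes "0 < \<eta>" "\<eta> \<le> \<alpha>" "0 < \<Delta>" "0 \<le> y0" "y0 \<le> y1" "y1 \<le> Y" "y1 - y0 \<le> h / 4"
    "0 \<le> e" "e \<le> h / 8" "e \<le> 1" "(\<Delta> + e) * (Y + 1) \<le> h * \<eta> / 4" "0 < h"
  shows "(y1 + e) / \<alpha> \<le> (y0 + h - e) / (\<alpha> + \<Delta> + e)"
    "(y1 + h + e) / \<alpha> - y0 / (\<alpha> + \<Delta> + e) \<le> 2 * h / \<eta>"
proof -
  have a: "0 < \<alpha>" using assms by linarith
  have "(y1 + e) * (\<Delta> + e) \<le> (Y + 1) * (\<Delta> + e)" using assms by (intro mult_right_mono) auto
  also have "\<dots> \<le> h * \<eta> / 4" using assms(11) by (simp add: mult.commute)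
  also have "\<dots> \<le> h / 4 * \<alpha>" using assms by (simp add: mult_left_mono)
  also have "\<dots> \<le> (y0 + h - 2 * e - y1) * \<alpha>" using assms a by (intro mult_right_mono) linarith+
  finally have "(y1 + e) * (\<alpha> + \<Delta> + e) \<le> (y0 + h - e) * \<alpha>" by (simp add: algebra_simps)
  then show "(y1 + e) / \<alpha> \<le> (y0 + h - e) / (\<alpha> + \<Delta> + e)"
    using a assms by (simp add: divide_le_eq le_divide_eq pos_divide_le_eq pos_le_divide_eq)
  have "y0 * (\<Delta> + e) \<le> (Y + 1) * (\<Delta> + e)" using assms by (intro mult_right_mono) auto
  also have "\<dots> \<le> h * \<eta> / 4" using assms(11) by (simp add: mult.commute)
  finally have 1: "y0 * (\<Delta> + e) \<le> h * \<eta> / 4" .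
  have "y0 / \<alpha> - y0 / (\<alpha> + \<Delta> + e) = y0 * (\<Delta> + e) / (\<alpha> * (\<alpha> + \<Delta> + e))"
    using a assms by (simp add: field_simps)
  also have "\<dots> \<le> (h * \<eta> / 4) / (\<eta> * \<eta>)"
    using 1 assms a by (intro frac_le mult_mono) auto
  also have "\<dots> = h / (4 * \<eta>)" using assms by simp
  finally have 2: "y0 / \<alpha> - y0 / (\<alpha> + \<Delta> + e) \<le> h / (4 * \<eta>)" .
  have "(y1 - y0 + h + e) / \<alpha> \<le> (h / 4 + h + h / 8) / \<eta>"
    using assms a by (intro frac_le) auto
  also have "\<dots> = (11/8) * (h / \<eta>)" by simp
  finally have 3: "(y1 - y0 + h + e) / \<alpha> \<le> (11/8) * (h / \<eta>)" .
  have "(y1 + h + e) / \<alpha> = (y1 - y0 + h + e) / \<alpha> + y0 / \<alpha>" by (simp add: add_divide_distrib diff_divide_distrib)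
  moreover have "h / (4 * \<eta>) = (1/4) * (h / \<eta>)" "0 \<le> h / \<eta>" using assms by auto
  ultimately have "(y1 + h + e) / \<alpha> - y0 / (\<alpha> + \<Delta> + e) \<le> 2 * (h / \<eta>)" using 2 3 by linarith
  then show "(y1 + h + e) / \<alpha> - y0 / (\<alpha> + \<Delta> + e) \<le> 2 * h / \<eta>" by simp
qed

section \<open>The forward equation\<close>

locale self_exciting = bounded_rate lam C\<^sub>0 K
  for lam :: "real \<Rightarrow> real" and C\<^sub>0 K :: real +
  fixes \<gamma> :: real and M :: "'a measure" and N :: "'a \<Rightarrow> real set"
  assumes gamma_nonneg: "0 \<le> \<gamma>" and process: "self_exciting_process lam \<gamma> M N"
begin

sublocale prob_space M
  using process by (simp add: self_exciting_process_def simple_point_process_def)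

definition rate :: "nat \<Rightarrow> real \<Rightarrow> real" where
  "rate n t = lam ((real n + \<gamma>) / (t + 1))"

definition p :: "nat \<Rightarrow> real \<Rightarrow> real" where
  "p n t = prob {\<omega>\<in>space M. count_in N {0<..t} \<omega> = n}"

definition L :: "real \<Rightarrow> 'a \<Rightarrow> real" where
  "L t \<omega> = lam ((real (count_in N {0<..<t} \<omega>) + \<gamma>) / (t + 1))"

lemma rate_nonneg: "0 \<le> t \<Longrightarrow> 0 \<le> rate n t"
  using gamma_nonneg by (simp add: rate_def lam_nonneg)

lemma rate_le: "0 \<le> t \<Longrightarrow> rate n t \<le> C\<^sub>0"
  using gamma_nonneg by (simp add: rate_def lam_bounded)

lemma L_le: "0 \<le> t \<Longrightarrow> L t \<omega> \<le> C\<^sub>0"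
  using gamma_nonneg by (simp add: L_def lam_bounded)

section \<open>Counts, the filtration and the compensator\<close>

lemma finite_points: "\<omega> \<in> space M \<Longrightarrow> finite (N \<omega> \<inter> {a<..b})" "\<omega> \<in> space M \<Longrightarrow> finite (N \<omega> \<inter> {a<..<b})"
proof -
  assume "\<omega> \<in> space M"
  then have "finite (N \<omega> \<inter> {a..b})"
    using process by (simp add: self_exciting_process_def simple_point_process_def)
  then show "finite (N \<omega> \<inter> {a<..b})" "finite (N \<omega> \<inter> {a<..<b})"
    by (auto elim: finite_subset[rotated])
qed

lemma measurable_count:
  "B \<in> sets borel \<Longrightarrow> bounded B \<Longrightarrow> count_in N B \<in> measurable M (count_space UNIV)"
  using process by (simp add: self_exciting_process_def simple_point_process_def)

lemma measurable_count_Ioc[measurable]: "count_in N {a<..b} \<in> measurable M (count_space UNIV)"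
  by (rule measurable_count) auto

lemma count_split:
  assumes "\<omega> \<in> space M" "a \<le> b" "b \<le> c"
  shows "count_in N {a<..c} \<omega> = count_in N {a<..b} \<omega> + count_in N {b<..c} \<omega>"
proof -
  have "N \<omega> \<inter> {a<..c} = (N \<omega> \<inter> {a<..b}) \<union> (N \<omega> \<inter> {b<..c})" using assms by auto
  then show ?thesis
    unfolding count_in_def using finite_points(1)[OF assms(1)] by (simp add: card_Un_disjoint disjoint_iff)
qed

lemma subalgebra_natural_filtration: "subalgebra M (natural_filtration M N t)"
  unfolding subalgebra_def
proof
  let ?G = "{count_in N B -` S \<inter> space M |B S. B \<in> sets borel \<and> bounded B \<and> B \<subseteq> {..t}}"
  have G: "?G \<subseteq> sets M" using measurable_count by (auto intro: measurable_sets)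
  then have "sigma_sets (space M) ?G \<subseteq> sets M" by (rule sets.sigma_sets_subset)
  moreover have "?G \<subseteq> Pow (space M)" by auto
  ultimately show "sets (natural_filtration M N t) \<subseteq> sets M"
    by (simp add: natural_filtration_def sets_measure_of)
  show "space (natural_filtration M N t) = space M"
    by (simp add: natural_filtration_def space_measure_of_conv)
qed

lemma count_event_in_filtration:
  assumes "B \<in> sets borel" "bounded B" "B \<subseteq> {..t}"
  shows "{\<omega>\<in>space M. P (count_in N B \<omega>)} \<in> sets (natural_filtration M N t)"
proof -
  let ?G = "{count_in N B -` S \<inter> space M |B S. B \<in> sets borel \<and> bounded B \<and> B \<subseteq> {..t}}"
  have "{\<omega>\<in>space M. P (count_in N B \<omega>)} = count_in N B -` {n. P n} \<inter> space M" by auto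
  then have "{\<omega>\<in>space M. P (count_in N B \<omega>)} \<in> ?G" using assms by blast
  moreover have "?G \<subseteq> Pow (space M)" by auto
  ultimately show ?thesis
    by (simp add: natural_filtration_def sets_measure_of sigma_sets.Basic)
qed

text \<open>Progressive measurability up to time b is joint measurability on \<open>{0..b}\<close>,
  where Lebesgue measure is finite; integrating out the time leaves a random variable.\<close>

lemma compensator_measurable[measurable]:
  assumes "0 \<le> a" "a \<le> b"
  shows "(\<lambda>\<omega>. \<integral>\<^sup>+ s\<in>{a<..b}. ennreal (L s \<omega>) \<partial>lborel) \<in> borel_measurable M"
proof -
  let ?R = "restrict_space lborel {0..b}"
  have "finite_measure ?R"
    using assms by (intro finite_measureI) (simp add: emeasure_restrict_space space_restrict_space)
  then interpret R: finite_measure ?R .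
  have prog: "(\<lambda>(s, \<omega>). L s \<omega>) \<in> borel_measurable (restrict_space borel {0..b} \<Otimes>\<^sub>M natural_filtration M N b)"
    using process assms unfolding self_exciting_process_def has_intensity_def L_def by simp
  have "sets ?R = sets (restrict_space borel {0..b})"
    by (intro sets_restrict_space_cong) simp
  then have prog': "(\<lambda>(s, \<omega>). L s \<omega>) \<in> borel_measurable (?R \<Otimes>\<^sub>M natural_filtration M N b)"
    using prog by (simp cong: measurable_cong_sets sets_pair_measure_cong)
  have "(\<lambda>(\<omega>, s). L s \<omega>) \<in> borel_measurable (natural_filtration M N b \<Otimes>\<^sub>M ?R)"
    using measurable_compose[OF measurable_pair_swap' prog'] by (simp add: split_beta')
  then have [measurable]: "(\<lambda>x. L (snd x) (fst x)) \<in> borel_measurable (natural_filtration M N b \<Otimes>\<^sub>M ?R)"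
    by (simp add: split_beta')
  have [measurable]: "(\<lambda>s. s) \<in> measurable ?R borel"
    by (simp add: measurable_restrict_space1)
  have "(\<lambda>(\<omega>, s). ennreal (L s \<omega>) * indicator {a<..b} s) \<in> borel_measurable (natural_filtration M N b \<Otimes>\<^sub>M ?R)"
    unfolding split_beta' by measurable
  then have "(\<lambda>\<omega>. \<integral>\<^sup>+ s. ennreal (L s \<omega>) * indicator {a<..b} s \<partial>?R) \<in> borel_measurable (natural_filtration M N b)"
    by (rule R.borel_measurable_nn_integral)
  then have "(\<lambda>\<omega>. \<integral>\<^sup>+ s. ennreal (L s \<omega>) * indicator {a<..b} s \<partial>?R) \<in> borel_measurable M"
    by (rule measurable_from_subalg[OF subalgebra_natural_filtration])
  moreover have "(\<integral>\<^sup>+ s. ennreal (L s \<omega>) * indicator {a<..b} s \<partial>?R) = (\<integral>\<^sup>+ s\<in>{a<..b}. ennreal (L s \<omega>) \<partial>lborel)" for \<omega>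
    by (subst nn_integral_restrict_space) (use assms in \<open>auto intro!: nn_integral_cong simp: indicator_def\<close>)
  ultimately show ?thesis by simp
qed

text \<open>The defining property of conditional expectations turns the intensity identity into one
  between plain integrals over events of the past, the only form in which it is used later.\<close>

lemma intensity_on_event:
  assumes ab: "0 \<le> a" "a \<le> b" and A: "A \<in> sets (natural_filtration M N a)"
  shows "(\<integral>\<^sup>+\<omega>\<in>A. ennreal (real (count_in N {a<..b} \<omega>)) \<partial>M) =
    (\<integral>\<^sup>+\<omega>\<in>A. (\<integral>\<^sup>+ s\<in>{a<..b}. ennreal (L s \<omega>) \<partial>lborel) \<partial>M)"
proof -
  let ?F = "natural_filtration M N a"
  interpret F: finite_measure_subalgebra M ?F
    by unfold_locales (rule subalgebra_natural_filtration)
  have ae: "AE \<omega> in M. nn_cond_exp M ?F (\<lambda>\<omega>'. ennreal (real (count_in N {a<..b} \<omega>'))) \<omega> =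
     nn_cond_exp M ?F (\<lambda>\<omega>'. \<integral>\<^sup>+ s\<in>{a<..b}. ennreal (L s \<omega>') \<partial>lborel) \<omega>"
    using process ab unfolding self_exciting_process_def has_intensity_def L_def by blast
  have i: "(\<lambda>\<omega>. indicator A \<omega> :: ennreal) \<in> borel_measurable ?F" using A by simp
  have "(\<integral>\<^sup>+\<omega>. indicator A \<omega> * ennreal (real (count_in N {a<..b} \<omega>)) \<partial>M)
    = (\<integral>\<^sup>+\<omega>. indicator A \<omega> * nn_cond_exp M ?F (\<lambda>\<omega>'. ennreal (real (count_in N {a<..b} \<omega>'))) \<omega> \<partial>M)"
    by (rule F.nn_cond_exp_intg[symmetric, OF i]) measurable
  also have "\<dots> = (\<integral>\<^sup>+\<omega>. indicator A \<omega> * nn_cond_exp M ?F (\<lambda>\<omega>'. \<integral>\<^sup>+ s\<in>{a<..b}. ennreal (L s \<omega>') \<partial>lborel) \<omega> \<partial>M)"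
    by (rule nn_integral_cong_AE) (use ae in auto)
  also have "\<dots> = (\<integral>\<^sup>+\<omega>. indicator A \<omega> * (\<integral>\<^sup>+ s\<in>{a<..b}. ennreal (L s \<omega>) \<partial>lborel) \<partial>M)"
    by (rule F.nn_cond_exp_intg[OF i compensator_measurable[OF ab]])
  finally show ?thesis by (simp add: mult.commute)
qed

lemma compensator_le: "0 \<le> a \<Longrightarrow> a \<le> b \<Longrightarrow> (\<integral>\<^sup>+ s\<in>{a<..b}. ennreal (L s \<omega>) \<partial>lborel) \<le> ennreal (C\<^sub>0 * (b - a))"
proof -
  assume ab: "0 \<le> a" "a \<le> b"
  have "(\<integral>\<^sup>+ s\<in>{a<..b}. ennreal (L s \<omega>) \<partial>lborel) \<le> (\<integral>\<^sup>+ s\<in>{a<..b}. ennreal C\<^sub>0 \<partial>lborel)"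
    by (rule nn_integral_mono) (use ab L_le in \<open>auto simp: indicator_def intro!: ennreal_leI\<close>)
  then show ?thesis using ab C0_nonneg by (simp add: nn_integral_cmult_indicator ennreal_mult)
qed

lemma nn_integral_count_le:
  assumes ab: "0 \<le> a" "a \<le> b" and A: "A \<in> sets (natural_filtration M N a)"
  shows "(\<integral>\<^sup>+\<omega>\<in>A. ennreal (real (count_in N {a<..b} \<omega>)) \<partial>M) \<le> ennreal (C\<^sub>0 * (b - a) * prob A)"
proof -
  have Am: "A \<in> sets M" using A subalgebra_natural_filtration[of a] by (auto simp: subalgebra_def)
  have "(\<integral>\<^sup>+\<omega>\<in>A. ennreal (real (count_in N {a<..b} \<omega>)) \<partial>M) \<le> (\<integral>\<^sup>+\<omega>\<in>A. ennreal (C\<^sub>0 * (b - a)) \<partial>M)"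
    unfolding intensity_on_event[OF ab A]
    by (rule nn_integral_mono) (use compensator_le[OF ab] in \<open>auto simp: indicator_def\<close>)
  also have "\<dots> = ennreal (C\<^sub>0 * (b - a) * prob A)"
    using Am ab C0_nonneg by (simp add: nn_integral_cmult_indicator ennreal_mult emeasure_eq_measure)
  finally show ?thesis .
qed

lemma prob_count_pos_le:
  assumes ab: "0 \<le> a" "a \<le> b"
  shows "prob {\<omega>\<in>space M. 1 \<le> count_in N {a<..b} \<omega>} \<le> C\<^sub>0 * (b - a)"
proof -
  let ?E = "{\<omega>\<in>space M. 1 \<le> count_in N {a<..b} \<omega>}"
  have sp: "space M \<in> sets (natural_filtration M N a)"
    using subalgebra_natural_filtration[of a] sets.top[of "natural_filtration M N a"]
    by (simp add: subalgebra_def)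
  have "ennreal (prob ?E) = (\<integral>\<^sup>+\<omega>. indicator ?E \<omega> \<partial>M)"
    by (simp add: emeasure_eq_measure)
  also have "\<dots> \<le> (\<integral>\<^sup>+\<omega>\<in>space M. ennreal (real (count_in N {a<..b} \<omega>)) \<partial>M)"
    by (rule nn_integral_mono) (auto simp: indicator_def)
  also have "\<dots> \<le> ennreal (C\<^sub>0 * (b - a) * prob (space M))"
    by (rule nn_integral_count_le[OF ab sp])
  finally show ?thesis using ab C0_nonneg by (simp add: prob_space ennreal_le_iff)
qed

text \<open>Simplicity of the process: on a fine enough grid, every point but the first one lies in a cell
  that begins after the first point.\<close>

lemma eventually_excess_le_grid_sum:
  assumes \<omega>: "\<omega> \<in> space M" and ab: "a \<le> b"
  defines "s \<equiv> \<lambda>n i. a + real i * ((b - a) / real n)"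
  shows "\<forall>\<^sub>F n in sequentially. count_in N {a<..b} \<omega> - 1 \<le>
    (\<Sum>i<n. if 1 \<le> count_in N {a<..s n i} \<omega> then count_in N {s n i<..s n (Suc i)} \<omega> else 0)"
proof (cases "N \<omega> \<inter> {a<..b} = {}")
  case True
  then show ?thesis by (simp add: count_in_def)
next
  case False
  define X where "X = N \<omega> \<inter> {a<..b}"
  have X: "finite X" "X \<noteq> {}" using finite_points[OF \<omega>] False by (auto simp: X_def)
  define x0 where "x0 = Min X"
  have x0: "x0 \<in> X" "\<And>x. x \<in> X \<Longrightarrow> x0 \<le> x" using X by (auto simp: x0_def)
  obtain d where d: "d > 0" "\<And>x. x \<in> X \<Longrightarrow> x \<noteq> x0 \<Longrightarrow> d \<le> dist x0 x"
    using finite_set_avoid[OF X(1), of x0] by blast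
  have "(\<lambda>n. (b - a) / real n) \<longlonglongrightarrow> 0" by real_asymp
  then have "\<forall>\<^sub>F n in sequentially. (b - a) / real n < d"
    using d(1) by (rule order_tendstoD)
  moreover have "\<forall>\<^sub>F n in sequentially. n > 0" by (rule eventually_gt_at_top)
  ultimately show ?thesis
  proof eventually_elim
    case (elim n)
    let ?Y = "X - {x0}" and ?I = "\<lambda>i. {s n i<..s n (Suc i)}"
    have step: "s n (Suc i) = s n i + (b - a) / real n" for i
      by (simp add: s_def distrib_right add_divide_distrib)
    have cover: "{a<..s n k} \<subseteq> (\<Union>i<k. ?I i)" for k
    proof (induction k)
      case 0 then show ?case by (simp add: s_def)
    next
      case (Suc k)
      have "{a<..s n (Suc k)} \<subseteq> {a<..s n k} \<union> ?I k" by auto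
      with Suc show ?case by (auto simp: lessThan_Suc)
    qed
    have "s n n = b" using elim by (simp add: s_def)
    then have "?Y \<subseteq> (\<Union>i<n. ?Y \<inter> ?I i)" using cover[of n] by (auto simp: X_def)
    then have "card ?Y \<le> card (\<Union>i<n. ?Y \<inter> ?I i)" using X(1) by (intro card_mono) auto
    also have "\<dots> \<le> (\<Sum>i<n. card (?Y \<inter> ?I i))" by (rule card_UN_le) simp
    also have "\<dots> \<le> (\<Sum>i<n. if 1 \<le> count_in N {a<..s n i} \<omega> then count_in N (?I i) \<omega> else 0)"
    proof (rule sum_mono)
      fix i assume "i \<in> {..<n}"
      show "card (?Y \<inter> ?I i) \<le> (if 1 \<le> count_in N {a<..s n i} \<omega> then count_in N (?I i) \<omega> else 0)"
      proof (cases "?Y \<inter> ?I i = {}")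
        case False
        then obtain x where "x \<in> ?Y \<inter> ?I i" by blast
        then have x: "x \<in> X" "x \<noteq> x0" "s n i < x" "x \<le> s n (Suc i)" by simp_all
        then have "d \<le> x - x0" using d(2)[OF x(1,2)] x0(2)[OF x(1)] by (simp add: dist_real_def)
        then have "x0 < s n i" using x(4) elim(1) step[of i] by simp
        then have "x0 \<in> N \<omega> \<inter> {a<..s n i}" using x0(1) by (auto simp: X_def)
        then have "1 \<le> count_in N {a<..s n i} \<omega>"
          unfolding count_in_def using finite_points(1)[OF \<omega>, of a "s n i"] by (metis card_gt_0_iff empty_iff One_nat_def Suc_leI)
        moreover have "card (?Y \<inter> ?I i) \<le> count_in N (?I i) \<omega>"
          unfolding count_in_def using finite_points(1)[OF \<omega>] by (intro card_mono) (auto simp: X_def)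
        ultimately show ?thesis by simp
      qed simp
    qed
    finally show ?case using X x0 by (simp add: count_in_def flip: X_def)
  qed
qed

text \<open>On a fine grid the excess is at most the number of points in cells that begin after some
  earlier point. Each of the n cells contributes at most \<open>C\<^sub>0 * (b - a) / n\<close>
  times the probability of an earlier point, itself at most \<open>C\<^sub>0 * (b - a)\<close>.
  Fatou's lemma removes the grid. The quadratic order makes double jumps invisible in the forward
  equation.\<close>

lemma nn_integral_excess_le:
  assumes ab: "0 \<le> a" "a \<le> b"
  shows "(\<integral>\<^sup>+\<omega>. ennreal (real (count_in N {a<..b} \<omega> - 1)) \<partial>M) \<le> ennreal ((C\<^sub>0 * (b - a))\<^sup>2)"
proof -
  define s where "s n i = a + real i * ((b - a) / real n)" for n i :: nat
  define E where "E n i = {\<omega>\<in>space M. 1 \<le> count_in N {a<..s n i} \<omega>}" for n i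
  define S where "S n \<omega> = (\<Sum>i<n. ennreal (real (count_in N {s n i<..s n (Suc i)} \<omega>)) * indicator (E n i) \<omega>)" for n \<omega>
  have [measurable]: "E n i \<in> sets M" for n i unfolding E_def by measurable
  have [measurable]: "S n \<in> borel_measurable M" for n unfolding S_def by measurable
  have SE: "S n \<omega> = ennreal (real (\<Sum>i<n. if 1 \<le> count_in N {a<..s n i} \<omega> then count_in N {s n i<..s n (Suc i)} \<omega> else 0))"
    if "\<omega> \<in> space M" for n \<omega>
  proof -
    have "S n \<omega> = (\<Sum>i<n. ennreal (real (if 1 \<le> count_in N {a<..s n i} \<omega> then count_in N {s n i<..s n (Suc i)} \<omega> else 0)))"
      unfolding S_def by (rule sum.cong[OF refl]) (use that in \<open>simp add: E_def indicator_def\<close>)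
    also have "\<dots> = ennreal (\<Sum>i<n. real (if 1 \<le> count_in N {a<..s n i} \<omega> then count_in N {s n i<..s n (Suc i)} \<omega> else 0))"
      by (rule sum_ennreal) simp
    finally show ?thesis by (simp only: of_nat_sum)
  qed
  have le: "ennreal (real (count_in N {a<..b} \<omega> - 1)) \<le> liminf (\<lambda>n. S n \<omega>)" if "\<omega> \<in> space M" for \<omega>
  proof (rule Liminf_bounded)
    show "\<forall>\<^sub>F n in sequentially. ennreal (real (count_in N {a<..b} \<omega> - 1)) \<le> S n \<omega>"
      using eventually_excess_le_grid_sum[OF that ab(2)]
    proof eventually_elim
      case (elim n)
      then show ?case unfolding SE[OF that] s_def by (intro ennreal_leI) (simp only: of_nat_le_iff)
    qed
  qed
  have "(\<integral>\<^sup>+\<omega>. ennreal (real (count_in N {a<..b} \<omega> - 1)) \<partial>M) \<le> (\<integral>\<^sup>+\<omega>. liminf (\<lambda>n. S n \<omega>) \<partial>M)"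
    by (rule nn_integral_mono) (rule le)
  also have "\<dots> \<le> liminf (\<lambda>n. \<integral>\<^sup>+\<omega>. S n \<omega> \<partial>M)"
    by (rule nn_integral_liminf) measurable
  also have "\<dots> \<le> ennreal ((C\<^sub>0 * (b - a))\<^sup>2)"
  proof -
    have "(\<integral>\<^sup>+\<omega>. S n \<omega> \<partial>M) \<le> ennreal ((C\<^sub>0 * (b - a))\<^sup>2)" if n: "n > 0" for n
    proof -
      have "(\<integral>\<^sup>+\<omega>. S n \<omega> \<partial>M) = (\<Sum>i<n. \<integral>\<^sup>+\<omega>\<in>E n i. ennreal (real (count_in N {s n i<..s n (Suc i)} \<omega>)) \<partial>M)"
        unfolding S_def by (rule nn_integral_sum) measurable
      also have "\<dots> \<le> (\<Sum>i<n. ennreal (C\<^sub>0 * (b - a) / n * (C\<^sub>0 * (b - a))))"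
      proof (rule sum_mono)
        fix i assume i: "i \<in> {..<n}"
        have si: "a \<le> s n i" "s n i \<le> s n (Suc i)" "s n (Suc i) - s n i = (b - a) / n"
          using ab by (simp_all add: s_def distrib_right add_divide_distrib)
        have "s n i \<le> b"
        proof -
          have "real i * ((b - a) / n) \<le> real n * ((b - a) / n)"
            using i ab by (intro mult_right_mono) auto
          then show ?thesis using n by (simp add: s_def)
        qed
        have E: "E n i \<in> sets (natural_filtration M N (s n i))"
          unfolding E_def by (rule count_event_in_filtration) auto
        have "(\<integral>\<^sup>+\<omega>\<in>E n i. ennreal (real (count_in N {s n i<..s n (Suc i)} \<omega>)) \<partial>M)
          \<le> ennreal (C\<^sub>0 * (s n (Suc i) - s n i) * prob (E n i))"
          using si ab by (intro nn_integral_count_le[OF _ _ E]) auto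
        also have "\<dots> \<le> ennreal (C\<^sub>0 * (b - a) / n * (C\<^sub>0 * (b - a)))"
        proof (rule ennreal_leI)
          have "prob (E n i) \<le> C\<^sub>0 * (s n i - a)" unfolding E_def using si ab by (intro prob_count_pos_le) auto
          also have "\<dots> \<le> C\<^sub>0 * (b - a)" using \<open>s n i \<le> b\<close> C0_nonneg by (intro mult_left_mono) auto
          finally show "C\<^sub>0 * (s n (Suc i) - s n i) * prob (E n i) \<le> C\<^sub>0 * (b - a) / n * (C\<^sub>0 * (b - a))"
            unfolding si(3) using C0_nonneg ab by (simp add: mult_left_mono divide_right_mono mult.assoc)
        qed
        finally show "(\<integral>\<^sup>+\<omega>\<in>E n i. ennreal (real (count_in N {s n i<..s n (Suc i)} \<omega>)) \<partial>M)
          \<le> ennreal (C\<^sub>0 * (b - a) / n * (C\<^sub>0 * (b - a)))" .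
      qed
      also have "\<dots> = ennreal (real n * (C\<^sub>0 * (b - a) / n * (C\<^sub>0 * (b - a))))"
      proof -
        have "0 \<le> C\<^sub>0 * (b - a) / n * (C\<^sub>0 * (b - a))" using ab C0_nonneg by simp
        then show ?thesis
          by (simp only: sum_constant card_lessThan ennreal_of_nat_eq_real_of_nat ennreal_mult[OF of_nat_0_le_iff])
      qed
      also have "real n * (C\<^sub>0 * (b - a) / n * (C\<^sub>0 * (b - a))) = (C\<^sub>0 * (b - a))\<^sup>2"
        using n by (simp add: power2_eq_square)
      finally show ?thesis .
    qed
    then have "\<forall>\<^sub>F n in sequentially. (\<integral>\<^sup>+\<omega>. S n \<omega> \<partial>M) \<le> ennreal ((C\<^sub>0 * (b - a))\<^sup>2)"
      using eventually_gt_at_top[of "0::nat"] by (rule eventually_mono[rotated])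
    from Limsup_bounded[OF this] show ?thesis
      using Liminf_le_Limsup[of sequentially "\<lambda>n. \<integral>\<^sup>+\<omega>. S n \<omega> \<partial>M"] by (simp add: order_trans)
  qed
  finally show ?thesis .
qed

end

text \<open>The error estimate evaluates G at the left end of the interval. For a difference
  quotient from the left at t this is an earlier point than t, and continuity of G makes up for
  it.\<close>

lemma has_real_derivative_from_quadratic_error:
  fixes p G :: "real \<Rightarrow> real"
  assumes err: "\<And>a b. 0 \<le> a \<Longrightarrow> a \<le> b \<Longrightarrow> \<bar>p b - p a - (b - a) * G a\<bar> \<le> c * (b - a)\<^sup>2"
    and G: "continuous_on {0..} G" and t: "0 \<le> t"
  shows "(p has_real_derivative G t) (at t within {0..})"
  unfolding has_field_derivative_def has_derivative_within_alt
proof (intro conjI allI impI)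
  show "bounded_linear ((*) (G t))" by (rule bounded_linear_mult_right)
  fix e :: real assume e: "e > 0"
  obtain d where d: "d > 0" "\<And>s. s \<ge> 0 \<Longrightarrow> \<bar>s - t\<bar> < d \<Longrightarrow> \<bar>G s - G t\<bar> < e / 2"
    using G t e unfolding continuous_on_iff dist_real_def by (meson atLeast_iff half_gt_zero)
  define d' where "d' = min d (e / (2 * (\<bar>c\<bar> + 1)))"
  have d': "d' > 0" using d e by (simp add: d'_def)
  have "\<bar>p s - p t - G t * (s - t)\<bar> \<le> e * \<bar>s - t\<bar>" if s: "s \<ge> 0" "\<bar>s - t\<bar> < d'" for s
  proof -
    have c: "c * (s - t)\<^sup>2 \<le> e / 2 * \<bar>s - t\<bar>"
    proof -
      have "\<bar>s - t\<bar> \<le> e / (2 * (\<bar>c\<bar> + 1))" using s by (simp add: d'_def)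
      then have "(\<bar>c\<bar> + 1) * \<bar>s - t\<bar> \<le> e / 2" by (simp add: field_simps)
      then have "(\<bar>c\<bar> + 1) * \<bar>s - t\<bar> * \<bar>s - t\<bar> \<le> e / 2 * \<bar>s - t\<bar>" by (intro mult_right_mono) auto
      moreover have "c * (s - t)\<^sup>2 \<le> (\<bar>c\<bar> + 1) * (s - t)\<^sup>2" by (intro mult_right_mono) auto
      moreover have "(s - t)\<^sup>2 = \<bar>s - t\<bar> * \<bar>s - t\<bar>" by (simp add: power2_eq_square abs_mult_self_eq)
      ultimately show ?thesis by (simp only: mult.assoc)
    qed
    show ?thesis
    proof (cases "t \<le> s")
      case True
      have "e / 2 * \<bar>s - t\<bar> \<le> e * \<bar>s - t\<bar>" using e by (intro mult_right_mono) auto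
      then show ?thesis using err[OF t True] c by (simp add: mult.commute)
    next
      case False
      have "\<bar>p t - p s - (t - s) * G s\<bar> \<le> e / 2 * \<bar>s - t\<bar>"
        using err[OF s(1), of t] False c by (simp add: power2_commute)
      moreover have "\<bar>(t - s) * (G s - G t)\<bar> \<le> e / 2 * \<bar>s - t\<bar>"
      proof -
        have "\<bar>G s - G t\<bar> \<le> e / 2" using d(2)[OF s(1)] s(2) by (simp add: d'_def)
        then have "\<bar>t - s\<bar> * \<bar>G s - G t\<bar> \<le> \<bar>t - s\<bar> * (e / 2)" by (intro mult_left_mono) auto
        then show ?thesis by (simp add: abs_mult abs_minus_commute mult.commute)
      qed
      moreover have "p s - p t - G t * (s - t) = - (p t - p s - (t - s) * G s) - (t - s) * (G s - G t)"
        by (simp add: algebra_simps)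
      ultimately show ?thesis by linarith
    qed
  qed
  then show "\<exists>d>0. \<forall>y\<in>{0..}. norm (y - t) < d \<longrightarrow> norm (p y - p t - G t * (y - t)) \<le> e * norm (y - t)"
    using d' by (intro exI[of _ d']) auto
qed

context self_exciting begin

lemma rate_antimono: "0 \<le> a \<Longrightarrow> a \<le> b \<Longrightarrow> rate n b \<le> rate n a"
  unfolding rate_def using gamma_nonneg by (intro lam_mono) (auto intro!: divide_left_mono)

lemma rate_diff_le:
  assumes "0 \<le> a" "a \<le> b"
  shows "rate n a - rate n b \<le> K * (n + \<gamma>) * (b - a)"
proof -
  have "rate n a - rate n b \<le> K * ((n + \<gamma>) / (a + 1) - (n + \<gamma>) / (b + 1))"
    unfolding rate_def using assms gamma_nonneg by (intro lam_diff) (auto intro!: divide_left_mono)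
  also have "(n + \<gamma>) / (a + 1) - (n + \<gamma>) / (b + 1) \<le> (n + \<gamma>) * (b - a)"
  proof -
    have "(n + \<gamma>) / (a + 1) - (n + \<gamma>) / (b + 1) = (n + \<gamma>) * (b - a) / ((a + 1) * (b + 1))"
      using assms by (simp add: field_simps)
    also have "\<dots> \<le> (n + \<gamma>) * (b - a) / 1"
      using assms gamma_nonneg by (intro divide_left_mono) (auto simp: mult_ge1_I)
    finally show ?thesis by simp
  qed
  finally show ?thesis using K_pos by (simp add: mult.assoc)
qed

text \<open>On the event of n points up to a, the expected number of points in (a,b] is the expected
  integral of L, and L equals the deterministic \<open>rate n s\<close> as long as no new point has
  occurred. A new point has probability of order b - a and the integral is at most
  \<open>C\<^sub>0 * (b - a)\<close>, so this error is quadratic. So are the errors from freezing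
  the time in the rate and from counting more than one point.\<close>

lemma prob_jump:
  assumes ab: "0 \<le> a" "a \<le> b"
  shows "\<bar>prob {\<omega>\<in>space M. count_in N {0<..a} \<omega> = n \<and> 1 \<le> count_in N {a<..b} \<omega>} - (b - a) * (rate n a * p n a)\<bar>
    \<le> (2 * C\<^sub>0\<^sup>2 + K * (n + \<gamma>)) * (b - a)\<^sup>2"
proof -
  let ?A = "{\<omega>\<in>space M. count_in N {0<..a} \<omega> = n}" and ?E = "{\<omega>\<in>space M. 1 \<le> count_in N {a<..b} \<omega>}"
  let ?X = "{\<omega>\<in>space M. count_in N {0<..a} \<omega> = n \<and> 1 \<le> count_in N {a<..b} \<omega>}"
  let ?D = "\<lambda>\<omega>. ennreal (real (count_in N {a<..b} \<omega>))"
  let ?C = "\<lambda>\<omega>. \<integral>\<^sup>+ s\<in>{a<..b}. ennreal (L s \<omega>) \<partial>lborel"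
  have [measurable]: "?A \<in> sets M" "?E \<in> sets M" "?X \<in> sets M" by measurable
  note [measurable] = compensator_measurable[OF ab]
  have A: "?A \<in> sets (natural_filtration M N a)"
    by (rule count_event_in_filtration) auto
  have PE: "prob ?E \<le> C\<^sub>0 * (b - a)" by (rule prob_count_pos_le[OF ab])
  have ra: "0 \<le> rate n a" "0 \<le> rate n b" using ab by (auto intro: rate_nonneg)
  have Lrate: "L s \<omega> = rate n s" if "\<omega> \<in> ?A" "\<omega> \<notin> ?E" "s \<in> {a<..b}" for s \<omega>
  proof -
    have "N \<omega> \<inter> {a<..b} = {}" using that finite_points[of \<omega> a b] by (auto simp: count_in_def card_eq_0_iff Suc_le_eq)
    moreover have "N \<omega> \<inter> {0<..<s} = (N \<omega> \<inter> {0<..a}) \<union> (N \<omega> \<inter> {a<..<s})" using that ab by auto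
    moreover have "{a<..<s} \<subseteq> {a<..b}" using that by auto
    ultimately have "N \<omega> \<inter> {0<..<s} = N \<omega> \<inter> {0<..a}" by blast
    then have "count_in N {0<..<s} \<omega> = count_in N {0<..a} \<omega>" by (simp add: count_in_def)
    then show ?thesis using that by (simp add: L_def rate_def)
  qed
  have up: "?C \<omega> \<le> ennreal ((b - a) * rate n a) + ennreal (C\<^sub>0 * (b - a)) * indicator ?E \<omega>" if \<omega>: "\<omega> \<in> ?A" for \<omega>
  proof (cases "\<omega> \<in> ?E")
    case True
    then show ?thesis using compensator_le[OF ab, of \<omega>] by (simp add: add_increasing)
  next
    case False
    have "?C \<omega> \<le> (\<integral>\<^sup>+ s\<in>{a<..b}. ennreal (rate n a) \<partial>lborel)"
      by (rule nn_integral_mono) (use Lrate[OF \<omega> False] ab rate_antimono[of a] in \<open>auto simp: indicator_def intro!: ennreal_leI\<close>)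
    also have "\<dots> = ennreal ((b - a) * rate n a)"
      using ab ra by (subst nn_integral_cmult_indicator) (auto simp: ennreal_mult mult.commute)
    finally show ?thesis by (simp add: add_increasing2)
  qed
  have lo: "ennreal ((b - a) * rate n b) \<le> ?C \<omega> + ennreal (C\<^sub>0 * (b - a)) * indicator ?E \<omega>" if \<omega>: "\<omega> \<in> ?A" for \<omega>
  proof (cases "\<omega> \<in> ?E")
    case True
    have "(b - a) * rate n b \<le> C\<^sub>0 * (b - a)" using mult_left_mono[OF rate_le[of b n], of "b - a"] ab by (simp add: mult.commute)
    then show ?thesis using True by (simp add: add_increasing ennreal_leI)
  next
    case False
    have "ennreal ((b - a) * rate n b) = (\<integral>\<^sup>+ s\<in>{a<..b}. ennreal (rate n b) \<partial>lborel)"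
      using ab ra by (subst nn_integral_cmult_indicator) (auto simp: ennreal_mult mult.commute)
    also have "\<dots> \<le> ?C \<omega>"
      by (rule nn_integral_mono) (use Lrate[OF \<omega> False] ab rate_antimono[of _ b] in \<open>auto simp: indicator_def intro!: ennreal_leI\<close>)
    finally show ?thesis by (simp add: add_increasing2)
  qed
  have cE: "(\<integral>\<^sup>+\<omega>. ennreal (C\<^sub>0 * (b - a)) * indicator ?E \<omega> \<partial>M) \<le> ennreal (C\<^sub>0\<^sup>2 * (b - a)\<^sup>2)"
  proof -
    have "(\<integral>\<^sup>+\<omega>. ennreal (C\<^sub>0 * (b - a)) * indicator ?E \<omega> \<partial>M) = ennreal (C\<^sub>0 * (b - a) * prob ?E)"
      using ab C0_nonneg by (subst nn_integral_cmult_indicator) (auto simp: ennreal_mult emeasure_eq_measure)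
    also have "\<dots> \<le> ennreal (C\<^sub>0 * (b - a) * (C\<^sub>0 * (b - a)))"
      using PE ab C0_nonneg by (intro ennreal_leI mult_left_mono) auto
    finally show ?thesis by (simp add: power2_eq_square ac_simps)
  qed
  have cA: "(\<integral>\<^sup>+\<omega>. ennreal ((b - a) * r) * indicator ?A \<omega> \<partial>M) = ennreal ((b - a) * (r * p n a))" if "0 \<le> r" for r
    using ab that by (subst nn_integral_cmult_indicator) (auto simp: ennreal_mult emeasure_eq_measure p_def mult.assoc)
  have "ennreal (prob ?X) = (\<integral>\<^sup>+\<omega>. indicator ?X \<omega> \<partial>M)"
    by (simp add: emeasure_eq_measure)
  also have "\<dots> \<le> (\<integral>\<^sup>+\<omega>\<in>?A. ?D \<omega> \<partial>M)"
    by (rule nn_integral_mono) (auto simp: indicator_def)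
  also have "\<dots> = (\<integral>\<^sup>+\<omega>\<in>?A. ?C \<omega> \<partial>M)" by (rule intensity_on_event[OF ab A])
  also have "\<dots> \<le> (\<integral>\<^sup>+\<omega>. ennreal ((b - a) * rate n a) * indicator ?A \<omega> + ennreal (C\<^sub>0 * (b - a)) * indicator ?E \<omega> \<partial>M)"
  proof (rule nn_integral_mono)
    fix \<omega>
    show "?C \<omega> * indicator ?A \<omega> \<le> ennreal ((b - a) * rate n a) * indicator ?A \<omega> + ennreal (C\<^sub>0 * (b - a)) * indicator ?E \<omega>"
      using up[of \<omega>] by (cases "\<omega> \<in> ?A") auto
  qed
  also have "\<dots> = ennreal ((b - a) * (rate n a * p n a)) + (\<integral>\<^sup>+\<omega>. ennreal (C\<^sub>0 * (b - a)) * indicator ?E \<omega> \<partial>M)"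
    by (subst nn_integral_add) (auto simp: cA[OF ra(1)])
  also have "\<dots> \<le> ennreal ((b - a) * (rate n a * p n a)) + ennreal (C\<^sub>0\<^sup>2 * (b - a)\<^sup>2)"
    by (rule add_left_mono[OF cE])
  finally have 1: "prob ?X \<le> (b - a) * (rate n a * p n a) + C\<^sub>0\<^sup>2 * (b - a)\<^sup>2"
    using ab ra by (simp add: p_def flip: ennreal_plus)
  have "ennreal ((b - a) * (rate n b * p n a)) = (\<integral>\<^sup>+\<omega>. ennreal ((b - a) * rate n b) * indicator ?A \<omega> \<partial>M)"
    by (rule cA[OF ra(2), symmetric])
  also have "\<dots> \<le> (\<integral>\<^sup>+\<omega>. ?C \<omega> * indicator ?A \<omega> + ennreal (C\<^sub>0 * (b - a)) * indicator ?E \<omega> \<partial>M)"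
  proof (rule nn_integral_mono)
    fix \<omega>
    show "ennreal ((b - a) * rate n b) * indicator ?A \<omega> \<le> ?C \<omega> * indicator ?A \<omega> + ennreal (C\<^sub>0 * (b - a)) * indicator ?E \<omega>"
      using lo[of \<omega>] by (cases "\<omega> \<in> ?A") auto
  qed
  also have "\<dots> = (\<integral>\<^sup>+\<omega>\<in>?A. ?D \<omega> \<partial>M) + (\<integral>\<^sup>+\<omega>. ennreal (C\<^sub>0 * (b - a)) * indicator ?E \<omega> \<partial>M)"
    unfolding intensity_on_event[OF ab A] by (rule nn_integral_add) measurable
  \<comment> \<open>The count is at most the indicator of at least one point plus the excess, whose
    mean is of order \<open>(b - a)\<^sup>2\<close>.\<close>
  also have "(\<integral>\<^sup>+\<omega>\<in>?A. ?D \<omega> \<partial>M) \<le> (\<integral>\<^sup>+\<omega>. indicator ?X \<omega> + ennreal (real (count_in N {a<..b} \<omega> - 1)) \<partial>M)"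
  proof (rule nn_integral_mono)
    fix \<omega>
    show "?D \<omega> * indicator ?A \<omega> \<le> indicator ?X \<omega> + ennreal (real (count_in N {a<..b} \<omega> - 1))"
    proof (cases "\<omega> \<in> ?X")
      case True
      then have "?D \<omega> = ennreal (1 + real (count_in N {a<..b} \<omega> - 1))" by simp
      also have "\<dots> = ennreal 1 + ennreal (real (count_in N {a<..b} \<omega> - 1))" by (rule ennreal_plus) auto
      finally show ?thesis using True by simp
    qed (auto simp: indicator_def not_less_eq_eq)
  qed
  also have "\<dots> = ennreal (prob ?X) + (\<integral>\<^sup>+\<omega>. ennreal (real (count_in N {a<..b} \<omega> - 1)) \<partial>M)"
    by (subst nn_integral_add) (auto simp: emeasure_eq_measure)
  also have "(\<integral>\<^sup>+\<omega>. ennreal (real (count_in N {a<..b} \<omega> - 1)) \<partial>M) \<le> ennreal (C\<^sub>0\<^sup>2 * (b - a)\<^sup>2)"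
    using nn_integral_excess_le[OF ab] by (simp add: power_mult_distrib)
  also have "(\<integral>\<^sup>+\<omega>. ennreal (C\<^sub>0 * (b - a)) * indicator ?E \<omega> \<partial>M) \<le> ennreal (C\<^sub>0\<^sup>2 * (b - a)\<^sup>2)" by (rule cE)
  finally have "ennreal ((b - a) * (rate n b * p n a)) \<le> ennreal (prob ?X) + ennreal (C\<^sub>0\<^sup>2 * (b - a)\<^sup>2) + ennreal (C\<^sub>0\<^sup>2 * (b - a)\<^sup>2)"
    by (simp add: add_mono)
  then have 2: "(b - a) * (rate n b * p n a) \<le> prob ?X + C\<^sub>0\<^sup>2 * (b - a)\<^sup>2 + C\<^sub>0\<^sup>2 * (b - a)\<^sup>2"
    by (simp flip: ennreal_plus)
  have "p n a \<le> 1" "0 \<le> p n a" by (auto simp: p_def)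
  have "(rate n a - rate n b) * p n a \<le> K * (n + \<gamma>) * (b - a) * 1"
    using rate_diff_le[OF ab, of n] \<open>p n a \<le> 1\<close> \<open>0 \<le> p n a\<close> K_pos gamma_nonneg ab by (intro mult_mono) auto
  then have "(b - a) * ((rate n a - rate n b) * p n a) \<le> (b - a) * (K * (n + \<gamma>) * (b - a))"
    using ab by (intro mult_left_mono) auto
  then have 3: "(b - a) * (rate n a * p n a) \<le> (b - a) * (rate n b * p n a) + K * (n + \<gamma>) * (b - a)\<^sup>2"
    by (simp add: power2_eq_square algebra_simps)
  have "0 \<le> K * (n + \<gamma>) * (b - a)\<^sup>2" "0 \<le> C\<^sub>0\<^sup>2 * (b - a)\<^sup>2" using K_pos gamma_nonneg by auto
  with 1 2 3 show ?thesis by (simp add: abs_le_iff algebra_simps)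
qed

section \<open>Increments of the marginal probabilities\<close>

lemma prob_two_points_le:
  assumes ab: "0 \<le> a" "a \<le> b"
  shows "prob {\<omega>\<in>space M. 2 \<le> count_in N {a<..b} \<omega>} \<le> C\<^sub>0\<^sup>2 * (b - a)\<^sup>2"
proof -
  let ?E = "{\<omega>\<in>space M. 2 \<le> count_in N {a<..b} \<omega>}"
  have "ennreal (prob ?E) = (\<integral>\<^sup>+\<omega>. indicator ?E \<omega> \<partial>M)"
    by (simp add: emeasure_eq_measure)
  also have "\<dots> \<le> (\<integral>\<^sup>+\<omega>. ennreal (real (count_in N {a<..b} \<omega> - 1)) \<partial>M)"
    by (rule nn_integral_mono) (auto simp: indicator_def)
  also have "\<dots> \<le> ennreal ((C\<^sub>0 * (b - a))\<^sup>2)" by (rule nn_integral_excess_le[OF ab])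
  finally show ?thesis by (simp add: power_mult_distrib)
qed

text \<open>Right-hand side of the Kolmogorov forward equation: probability entering from the state
  below minus probability leaving upwards.\<close>

definition flow :: "nat \<Rightarrow> real \<Rightarrow> real" where
  "flow n t = (case n of 0 \<Rightarrow> 0 | Suc m \<Rightarrow> rate m t * p m t) - rate n t * p n t"

text \<open>Up to quadratic terms at most one point falls into (a,b], so n is entered from n - 1 and
  left by single jumps, and \<open>prob_jump\<close> evaluates both.\<close>

lemma p_increment:
  assumes ab: "0 \<le> a" "a \<le> b"
  shows "\<bar>p n b - p n a - (b - a) * flow n a\<bar> \<le> (6 * C\<^sub>0\<^sup>2 + 2 * K * (n + \<gamma>)) * (b - a)\<^sup>2"
proof -
  \<comment> \<open>Events are predicates on the two counts, up to a and in (a,b], so that splitting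
    an event becomes logic on pairs of numbers.\<close>
  let ?ev = "\<lambda>P. prob {\<omega>\<in>space M. P (count_in N {0<..a} \<omega>) (count_in N {a<..b} \<omega>)}"
  have [measurable]: "{\<omega>\<in>space M. P (count_in N {0<..a} \<omega>) (count_in N {a<..b} \<omega>)} \<in> sets M" for P
    by measurable
  have Un: "?ev (\<lambda>i j. P i j \<or> Q i j) = ?ev P + ?ev Q" if "\<And>i j. \<not> (P i j \<and> Q i j)" for P Q
  proof -
    have "{\<omega>\<in>space M. P (count_in N {0<..a} \<omega>) (count_in N {a<..b} \<omega>) \<or> Q (count_in N {0<..a} \<omega>) (count_in N {a<..b} \<omega>)}
      = {\<omega>\<in>space M. P (count_in N {0<..a} \<omega>) (count_in N {a<..b} \<omega>)} \<union> {\<omega>\<in>space M. Q (count_in N {0<..a} \<omega>) (count_in N {a<..b} \<omega>)}"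
      by auto
    then show ?thesis using that by (simp only:) (rule finite_measure_Union, auto)
  qed
  have mono: "?ev P \<le> ?ev Q" if "\<And>i j. P i j \<Longrightarrow> Q i j" for P Q
    using that by (intro finite_measure_mono) auto
  define e where "e = C\<^sub>0\<^sup>2 * (b - a)\<^sup>2"
  have two: "?ev (\<lambda>i j. 2 \<le> j) \<le> e" unfolding e_def by (rule prob_two_points_le[OF ab])
  have "p n b = ?ev (\<lambda>i j. i + j = n)"
    unfolding p_def by (rule arg_cong[where f=prob]) (use count_split[of _ 0 a b] ab in auto)
  also have "\<dots> = ?ev (\<lambda>i j. (i = n \<and> j = 0) \<or> (i + j = n \<and> 1 \<le> j))"
    by (rule arg_cong[where f=prob]) auto
  also have "\<dots> = ?ev (\<lambda>i j. i = n \<and> j = 0) + ?ev (\<lambda>i j. i + j = n \<and> 1 \<le> j)"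
    by (rule Un) auto
  finally have A: "p n b = ?ev (\<lambda>i j. i = n \<and> j = 0) + ?ev (\<lambda>i j. i + j = n \<and> 1 \<le> j)" .
  have "p n a = ?ev (\<lambda>i j. (i = n \<and> j = 0) \<or> (i = n \<and> 1 \<le> j))"
    unfolding p_def by (rule arg_cong[where f=prob]) auto
  also have "\<dots> = ?ev (\<lambda>i j. i = n \<and> j = 0) + ?ev (\<lambda>i j. i = n \<and> 1 \<le> j)"
    by (rule Un) auto
  finally have B: "p n a = ?ev (\<lambda>i j. i = n \<and> j = 0) + ?ev (\<lambda>i j. i = n \<and> 1 \<le> j)" .
  have out: "\<bar>?ev (\<lambda>i j. i = n \<and> 1 \<le> j) - (b - a) * (rate n a * p n a)\<bar> \<le> (2 * C\<^sub>0\<^sup>2 + K * (n + \<gamma>)) * (b - a)\<^sup>2" for n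
    by (rule prob_jump[OF ab])
  have inn: "\<bar>?ev (\<lambda>i j. i + j = n \<and> 1 \<le> j) - (b - a) * (case n of 0 \<Rightarrow> 0 | Suc m \<Rightarrow> rate m a * p m a)\<bar>
    \<le> (2 * C\<^sub>0\<^sup>2 + K * (n + \<gamma>)) * (b - a)\<^sup>2 + e"
  proof (cases n)
    case 0
    have "?ev (\<lambda>i j. i + j = n \<and> 1 \<le> j) \<le> ?ev (\<lambda>i j. False)" by (rule mono) (use 0 in auto)
    then have "?ev (\<lambda>i j. i + j = n \<and> 1 \<le> j) = 0" using measure_nonneg by (simp add: antisym)
    then show ?thesis using 0 K_pos gamma_nonneg by (simp add: e_def)
  next
    case (Suc m)
    have "?ev (\<lambda>i j. i + j = n \<and> 1 \<le> j) \<le> ?ev (\<lambda>i j. (i = m \<and> j = 1) \<or> 2 \<le> j)"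
      using Suc by (intro mono) auto
    also have "\<dots> = ?ev (\<lambda>i j. i = m \<and> j = 1) + ?ev (\<lambda>i j. 2 \<le> j)" by (rule Un) auto
    also have "?ev (\<lambda>i j. i = m \<and> j = 1) \<le> ?ev (\<lambda>i j. i = m \<and> 1 \<le> j)" by (rule mono) auto
    finally have 1: "?ev (\<lambda>i j. i + j = n \<and> 1 \<le> j) \<le> ?ev (\<lambda>i j. i = m \<and> 1 \<le> j) + e" using two by simp
    have "?ev (\<lambda>i j. i = m \<and> 1 \<le> j) = ?ev (\<lambda>i j. (i = m \<and> j = 1) \<or> (i = m \<and> 2 \<le> j))"
      by (rule arg_cong[where f=prob]) auto
    also have "\<dots> = ?ev (\<lambda>i j. i = m \<and> j = 1) + ?ev (\<lambda>i j. i = m \<and> 2 \<le> j)" by (rule Un) auto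
    also have "?ev (\<lambda>i j. i = m \<and> 2 \<le> j) \<le> ?ev (\<lambda>i j. 2 \<le> j)" by (rule mono) auto
    also have "?ev (\<lambda>i j. i = m \<and> j = 1) \<le> ?ev (\<lambda>i j. i + j = n \<and> 1 \<le> j)" using Suc by (intro mono) auto
    finally have 2: "?ev (\<lambda>i j. i = m \<and> 1 \<le> j) \<le> ?ev (\<lambda>i j. i + j = n \<and> 1 \<le> j) + e" using two by simp
    have "(2 * C\<^sub>0\<^sup>2 + K * (m + \<gamma>)) * (b - a)\<^sup>2 \<le> (2 * C\<^sub>0\<^sup>2 + K * (n + \<gamma>)) * (b - a)\<^sup>2"
      using Suc K_pos by (intro mult_right_mono add_left_mono mult_left_mono) auto
    then show ?thesis using out[of m] 1 2 Suc by (simp add: abs_le_iff)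
  qed
  have "p n b - p n a - (b - a) * flow n a = (?ev (\<lambda>i j. i + j = n \<and> 1 \<le> j) - (b - a) * (case n of 0 \<Rightarrow> 0 | Suc m \<Rightarrow> rate m a * p m a))
    - (?ev (\<lambda>i j. i = n \<and> 1 \<le> j) - (b - a) * (rate n a * p n a))"
    unfolding A flow_def using B by (simp add: algebra_simps)
  then have "\<bar>p n b - p n a - (b - a) * flow n a\<bar> \<le> (2 * C\<^sub>0\<^sup>2 + K * (n + \<gamma>)) * (b - a)\<^sup>2 + e + (2 * C\<^sub>0\<^sup>2 + K * (n + \<gamma>)) * (b - a)\<^sup>2"
    using inn out[of n] by linarith
  also have "\<dots> \<le> (6 * C\<^sub>0\<^sup>2 + 2 * K * (n + \<gamma>)) * (b - a)\<^sup>2"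
    unfolding e_def by (simp add: algebra_simps)
  finally show ?thesis .
qed

lemma p_nonneg: "0 \<le> p n t"
  by (simp add: p_def)

lemma p_zero: "p n 0 = (if n = 0 then 1 else 0)"
  by (simp add: p_def count_in_def prob_space)

lemma continuous_on_rate: "continuous_on {0..} (rate n)"
  unfolding rate_def
  by (rule continuous_on_compose2[OF lipschitz_on_continuous_on[OF lam_lipschitz]])
    (use gamma_nonneg in \<open>auto intro!: continuous_intros\<close>)

text \<open>Follows from the increment estimate and a bound for \<open>flow\<close>. It cannot be
  read off from differentiability, which is itself deduced from continuity of
  \<open>flow\<close>.\<close>

lemma continuous_on_p: "continuous_on {0..} (p n)"
proof -
  define c where "c = 6 * C\<^sub>0\<^sup>2 + 2 * K * (n + \<gamma>)"
  have c: "c \<ge> 0" using K_pos gamma_nonneg by (simp add: c_def)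
  have fl: "\<bar>flow n a\<bar> \<le> C\<^sub>0" if "a \<ge> 0" for a
  proof -
    have r: "0 \<le> rate m a * p m a \<and> rate m a * p m a \<le> C\<^sub>0" for m
      using rate_nonneg[OF that, of m] rate_le[OF that, of m] p_nonneg[of m a] C0_nonneg
        mult_mono[of "rate m a" C\<^sub>0 "p m a" 1] by (auto simp: p_def)
    show ?thesis using r[of n] r[of "n - 1"] C0_nonneg by (cases n) (auto simp: flow_def abs_le_iff)
  qed
  have d: "\<bar>p n b - p n a\<bar> \<le> C\<^sub>0 * (b - a) + c * (b - a)\<^sup>2" if "0 \<le> a" "a \<le> b" for a b
  proof -
    have "\<bar>(b - a) * flow n a\<bar> \<le> C\<^sub>0 * (b - a)"
      using mult_left_mono[OF fl[OF that(1)], of "b - a"] that by (simp add: abs_mult mult.commute)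
    then show ?thesis using p_increment[OF that, of n] unfolding c_def by linarith
  qed
  show ?thesis
    unfolding continuous_on_def
  proof
    fix x :: real assume x: "x \<in> {0..}"
    have "((\<lambda>y. p n y - p n x) \<longlongrightarrow> 0) (at x within {0..})"
    proof (rule Lim_null_comparison)
      show "\<forall>\<^sub>F y in at x within {0..}. norm (p n y - p n x) \<le> C\<^sub>0 * \<bar>y - x\<bar> + c * (y - x)\<^sup>2"
      proof (unfold eventually_at_filter, intro always_eventually allI impI)
        fix y :: real assume "y \<noteq> x" "y \<in> {0..}"
        then show "norm (p n y - p n x) \<le> C\<^sub>0 * \<bar>y - x\<bar> + c * (y - x)\<^sup>2"
          using d[of x y] d[of y x] x by (cases "x \<le> y") (auto simp: abs_minus_commute power2_commute)
      qed
      have "((\<lambda>y. C\<^sub>0 * \<bar>y - x\<bar> + c * (y - x)\<^sup>2) \<longlongrightarrow> C\<^sub>0 * \<bar>x - x\<bar> + c * (x - x)\<^sup>2) (at x within {0..})"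
        by (intro tendsto_intros)
      then show "((\<lambda>y. C\<^sub>0 * \<bar>y - x\<bar> + c * (y - x)\<^sup>2) \<longlongrightarrow> 0) (at x within {0..})" by simp
    qed
    then show "(p n \<longlongrightarrow> p n x) (at x within {0..})" by (simp add: LIM_zero_iff)
  qed
qed

lemma continuous_on_flow: "continuous_on {0..} (flow n)"
proof (cases n)
  case 0
  then show ?thesis unfolding flow_def[abs_def]
    by (auto intro!: continuous_intros continuous_on_rate continuous_on_p)
next
  case (Suc m)
  then show ?thesis unfolding flow_def[abs_def]
    by (auto intro!: continuous_intros continuous_on_rate continuous_on_p)
qed

theorem forward_equation: "0 \<le> t \<Longrightarrow> (p n has_real_derivative flow n t) (at t within {0..})"
  by (rule has_real_derivative_from_quadratic_error[OF p_increment continuous_on_flow])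

end

section \<open>Transition estimates\<close>

lemma nondecreasing_if_derivative_nonneg:
  fixes f f' :: "real \<Rightarrow> real"
  assumes ab: "0 \<le> a" "a \<le> b"
    and deriv: "\<And>x. a \<le> x \<Longrightarrow> x \<le> b \<Longrightarrow> (f has_real_derivative f' x) (at x within {0..})"
    and nonneg: "\<And>x. a \<le> x \<Longrightarrow> x \<le> b \<Longrightarrow> 0 \<le> f' x"
  shows "f a \<le> f b"
proof (rule DERIV_nonneg_imp_increasing_open[OF ab(2)])
  fix x assume x: "a < x" "x < b"
  then have "at x within {0..} = at x" using ab by (intro at_within_interior) auto
  then show "\<exists>y. (f has_real_derivative y) (at x) \<and> 0 \<le> y"
    using deriv[of x] nonneg[of x] x by auto
next
  show "continuous_on {a..b} f"
    unfolding continuous_on_eq_continuous_within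
  proof
    fix x assume "x \<in> {a..b}"
    then show "continuous (at x within {a..b}) f"
      using DERIV_continuous[OF deriv[of x]] ab by (auto intro: continuous_within_subset)
  qed
qed

lemma mult_exp_minus_le_iff: "A * exp (- z) \<le> B \<longleftrightarrow> A \<le> exp z * B" for A B z :: real
  by (simp add: exp_minus field_simps)

lemma DERIV_power_over_fact:
  fixes c a x :: real
  shows "((\<lambda>x. (c * (x - a)) ^ Suc j / fact (Suc j)) has_real_derivative c * ((c * (x - a)) ^ j / fact j)) (at x within S)"
proof -
  have "((\<lambda>x. c * (x - a)) has_real_derivative c) (at x within S)"
    by (auto intro!: derivative_eq_intros)
  from DERIV_cdivide[OF DERIV_power_Suc[OF this, of j], of "fact (Suc j)"]
  have "((\<lambda>x. (c * (x - a)) ^ Suc j / fact (Suc j)) has_real_derivative (1 + real j) * (c * (c * (x - a)) ^ j) / fact (Suc j)) (at x within S)"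
    by simp
  moreover have "(1 + real j) * (c * (c * (x - a)) ^ j) / fact (Suc j) = c * ((c * (x - a)) ^ j / fact j)"
    by (simp add: fact_Suc)
  ultimately show ?thesis by simp
qed

text \<open>Integrating factor: multiplied by the exponential of an antiderivative of c, the
  function d is nondecreasing.\<close>

lemma nonneg_of_linear_differential_inequality:
  fixes d d' c :: "real \<Rightarrow> real"
  assumes ab: "0 \<le> a" "a \<le> b"
    and deriv: "\<And>x. a \<le> x \<Longrightarrow> x \<le> b \<Longrightarrow> (d has_real_derivative d' x) (at x within {0..})"
    and ineq: "\<And>x. a \<le> x \<Longrightarrow> x \<le> b \<Longrightarrow> 0 \<le> d' x + c x * d x"
    and c: "continuous_on {0..} c" and d0: "0 \<le> d a"
  shows "0 \<le> d b"
proof -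
  \<comment> \<open>The interval extends beyond b so that even at x = b a derivative within it is a
    derivative within \<open>{0..}\<close>.\<close>
  have "continuous_on {0..b + 1} c" using c by (rule continuous_on_subset) auto
  then obtain C where C: "\<And>x. x \<in> {0..b + 1} \<Longrightarrow> (C has_vector_derivative c x) (at x within {0..b + 1})"
    using antiderivative_continuous by blast
  have C': "(C has_real_derivative c x) (at x within {0..})" if "a \<le> x" "x \<le> b" for x
  proof -
    have "at x within {0..b + 1} = at x within {0..}"
      by (rule at_within_nhd[of x "{..<b + 1}"]) (use that ab in auto)
    then show ?thesis using C[of x] that ab by (simp add: has_real_derivative_iff_has_vector_derivative)
  qed
  have "exp (C a) * d a \<le> exp (C b) * d b"
  proof (rule nondecreasing_if_derivative_nonneg[OF ab])
    fix x assume x: "a \<le> x" "x \<le> b"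
    show "((\<lambda>x. exp (C x) * d x) has_real_derivative exp (C x) * (d' x + c x * d x)) (at x within {0..})"
      using C'[OF x] deriv[OF x] by (auto intro!: derivative_eq_intros simp: algebra_simps)
    show "0 \<le> exp (C x) * (d' x + c x * d x)" using ineq[OF x] by simp
  qed
  moreover have "0 \<le> exp (C a) * d a" using d0 by simp
  ultimately show ?thesis by (smt (verit) exp_gt_zero zero_le_mult_iff)
qed

context self_exciting begin

lemma rate_mono: "0 \<le> t \<Longrightarrow> m \<le> n \<Longrightarrow> rate m t \<le> rate n t"
  unfolding rate_def using gamma_nonneg by (intro lam_mono) (auto intro!: divide_right_mono)

text \<open>After multiplication by \<open>exp (hi * (x - a))\<close>, which compensates the
  outflow, each state grows at least at speed lo times the state below; induction on m integrates
  this to a Poisson power. The end time r is kept apart from b so that the induction hypothesis is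
  available at all intermediate times.\<close>

lemma transition_lower:
  assumes a: "0 \<le> a" and r: "a \<le> r" "r \<le> b" and lo: "0 \<le> lo"
    and lo_rate: "\<And>j s. j < m \<Longrightarrow> a \<le> s \<Longrightarrow> s \<le> b \<Longrightarrow> lo \<le> rate (n + j) s"
    and hi_rate: "\<And>j s. j \<le> m \<Longrightarrow> a \<le> s \<Longrightarrow> s \<le> b \<Longrightarrow> rate (n + j) s \<le> hi"
  shows "p n a * ((lo * (r - a)) ^ m / fact m) * exp (- hi * (r - a)) \<le> p (n + m) r"
  using r lo_rate hi_rate
proof (induction m arbitrary: r)
  case 0
  have "exp (hi * (a - a)) * p n a \<le> exp (hi * (r - a)) * p n r"
  proof (rule nondecreasing_if_derivative_nonneg[OF a \<open>a \<le> r\<close>])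
    fix x assume x: "a \<le> x" "x \<le> r"
    show "((\<lambda>x. exp (hi * (x - a)) * p n x) has_real_derivative exp (hi * (x - a)) * (hi * p n x + flow n x)) (at x within {0..})"
      using a x by (auto intro!: derivative_eq_intros forward_equation simp: algebra_simps)
    have "rate n x * p n x \<le> hi * p n x" using 0 x p_nonneg by (intro mult_right_mono) auto
    moreover have "0 \<le> (case n of 0 \<Rightarrow> 0 | Suc m \<Rightarrow> rate m x * p m x)"
      using a x p_nonneg rate_nonneg by (cases n) auto
    ultimately show "0 \<le> exp (hi * (x - a)) * (hi * p n x + flow n x)"
      by (intro mult_nonneg_nonneg) (auto simp: flow_def)
  qed
  then have "p n a * exp (- hi * (r - a)) \<le> exp (hi * (r - a)) * p n r * exp (- hi * (r - a))"
    by (intro mult_right_mono) auto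
  also have "\<dots> = p n r" by (simp add: exp_minus)
  finally show ?case by simp
next
  case (Suc m)
  have IH: "p n a * ((lo * (x - a)) ^ m / fact m) \<le> exp (hi * (x - a)) * p (n + m) x" if "a \<le> x" "x \<le> b" for x
  proof -
    have "p n a * ((lo * (x - a)) ^ m / fact m) * exp (- hi * (x - a)) \<le> p (n + m) x"
      using Suc.IH[OF that] Suc.prems by simp
    then show ?thesis by (intro mult_exp_minus_le_iff[THEN iffD1]) (simp only: mult_minus_left)
  qed
  define d where "d x = exp (hi * (x - a)) * p (n + Suc m) x - p n a * ((lo * (x - a)) ^ Suc m / fact (Suc m))" for x
  have "d a \<le> d r"
  proof (rule nondecreasing_if_derivative_nonneg[OF a \<open>a \<le> r\<close>])
    fix x assume x: "a \<le> x" "x \<le> r"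
    let ?D = "exp (hi * (x - a)) * (hi * p (n + Suc m) x + flow (n + Suc m) x) - p n a * (lo * ((lo * (x - a)) ^ m / fact m))"
    note P = DERIV_power_over_fact[of lo a m x "{0..}"]
    have Q: "((\<lambda>x. exp (hi * (x - a)) * p (n + Suc m) x) has_real_derivative exp (hi * (x - a)) * (hi * p (n + Suc m) x + flow (n + Suc m) x)) (at x within {0..})"
      using a x by (auto intro!: derivative_eq_intros forward_equation simp: algebra_simps)
    show "(d has_real_derivative ?D) (at x within {0..})"
      unfolding d_def using DERIV_diff[OF Q DERIV_cmult[OF P]] by simp
    have "rate (n + Suc m) x * p (n + Suc m) x \<le> hi * p (n + Suc m) x"
      using Suc.prems(4)[of "Suc m" x] Suc.prems(2) x p_nonneg by (intro mult_right_mono) auto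
    moreover have "lo * p (n + m) x \<le> rate (n + m) x * p (n + m) x"
      using Suc.prems x p_nonneg by (intro mult_right_mono) auto
    ultimately have "exp (hi * (x - a)) * (lo * p (n + m) x) \<le> exp (hi * (x - a)) * (hi * p (n + Suc m) x + flow (n + Suc m) x)"
      by (intro mult_left_mono) (auto simp: flow_def)
    moreover have "lo * (p n a * ((lo * (x - a)) ^ m / fact m)) \<le> lo * (exp (hi * (x - a)) * p (n + m) x)"
      using IH[of x] x Suc.prems lo by (intro mult_left_mono) auto
    ultimately show "0 \<le> ?D" by (simp only: mult.left_commute)
  qed
  moreover have "0 \<le> d a" using p_nonneg by (simp add: d_def)
  ultimately have "p n a * ((lo * (r - a)) ^ Suc m / fact (Suc m)) \<le> exp (hi * (r - a)) * p (n + Suc m) r"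
    by (simp add: d_def)
  then have "p n a * ((lo * (r - a)) ^ Suc m / fact (Suc m)) * exp (- hi * (r - a)) \<le> exp (hi * (r - a)) * p (n + Suc m) r * exp (- hi * (r - a))"
    by (intro mult_right_mono) auto
  also have "\<dots> = p (n + Suc m) r" by (simp add: exp_minus)
  finally show ?case .
qed

text \<open>The right-hand side is a supersolution of the forward equation with the same values at
  time a. Its decay uses \<open>rate m b\<close>, the smallest rate over states from m on and times
  up to b, so it loses no more than \<open>rate n x\<close> allows. Its gain uses hi, which
  dominates all rates of the states below n.\<close>

lemma transition_upper:
  assumes a: "0 \<le> a" and r: "a \<le> r" "r \<le> b"
    and hi: "\<And>j. j < n \<Longrightarrow> rate j a \<le> hi" and hi0: "0 \<le> hi"
  shows "p n r \<le> (\<Sum>m\<le>n. p m a * ((hi * (r - a)) ^ (n - m) / fact (n - m) * exp (- rate m b * (r - a))))"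
proof -
  define v where "v k m r = (hi * (r - a)) ^ k / fact k * exp (- rate m b * (r - a))" for k m r
  define u where "u n r = (\<Sum>m\<le>n. p m a * v (n - m) m r)" for n r
  have v0: "0 \<le> v k m x" if "a \<le> x" for k m x using hi0 that by (simp add: v_def)
  have dv: "(v k m has_real_derivative (case k of 0 \<Rightarrow> 0 | Suc j \<Rightarrow> hi * v j m x) - rate m b * v k m x) (at x within {0..})" for k m x
  proof (cases k)
    case 0
    show ?thesis unfolding 0 v_def by (auto intro!: derivative_eq_intros)
  next
    case (Suc j)
    note P = DERIV_power_over_fact[of hi a j x "{0..}"]
    have Q: "((\<lambda>x. exp (- rate m b * (x - a))) has_real_derivative - rate m b * exp (- rate m b * (x - a))) (at x within {0..})"
      by (auto intro!: derivative_eq_intros)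
    show ?thesis unfolding Suc v_def
      by (rule DERIV_cong[OF DERIV_mult[OF P Q]]) (simp add: ac_simps del: power_Suc fact_Suc)
  qed
  have du: "(u n has_real_derivative (case n of 0 \<Rightarrow> 0 | Suc j \<Rightarrow> hi * u j x) - (\<Sum>m\<le>n. p m a * (rate m b * v (n - m) m x))) (at x within {0..})" for n x
  proof -
    have "(u n has_real_derivative (\<Sum>m\<le>n. p m a * ((case n - m of 0 \<Rightarrow> 0 | Suc j \<Rightarrow> hi * v j m x) - rate m b * v (n - m) m x))) (at x within {0..})"
      unfolding u_def by (intro DERIV_sum DERIV_cmult dv)
    moreover have "(\<Sum>m\<le>n. p m a * ((case n - m of 0 \<Rightarrow> 0 | Suc j \<Rightarrow> hi * v j m x) - rate m b * v (n - m) m x))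
      = (\<Sum>m\<le>n. p m a * (case n - m of 0 \<Rightarrow> 0 | Suc j \<Rightarrow> hi * v j m x)) - (\<Sum>m\<le>n. p m a * (rate m b * v (n - m) m x))"
      by (simp add: right_diff_distrib sum_subtractf)
    moreover have "(\<Sum>m\<le>n. p m a * (case n - m of 0 \<Rightarrow> 0 | Suc j \<Rightarrow> hi * v j m x)) = (case n of 0 \<Rightarrow> 0 | Suc j \<Rightarrow> hi * u j x)"
    proof (cases n)
      case (Suc j)
      have "(\<Sum>m\<le>j. p m a * (case n - m of 0 \<Rightarrow> 0 | Suc j \<Rightarrow> hi * v j m x)) = hi * u j x"
        unfolding u_def sum_distrib_left by (rule sum.cong) (auto simp: Suc Suc_diff_le)
      then show ?thesis by (simp add: Suc)
    qed simp
    ultimately show ?thesis by simp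
  qed
  \<comment> \<open>Once the state below is dominated, the difference u - p satisfies a linear
    differential inequality with coefficient \<open>rate n\<close>.\<close>
  have step: "0 \<le> (u n r - p n r)" if r: "a \<le> r" "r \<le> b"
    and IH: "\<And>x. a \<le> x \<Longrightarrow> x \<le> b \<Longrightarrow> (case n of 0 \<Rightarrow> 0 | Suc j \<Rightarrow> rate j x * p j x) \<le> (case n of 0 \<Rightarrow> 0 | Suc j \<Rightarrow> hi * u j x)" for n r
  proof (rule nonneg_of_linear_differential_inequality[OF a r(1), where d = "\<lambda>x. u n x - p n x"])
    fix x assume x: "a \<le> x" "x \<le> r"
    show "((\<lambda>x. u n x - p n x) has_real_derivative
      ((case n of 0 \<Rightarrow> 0 | Suc j \<Rightarrow> hi * u j x) - (\<Sum>m\<le>n. p m a * (rate m b * v (n - m) m x))) - flow n x) (at x within {0..})"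
      using a x by (intro DERIV_diff du forward_equation) auto
    have "(\<Sum>m\<le>n. p m a * (rate m b * v (n - m) m x)) \<le> (\<Sum>m\<le>n. rate n x * (p m a * v (n - m) m x))"
    proof (rule sum_mono)
      fix m assume "m \<in> {..n}"
      then have "rate m b \<le> rate n x"
        using rate_antimono[of x b m] rate_mono[of x m n] a x r by auto
      then have "rate m b * (p m a * v (n - m) m x) \<le> rate n x * (p m a * v (n - m) m x)"
        using p_nonneg v0[OF x(1)] by (intro mult_right_mono) auto
      then show "p m a * (rate m b * v (n - m) m x) \<le> rate n x * (p m a * v (n - m) m x)"
        by (simp only: mult.left_commute)
    qed
    also have "\<dots> = rate n x * u n x" by (simp add: u_def sum_distrib_left)
    finally show "0 \<le> ((case n of 0 \<Rightarrow> 0 | Suc j \<Rightarrow> hi * u j x) - (\<Sum>m\<le>n. p m a * (rate m b * v (n - m) m x))) - flow n x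
      + rate n x * (u n x - p n x)"
      using IH[of x] x r by (simp add: flow_def algebra_simps)
  next
    show "continuous_on {0..} (rate n)" by (rule continuous_on_rate)
    have "u n a = (\<Sum>m\<le>n. if m = n then p n a else 0)"
      unfolding u_def by (rule sum.cong) (auto simp: v_def)
    then show "0 \<le> u n a - p n a" by simp
  qed
  have "p n r \<le> u n r"
    using r hi
  proof (induction n arbitrary: r)
    case 0
    then show ?case using step[of r 0] by simp
  next
    case (Suc n)
    have "rate n x * p n x \<le> hi * u n x" if x: "a \<le> x" "x \<le> b" for x
    proof -
      have "rate n x \<le> hi" using Suc.prems(3)[of n] rate_antimono[OF a x(1), of n] by simp
      moreover have "p n x \<le> u n x" using Suc.IH[OF x] Suc.prems(3) by simp
      ultimately show ?thesis using hi0 p_nonneg by (intro mult_mono) auto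
    qed
    then show ?case using step[of r "Suc n"] Suc.prems by simp
  qed
  then show ?thesis by (simp add: u_def v_def)
qed

end

section \<open>The lower bound\<close>

text \<open>For positive F this says that the lower limit of \<open>ln (F t) / t\<close> is at least
  -x. Written without a logarithm it includes eventual positivity and multiplies well, which is how
  grid cells are chained.\<close>

definition exponent_at_most :: "(real \<Rightarrow> real) \<Rightarrow> real \<Rightarrow> bool" where
  "exponent_at_most F x \<longleftrightarrow> (\<forall>e>0. \<forall>\<^sub>F t in at_top. exp (- t * (x + e)) \<le> F t)"

lemma exponent_at_mostD:
  "exponent_at_most F x \<Longrightarrow> 0 < e \<Longrightarrow> \<forall>\<^sub>F t in at_top. exp (- t * (x + e)) \<le> F t"
  by (simp add: exponent_at_most_def)

lemma exponent_at_most_weaken: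
  assumes "exponent_at_most F x" "x \<le> y" "\<forall>\<^sub>F t in at_top. F t \<le> G t"
  shows "exponent_at_most G y"
  unfolding exponent_at_most_def
proof (intro allI impI)
  fix e :: real assume "e > 0"
  from exponent_at_mostD[OF assms(1) this] assms(3) eventually_ge_at_top[of "0::real"]
  show "\<forall>\<^sub>F t in at_top. exp (- t * (y + e)) \<le> G t"
  proof eventually_elim
    case (elim t)
    have "t * (x + e) \<le> t * (y + e)" using elim(3) assms(2) by (intro mult_left_mono) auto
    then have "exp (- t * (y + e)) \<le> exp (- t * (x + e))" by simp
    with elim show ?case by linarith
  qed
qed

lemma exponent_at_most_mult:
  assumes "exponent_at_most F x" "exponent_at_most G y"
  shows "exponent_at_most (\<lambda>t. F t * G t) (x + y)"
  unfolding exponent_at_most_def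
proof (intro allI impI)
  fix e :: real assume "e > 0"
  then have "e / 2 > 0" by simp
  from exponent_at_mostD[OF assms(1) this] exponent_at_mostD[OF assms(2) this]
  show "\<forall>\<^sub>F t in at_top. exp (- t * (x + y + e)) \<le> F t * G t"
  proof eventually_elim
    case (elim t)
    have "exp (- t * (x + y + e)) = exp (- t * (x + e / 2)) * exp (- t * (y + e / 2))"
      by (simp add: exp_add[symmetric] algebra_simps)
    also have "\<dots> \<le> F t * G t" using elim order_trans[OF exp_ge_zero elim(1)] by (intro mult_mono) auto
    finally show ?case .
  qed
qed

lemma exponent_at_most_limit:
  assumes "(a \<longlongrightarrow> x) at_top" "\<forall>\<^sub>F t in at_top. exp (- t * a t) \<le> F t"
  shows "exponent_at_most F x"
  unfolding exponent_at_most_def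
proof (intro allI impI)
  fix e :: real assume "e > 0"
  then have "\<forall>\<^sub>F t in at_top. a t < x + e" using assms(1) by (intro order_tendstoD) auto
  with assms(2) eventually_ge_at_top[of "0::real"]
  show "\<forall>\<^sub>F t in at_top. exp (- t * (x + e)) \<le> F t"
  proof eventually_elim
    case (elim t)
    have "t * a t \<le> t * (x + e)" using elim by (intro mult_left_mono) auto
    then have "exp (- t * (x + e)) \<le> exp (- t * a t)" by simp
    with elim show ?case by linarith
  qed
qed

lemma tendsto_mult_ln:
  fixes u :: "real \<Rightarrow> real" and u0 :: real
  assumes u: "(u \<longlongrightarrow> u0) F" and u0: "0 \<le> u0" and pos: "\<forall>\<^sub>F t in F. 0 < u t"
  shows "((\<lambda>t. u t * ln (u t)) \<longlongrightarrow> u0 * ln u0) F"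
proof (cases "u0 = 0")
  case False
  then show ?thesis using u u0 by (intro tendsto_intros) auto
next
  case True
  have l: "((\<lambda>x::real. x * ln x) \<longlongrightarrow> 0) (at_right 0)" by real_asymp
  have "filterlim u (at_right 0) F"
    using u pos True by (auto simp: filterlim_at eventually_mono)
  from filterlim_compose[OF l this] show ?thesis using True by simp
qed

text \<open>Stirling's formula for a count that grows like t u. The alternative z = 0 covers a cell
  without climb and with vanishing rate, where the weight is \<open>0 ^ 0 = 1\<close>.\<close>

lemma exponent_poisson_weight:
  fixes m :: "real \<Rightarrow> nat" and u z :: real
  assumes m: "\<forall>\<^sub>F t in at_top. \<bar>real (m t) - t * u\<bar> \<le> 1" and u: "0 \<le> u"
    and z: "0 < z \<or> u = 0 \<and> z = 0 \<and> (\<forall>t. m t = 0)"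
  shows "exponent_at_most (\<lambda>t. (z * t) ^ m t / fact (m t)) (u * ln (u / z) - u)"
proof (cases "0 < z")
  case False
  then show ?thesis using z
    by (auto simp: exponent_at_most_def eventually_at_top_linorder intro!: exI[of _ 0])
next
  case True
  \<comment> \<open>Normalised with m + 1 because \<open>ln_fact_le\<close> is; the last term of
    \<open>a\<close> below collects the resulting corrections.\<close>
  define v where "v t = (real (m t) + 1) / t" for t
  have vlim: "(v \<longlongrightarrow> u) at_top"
  proof (rule tendsto_sandwich)
    show "\<forall>\<^sub>F t in at_top. u \<le> v t"
      using m eventually_gt_at_top[of 0]
      by eventually_elim (simp add: v_def le_divide_eq mult.commute abs_le_iff)
    show "\<forall>\<^sub>F t in at_top. v t \<le> u + 2 / t"
      using m eventually_gt_at_top[of 0]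
    proof eventually_elim
      case (elim t)
      have "v t \<le> (t * u + 2) / t" unfolding v_def using elim by (intro divide_right_mono) auto
      also have "\<dots> = u + 2 / t" using elim by (simp add: add_divide_distrib)
      finally show ?case .
    qed
    show "((\<lambda>t. u + 2 / t) \<longlongrightarrow> u) at_top" by real_asymp
  qed simp
  have vpos: "\<forall>\<^sub>F t in at_top. 0 < v t"
    using eventually_gt_at_top[of 0] by eventually_elim (simp add: v_def add_pos_pos)
  define a where "a t = v t * ln (v t) - v t * ln z - v t + (1 + ln (z * t)) / t" for t
  have "((\<lambda>t. (1 + ln (z * t)) / t) \<longlongrightarrow> 0) at_top" using True by real_asymp
  then have "(a \<longlongrightarrow> u * ln u - u * ln z - u + 0) at_top"
    unfolding a_def by (intro tendsto_intros tendsto_mult_ln vlim vpos u)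
  moreover have "u * ln u - u * ln z - u + 0 = u * ln (u / z) - u"
    using True u by (cases "u = 0") (auto simp: ln_div algebra_simps)
  ultimately have alim: "(a \<longlongrightarrow> u * ln (u / z) - u) at_top" by simp
  have "\<forall>\<^sub>F t in at_top. exp (- t * a t) \<le> (z * t) ^ m t / fact (m t)"
    using eventually_gt_at_top[of 0]
  proof eventually_elim
    case (elim t)
    have M: "real (m t) + 1 = t * v t" using elim by (simp add: v_def)
    have M': "t * v t - 1 = real (m t)" using elim by (simp add: v_def)
    have vt: "v t > 0" using elim by (simp add: v_def add_pos_pos)
    have "ln (fact (m t)) \<le> t * v t * ln (t * v t) - (t * v t - 1)"
      using ln_fact_le[of "m t"] M by (metis add_diff_cancel_right')
    then have "(t * v t - 1) * ln (z * t) - ln (fact (m t)) \<ge> - t * a t"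
    proof -
      have "t * a t = t * v t * ln (v t) - t * v t * ln z - t * v t + (1 + ln (z * t))"
      proof -
        have "t * a t = t * (v t * ln (v t) - v t * ln z - v t) + t * ((1 + ln (z * t)) / t)"
          by (simp only: a_def distrib_left)
        also have "t * ((1 + ln (z * t)) / t) = 1 + ln (z * t)" using elim by simp
        finally show ?thesis by (simp add: right_diff_distrib)
      qed
      moreover have "ln (z * t) = ln z + ln t" "ln (t * v t) = ln t + ln (v t)"
        using True elim vt by (simp_all add: ln_mult)
      ultimately show ?thesis
        using \<open>ln (fact (m t)) \<le> _\<close> by (simp add: algebra_simps)
    qed
    then have "- t * a t \<le> real (m t) * ln (z * t) - ln (fact (m t))"
      unfolding M' .
    also have "\<dots> = ln ((z * t) ^ m t / fact (m t))" using True elim by (simp add: ln_div ln_realpow)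
    finally show ?case using True elim by (simp add: ln_ge_iff)
  qed
  with alim show ?thesis by (rule exponent_at_most_limit)
qed

text \<open>The case in which state 0 can be left, since \<open>rate 0 0 = lam \<gamma>\<close>. The
  rate in state 0 need not stay positive, as \<gamma> / (t + 1) decreases.\<close>

locale active_process = self_exciting +
  assumes lam_gamma_pos: "0 < lam \<gamma>"
begin

lemma C0_pos: "0 < C\<^sub>0"
  using lam_gamma_pos lam_bounded[OF gamma_nonneg] by simp

section \<open>Holding and the initial climb\<close>

lemma hold_lower:
  assumes "0 \<le> a" "a \<le> b"
  shows "p n a * exp (- C\<^sub>0 * (b - a)) \<le> p n b"
  using transition_lower[of a b b 0 0 n C\<^sub>0] assms rate_le by simp

text \<open>In state 0 the rate is known to be positive only near time 0. So the jump is made by a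
  small time s, and the process then holds until t.\<close>

lemma p_one_pos:
  assumes "0 < t"
  shows "0 < p 1 t"
proof -
  have "isCont (\<lambda>s. \<gamma> / (s + 1)) 0" by (intro continuous_intros) auto
  have "continuous (at 0 within {0..}) (rate 0)"
    using continuous_on_rate[of 0] by (simp add: continuous_on_eq_continuous_within)
  then have "(rate 0 \<longlongrightarrow> rate 0 0) (at 0 within {0..})" by (simp add: continuous_within)
  moreover have r0: "rate 0 0 = lam \<gamma>" by (simp add: rate_def)
  ultimately have "\<forall>\<^sub>F s in at 0 within {0..}. 0 < rate 0 s"
    using lam_gamma_pos by (intro order_tendstoD) auto
  then obtain d where d: "d > 0" "\<And>s. 0 < s \<Longrightarrow> s < d \<Longrightarrow> 0 < rate 0 s"
    unfolding eventually_at by (auto simp: dist_real_def)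
  define s where "s = min (d / 2) t"
  have s: "0 < s" "s < d" "s \<le> t" using d assms by (auto simp: s_def)
  have "p 0 0 * ((rate 0 s * (s - 0)) ^ 1 / fact 1) * exp (- C\<^sub>0 * (s - 0)) \<le> p (0 + 1) s"
  proof (rule transition_lower[where b = s])
    show "rate 0 s \<le> rate (0 + j) r" if "j < 1" "0 \<le> r" "r \<le> s" for j r
      using that rate_antimono[of r s 0] by simp
    show "rate (0 + j) r \<le> C\<^sub>0" if "0 \<le> r" for j r using that rate_le by simp
  qed (use s rate_nonneg in auto)
  moreover have "0 < p 0 0 * ((rate 0 s * (s - 0)) ^ 1 / fact 1) * exp (- C\<^sub>0 * (s - 0))"
    using d(2)[OF s(1,2)] s by (simp add: p_zero)
  ultimately have "0 < p 1 s" by simp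
  then show ?thesis using hold_lower[of s t 1] s by (smt (verit) exp_gt_zero mult_pos_pos)
qed

text \<open>Jumping once in every time interval of length \<open>1 / g\<close> keeps the intensity above
  \<open>lam \<gamma>\<close>, which need not be true if the process waits.\<close>

lemma steady_growth:
  assumes g: "2 * \<gamma> + 1 \<le> g"
  shows "p 1 (1 / g) * (lam \<gamma> / g) ^ n * exp (- C\<^sub>0 * (n / g)) \<le> p (Suc n) (Suc n / g)"
proof (induction n)
  case 0
  then show ?case by simp
next
  case (Suc n)
  have g0: "g > 0" using g gamma_nonneg by simp
  have "p (Suc n) (Suc n / g) * ((lam \<gamma> * (Suc (Suc n) / g - Suc n / g)) ^ 1 / fact 1) * exp (- C\<^sub>0 * (Suc (Suc n) / g - Suc n / g))
    \<le> p (Suc n + 1) (Suc (Suc n) / g)"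
  proof (rule transition_lower[where b = "Suc (Suc n) / g"])
    show "lam \<gamma> \<le> rate (Suc n + j) s" if s: "j < 1" "Suc n / g \<le> s" "s \<le> Suc (Suc n) / g" for j s
    proof -
      have s0: "0 \<le> s" using s(2) g0 by (meson divide_nonneg_pos of_nat_0_le_iff order_trans)
      have "\<gamma> * (s + 1) \<le> \<gamma> * (real (Suc (Suc n)) / g + 1)"
        using s gamma_nonneg by (intro mult_left_mono) auto
      also have "\<dots> \<le> real (Suc n) + \<gamma>"
      proof -
        \<comment> \<open>This is where \<open>2 * \<gamma> \<le> g\<close> enters, through n + 2
          \<le> 2 (n + 1).\<close>
        have "\<gamma> * real (Suc (Suc n)) \<le> g * real (Suc n)"
        proof -
          have "\<gamma> * real (Suc (Suc n)) \<le> (2 * \<gamma>) * real (Suc n)" using gamma_nonneg by (simp add: algebra_simps)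
          also have "\<dots> \<le> g * real (Suc n)" using g by (intro mult_right_mono) auto
          finally show ?thesis .
        qed
        then have "\<gamma> * (real (Suc (Suc n)) / g) \<le> real (Suc n)" using g0 by (simp add: divide_le_eq mult.commute)
        then show ?thesis by (simp add: distrib_left)
      qed
      finally have "\<gamma> \<le> (real (Suc n + j) + \<gamma>) / (s + 1)"
        using s s0 by (simp add: le_divide_eq)
      then show ?thesis unfolding rate_def using gamma_nonneg by (intro lam_mono) auto
    qed
    show "rate (Suc n + j) s \<le> C\<^sub>0" if "j \<le> 1" "Suc n / g \<le> s" for j s
      using that g0 by (intro rate_le) (meson divide_nonneg_pos of_nat_0_le_iff order_trans)
  qed (use g0 lam_gamma_pos in \<open>auto simp: divide_right_mono\<close>)
  moreover have "real (Suc (Suc n)) / g - real (Suc n) / g = 1 / g" by (simp add: add_divide_distrib)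
  ultimately have "p (Suc n) (Suc n / g) * (lam \<gamma> / g * exp (- C\<^sub>0 / g)) \<le> p (Suc (Suc n)) (Suc (Suc n) / g)"
    by (simp add: mult.assoc)
  moreover have "p 1 (1 / g) * (lam \<gamma> / g) ^ n * exp (- C\<^sub>0 * (n / g)) * (lam \<gamma> / g * exp (- C\<^sub>0 / g))
    \<le> p (Suc n) (Suc n / g) * (lam \<gamma> / g * exp (- C\<^sub>0 / g))"
    using Suc lam_gamma_pos g0 by (intro mult_right_mono) auto
  moreover have "p 1 (1 / g) * (lam \<gamma> / g) ^ n * exp (- C\<^sub>0 * (n / g)) * (lam \<gamma> / g * exp (- C\<^sub>0 / g))
    = p 1 (1 / g) * (lam \<gamma> / g) ^ Suc n * exp (- C\<^sub>0 * (Suc n / g))"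
  proof -
    have "exp (- C\<^sub>0 * (real (Suc n) / g)) = exp (- C\<^sub>0 * (n / g)) * exp (- C\<^sub>0 / g)"
      by (simp add: exp_add[symmetric] add_divide_distrib algebra_simps)
    then show ?thesis by (simp only: power_Suc ac_simps)
  qed
  ultimately show ?case by linarith
qed

text \<open>One jump per time 1 / g reaches the required height no later than t \<eta>, because
  \<open>y / \<eta> \<le> g\<close>; afterwards the process holds, at a price of at most
  \<open>C\<^sub>0\<close> per unit of time. The exponent is crude, but
  \<open>initial_excess\<close> shows that it suffices.\<close>

lemma exponent_initial:
  assumes \<eta>: "0 < \<eta>" and y: "0 < y" and g: "2 * \<gamma> + 1 \<le> g" "y / \<eta> \<le> g"
  shows "exponent_at_most (\<lambda>t. p (nat \<lfloor>t * y\<rfloor>) (t * \<eta>)) (y * (ln g - ln (lam \<gamma>)) + C\<^sub>0 * \<eta>)"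
proof -
  have g0: "g > 0" using g gamma_nonneg by simp
  define q where "q = ln (lam \<gamma>) - ln g"
  define c where "c = ln (p 1 (1 / g))"
  have p1: "0 < p 1 (1 / g)" using g0 by (intro p_one_pos) simp
  define N' where "N' t = nat \<lfloor>t * y\<rfloor>" for t
  \<comment> \<open>The first of the \<open>N' t\<close> jumps is paid for by the constant c, hence
    the subtraction of 1 / t.\<close>
  define a where "a t = - (real (N' t) / t - 1 / t) * q + C\<^sub>0 * \<eta> - c / t" for t
  have "((\<lambda>t. real (N' t) / t) \<longlongrightarrow> y) at_top"
  proof (rule tendsto_sandwich)
    show "\<forall>\<^sub>F t in at_top. y - 1 / t \<le> real (N' t) / t"
      using eventually_gt_at_top[of 0]
    proof eventually_elim
      case (elim t)
      then have "t * y - 1 \<le> real (N' t)" unfolding N'_def by linarith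
      then have "(t * y - 1) / t \<le> real (N' t) / t" using elim by (intro divide_right_mono) auto
      then show ?case using elim by (simp add: diff_divide_distrib)
    qed
    show "\<forall>\<^sub>F t in at_top. real (N' t) / t \<le> y"
      using eventually_gt_at_top[of 0]
    proof eventually_elim
      case (elim t)
      then have "real (N' t) \<le> t * y" using y unfolding N'_def by simp
      then show ?case using elim by (simp add: divide_le_eq mult.commute)
    qed
    show "((\<lambda>t. y - 1 / t) \<longlongrightarrow> y) at_top" by real_asymp
  qed simp
  moreover have "((\<lambda>t::real. 1 / t) \<longlongrightarrow> 0) at_top" "((\<lambda>t. c / t) \<longlongrightarrow> 0) at_top" by real_asymp+
  ultimately have "(a \<longlongrightarrow> - (y - 0) * q + C\<^sub>0 * \<eta> - 0) at_top"
    unfolding a_def by (intro tendsto_intros)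
  then have lim: "(a \<longlongrightarrow> y * (ln g - ln (lam \<gamma>)) + C\<^sub>0 * \<eta>) at_top"
    by (simp add: q_def algebra_simps)
  have "\<forall>\<^sub>F t in at_top. exp (- t * a t) \<le> p (N' t) (t * \<eta>)"
    using eventually_gt_at_top[of "1 / y"] eventually_gt_at_top[of 0]
  proof eventually_elim
    case (elim t)
    then have "1 \<le> t * y" using y by (simp add: field_simps)
    then have "1 \<le> N' t" unfolding N'_def by linarith
    then obtain n where n: "N' t = Suc n" by (cases "N' t") auto
    have "real (Suc n) \<le> t * y" using n elim y unfolding N'_def by (metis floor_le_iff mult_pos_pos of_int_floor_le of_nat_nat order_less_imp_le zero_le_floor)
    also have "\<dots> \<le> g * (t * \<eta>)" using g(2) \<eta> elim by (simp add: divide_le_eq mult_left_mono)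
    finally have time: "real (Suc n) / g \<le> t * \<eta>" using g0 by (simp add: divide_le_eq mult.commute)
    have "exp (- t * a t) = p 1 (1 / g) * (lam \<gamma> / g) ^ n * exp (- C\<^sub>0 * (t * \<eta>))"
    proof -
      have "- t * a t = c + real n * q - C\<^sub>0 * (t * \<eta>)" using elim n by (simp add: a_def field_simps)
      moreover have "exp (real n * q) = (lam \<gamma> / g) ^ n"
        using lam_gamma_pos g0 by (simp add: exp_of_nat_mult q_def exp_diff)
      ultimately show ?thesis using p1 by (simp add: exp_add exp_diff exp_minus c_def divide_inverse)
    qed
    also have "\<dots> \<le> p 1 (1 / g) * (lam \<gamma> / g) ^ n * (exp (- C\<^sub>0 * (n / g)) * exp (- C\<^sub>0 * (t * \<eta> - Suc n / g)))"
    proof (intro mult_left_mono)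
      have "C\<^sub>0 * (n / g) + C\<^sub>0 * (t * \<eta> - Suc n / g) \<le> C\<^sub>0 * (t * \<eta>)"
        using C0_nonneg g0 by (simp add: algebra_simps add_divide_distrib)
      then show "exp (- C\<^sub>0 * (t * \<eta>)) \<le> exp (- C\<^sub>0 * (n / g)) * exp (- C\<^sub>0 * (t * \<eta> - Suc n / g))"
        by (simp flip: exp_add)
    qed (use p1 lam_gamma_pos g0 in auto)
    also have "\<dots> = (p 1 (1 / g) * (lam \<gamma> / g) ^ n * exp (- C\<^sub>0 * (n / g))) * exp (- C\<^sub>0 * (t * \<eta> - Suc n / g))"
      by (simp only: mult.assoc)
    also have "\<dots> \<le> p (Suc n) (Suc n / g) * exp (- C\<^sub>0 * (t * \<eta> - Suc n / g))"
      by (rule mult_right_mono[OF steady_growth[OF g(1)]]) simp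
    also have "\<dots> \<le> p (Suc n) (t * \<eta>)" using time g0 by (intro hold_lower) auto
    finally show ?case by (simp add: n)
  qed
  with lim show ?thesis unfolding N'_def by (rule exponent_at_most_limit)
qed

text \<open>One cell of the raised process. The logarithm contains
  \<open>lam (y1 / \<alpha>)\<close>, the largest rate along the unraised path, which is what
  \<open>cost_on_ge_segment\<close> can pay for; by \<open>raised_ratio_bounds\<close> it is a lower
  bound for the rates that the raised process meets. The linear term is off by K times the spread of
  the ratios. If that rate vanishes, the cell has no climb and no jump is required.\<close>

lemma exponent_step:
  assumes \<eta>: "0 < \<eta>" "\<eta> \<le> \<alpha>" and \<Delta>: "0 < \<Delta>" and y: "0 \<le> y0" "y0 \<le> y1" "y1 \<le> Y" "y1 - y0 \<le> h / 4"
    and h: "0 < h" and mesh: "\<Delta> * (Y + 1) \<le> h * \<eta> / 8"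
    and pos: "y0 = y1 \<or> 0 < lam (y1 / \<alpha>)"
    and X: "exponent_at_most (\<lambda>t. p (nat \<lfloor>t * (y0 + h)\<rfloor>) (t * \<alpha>)) X"
  shows "exponent_at_most (\<lambda>t. p (nat \<lfloor>t * (y1 + h)\<rfloor>) (t * (\<alpha> + \<Delta>)))
    (X + ((y1 - y0) * ln ((y1 - y0) / (lam (y1 / \<alpha>) * \<Delta>)) - (y1 - y0) + (lam (y0 / (\<alpha> + \<Delta>)) + K * (2 * h / \<eta>)) * \<Delta>))"
proof -
  have \<alpha>: "0 < \<alpha>" using \<eta> by simp
  define lo where "lo = lam (y1 / \<alpha>)"
  define hi where "hi = lam (y0 / (\<alpha> + \<Delta>)) + K * (2 * h / \<eta>)"
  have lo0: "0 \<le> lo" unfolding lo_def using y \<alpha> by (intro lam_nonneg) auto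
  define n0 n1 m where "n0 t = nat \<lfloor>t * (y0 + h)\<rfloor>" and "n1 t = nat \<lfloor>t * (y1 + h)\<rfloor>" and "m t = n1 t - n0 t" for t
  have n01: "n0 t \<le> n1 t" if "0 \<le> t" for t
    unfolding n0_def n1_def using that y by (intro nat_mono floor_mono mult_left_mono) auto
  have nb: "t * (y0 + h) - 1 \<le> real (n0 t)" "real (n0 t) \<le> t * (y0 + h)"
    "t * (y1 + h) - 1 \<le> real (n1 t)" "real (n1 t) \<le> t * (y1 + h)" if "0 \<le> t" for t
    using that y h by (simp_all add: n0_def n1_def)
  \<comment> \<open>The quantity (1 + \<gamma>) / t is the error e of
    \<open>raised_ratio_bounds\<close>: rounding loses at most 1, and the rate adds \<gamma> to the
    count and 1 to the time.\<close>
  have e_lim: "((\<lambda>t. (1 + \<gamma>) / t) \<longlongrightarrow> 0) at_top" by real_asymp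
  then have "((\<lambda>t. (\<Delta> + (1 + \<gamma>) / t) * (Y + 1)) \<longlongrightarrow> (\<Delta> + 0) * (Y + 1)) at_top"
    by (intro tendsto_intros)
  moreover have "(\<Delta> + 0) * (Y + 1) < h * \<eta> / 4"
  proof -
    have "0 < h * \<eta>" using h \<eta> by simp
    then show ?thesis using mesh unfolding add_0_right by linarith
  qed
  ultimately have e3: "\<forall>\<^sub>F t in at_top. (\<Delta> + (1 + \<gamma>) / t) * (Y + 1) < h * \<eta> / 4"
    by (rule order_tendstoD)
  have e12: "\<forall>\<^sub>F t in at_top. (1 + \<gamma>) / t < min (h / 8) 1"
    using h by (intro order_tendstoD(2)[OF e_lim]) auto
  have "exponent_at_most (\<lambda>t. exp (- t * (hi * \<Delta>))) (hi * \<Delta>)"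
    by (rule exponent_at_most_limit[of "\<lambda>_. hi * \<Delta>"]) auto
  moreover have "exponent_at_most (\<lambda>t. (lo * \<Delta> * t) ^ m t / fact (m t)) ((y1 - y0) * ln ((y1 - y0) / (lo * \<Delta>)) - (y1 - y0))"
  proof (rule exponent_poisson_weight)
    show "\<forall>\<^sub>F t in at_top. \<bar>real (m t) - t * (y1 - y0)\<bar> \<le> 1"
      using eventually_ge_at_top[of 0]
    proof eventually_elim
      case (elim t)
      show ?case using nb[OF elim] n01[OF elim] by (simp add: m_def of_nat_diff algebra_simps abs_le_iff)
    qed
    show "0 < lo * \<Delta> \<or> y1 - y0 = 0 \<and> lo * \<Delta> = 0 \<and> (\<forall>t. m t = 0)"
    proof (cases "lo = 0")
      case True
      then have "y0 = y1" using pos by (auto simp: lo_def)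
      then show ?thesis using True by (simp add: m_def n0_def n1_def)
    qed (use lo0 \<Delta> in auto)
  qed (use y in auto)
  ultimately have W: "exponent_at_most (\<lambda>t. p (n0 t) (t * \<alpha>) * (((lo * \<Delta> * t) ^ m t / fact (m t)) * exp (- t * (hi * \<Delta>))))
     (X + (((y1 - y0) * ln ((y1 - y0) / (lo * \<Delta>)) - (y1 - y0)) + hi * \<Delta>))"
    using X unfolding n0_def[symmetric] by (intro exponent_at_most_mult)
  have ev: "\<forall>\<^sub>F t in at_top. p (n0 t) (t * \<alpha>) * (((lo * \<Delta> * t) ^ m t / fact (m t)) * exp (- t * (hi * \<Delta>))) \<le> p (n1 t) (t * (\<alpha> + \<Delta>))"
    using e12 e3 eventually_gt_at_top[of 0]
  proof eventually_elim
    case (elim t)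
    define e where "e = (1 + \<gamma>) / t"
    have e: "0 \<le> e" "e \<le> h / 8" "e \<le> 1" "(\<Delta> + e) * (Y + 1) \<le> h * \<eta> / 4"
      using elim gamma_nonneg by (auto simp: e_def)
    have te: "t * e = 1 + \<gamma>" using elim by (simp add: e_def)
    note geo = raised_ratio_bounds[OF \<eta> \<Delta> y e h]
    have t0: "0 \<le> t" using elim by simp
    note nb = nb[OF t0]
    have "p (n0 t) (t * \<alpha>) * ((lo * (t * (\<alpha> + \<Delta>) - t * \<alpha>)) ^ m t / fact (m t)) * exp (- hi * (t * (\<alpha> + \<Delta>) - t * \<alpha>)) \<le> p (n0 t + m t) (t * (\<alpha> + \<Delta>))"
    proof (rule transition_lower[where b = "t * (\<alpha> + \<Delta>)"])
      show "lo \<le> rate (n0 t + j) s" if s: "t * \<alpha> \<le> s" "s \<le> t * (\<alpha> + \<Delta>)" for j s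
      proof -
        have "0 \<le> t * \<alpha>" using t0 \<alpha> by simp
        then have s0: "0 \<le> s" using s by simp
        have "y1 / \<alpha> \<le> (y1 + e) / \<alpha>" using e \<alpha> by (simp add: divide_right_mono)
        also have "\<dots> \<le> (y0 + h - e) / (\<alpha> + \<Delta> + e)" by (rule geo(1))
        also have "\<dots> = (t * (y0 + h - e)) / (t * (\<alpha> + \<Delta> + e))" using elim by simp
        also have "\<dots> \<le> (real (n0 t + j) + \<gamma>) / (s + 1)"
        proof (rule frac_le)
          show "t * (y0 + h - e) \<le> real (n0 t + j) + \<gamma>" using nb te gamma_nonneg by (simp add: right_diff_distrib)
          show "s + 1 \<le> t * (\<alpha> + \<Delta> + e)" using s te gamma_nonneg by (simp add: distrib_left)
        qed (use s0 gamma_nonneg in auto)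
        finally show ?thesis unfolding lo_def rate_def using y \<alpha> by (intro lam_mono) auto
      qed
      show "rate (n0 t + j) s \<le> hi" if j: "j \<le> m t" and s: "t * \<alpha> \<le> s" "s \<le> t * (\<alpha> + \<Delta>)" for j s
      proof -
        have "0 \<le> t * \<alpha>" using t0 \<alpha> by simp
        then have s0: "0 \<le> s" using s by simp
        have "real (n0 t + j) \<le> real (n1 t)" using j n01[OF t0] by (simp add: m_def flip: of_nat_add)
        then have "real (n0 t + j) + \<gamma> \<le> t * (y1 + h + e)" using nb te by (simp add: distrib_left)
        then have "(real (n0 t + j) + \<gamma>) / (s + 1) \<le> (t * (y1 + h + e)) / (t * \<alpha>)"
          using s \<alpha> elim y h e by (intro frac_le) auto
        also have "\<dots> = (y1 + h + e) / \<alpha>" using elim by simp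
        also have "\<dots> \<le> y0 / (\<alpha> + \<Delta> + e) + 2 * h / \<eta>" using geo(2) by simp
        also have "\<dots> \<le> y0 / (\<alpha> + \<Delta>) + 2 * h / \<eta>"
          using y \<alpha> \<Delta> e by (intro add_right_mono divide_left_mono) auto
        finally have "rate (n0 t + j) s \<le> lam (y0 / (\<alpha> + \<Delta>) + 2 * h / \<eta>)"
          unfolding rate_def using s0 gamma_nonneg by (intro lam_mono) auto
        also have "\<dots> \<le> lam (y0 / (\<alpha> + \<Delta>)) + K * (2 * h / \<eta>)"
          using lam_diff[of "y0 / (\<alpha> + \<Delta>)" "y0 / (\<alpha> + \<Delta>) + 2 * h / \<eta>"] y \<alpha> \<Delta> h \<eta> by simp
        finally show ?thesis by (simp add: hi_def)
      qed
    qed (use t0 \<alpha> \<Delta> lo0 in \<open>auto simp: mult_left_mono\<close>)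
    moreover have "t * (\<alpha> + \<Delta>) - t * \<alpha> = \<Delta> * t" by (simp add: algebra_simps)
    moreover have "n0 t + m t = n1 t" using n01[OF t0] by (simp add: m_def)
    ultimately show ?case by (simp add: ac_simps)
  qed
  from exponent_at_most_weaken[OF W order_refl ev] show ?thesis
    unfolding n1_def lo_def hi_def by (simp add: add.assoc)
qed

text \<open>The bound \<open>h\<^sub>0\<close> depends on c and \<epsilon> but not on f. Lower
  semicontinuity relies on this, because the path there varies with the nearby point.\<close>

lemma lower_local_bound:
  assumes c: "0 \<le> c" and \<epsilon>: "0 < \<epsilon>"
  obtains h\<^sub>0 where "0 < h\<^sub>0"
    "\<And>f h. f \<in> AC0_plus \<Longrightarrow> path_cost lam f \<le> ennreal c \<Longrightarrow> 0 < h \<Longrightarrow> h \<le> h\<^sub>0 \<Longrightarrow>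
      \<forall>\<^sub>F t in at_top. exp (- t * (c + \<epsilon>)) \<le> p (nat \<lfloor>t * (f 1 + h)\<rfloor>) t"
proof -
  define g\<^sub>0 where "g\<^sub>0 = 2 * \<gamma> + 1"
  have g0: "1 \<le> g\<^sub>0" using gamma_nonneg by (simp add: g\<^sub>0_def)
  define B where "B = 2 * g\<^sub>0 + 4 + \<bar>ln C\<^sub>0\<bar> + \<bar>ln (lam \<gamma>)\<bar> + C\<^sub>0"
  have B: "B > 0" using g0 C0_pos by (simp add: B_def)
  \<comment> \<open>B is the constant of \<open>initial_excess\<close>; with \<eta> and w at most
    \<delta>, the initial error \<open>B * (\<eta> + w)\<close> is at most \<epsilon> / 4.\<close>
  define \<delta> where "\<delta> = \<epsilon> / (8 * B)"
  have \<delta>: "\<delta> > 0" using B \<epsilon> by (simp add: \<delta>_def)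
  obtain d0 where d0: "0 < d0" "\<And>d w. 0 < d \<Longrightarrow> d < d0 \<Longrightarrow> 0 \<le> w \<Longrightarrow> w * ln (w / (C\<^sub>0 * d)) - w \<le> c \<Longrightarrow> w \<le> \<delta>"
    by (rule small_if_entropy_bounded[OF C0_pos \<delta>, of c]) (rule that)
  \<comment> \<open>Below \<open>d0\<close> every path of cost at most c has height at most \<delta>
    at time \<eta>. The last bound makes the linear error, at most \<open>2 * K * \<eta>\<close> for
    \<open>h \<le> \<eta>\<^sup>2\<close>, no larger than \<epsilon> / 4.\<close>
  define \<eta> where "\<eta> = min (min (1/2) (d0 / 2)) (min \<delta> (\<epsilon> / (8 * K)))"
  have \<eta>: "0 < \<eta>" "\<eta> \<le> 1/2" "\<eta> < d0" "\<eta> \<le> \<delta>" "\<eta> \<le> \<epsilon> / (8 * K)"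
    using d0 \<delta> \<epsilon> K_pos by (auto simp: \<eta>_def)
  have K\<eta>: "K * \<eta> \<le> \<epsilon> / 8" using \<eta>(5) K_pos by (simp add: field_simps)
  have main: "\<forall>\<^sub>F t in at_top. exp (- t * (c + \<epsilon>)) \<le> p (nat \<lfloor>t * (f 1 + h)\<rfloor>) t"
    if f: "f \<in> AC0_plus" and fc: "path_cost lam f \<le> ennreal c" and h: "0 < h" "h \<le> \<eta>\<^sup>2" for f h
  proof -
    have mono: "f u \<le> f v" if "0 \<le> u" "u \<le> v" "v \<le> 1" for u v
      using mono_onD[OF AC0_plusD(2)[OF f], of u v] that by auto
    have nonneg: "0 \<le> f u" if "0 \<le> u" "u \<le> 1" for u using AC0_plus_nonneg[OF f, of u] that by simp
    define w where "w = f \<eta>"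
    have w0: "0 \<le> w" using nonneg \<eta> by (simp add: w_def)
    define Y where "Y = f 1"
    have Y: "0 \<le> Y" "f u \<le> Y" if "0 \<le> u" "u \<le> 1" for u using nonneg mono that by (auto simp: Y_def)
    have "uniformly_continuous_on {0..1} f"
      by (intro compact_uniformly_continuous absolutely_continuous_on_imp_continuous_on AC0_plusD(1)[OF f]) auto
    then obtain d where d: "d > 0" "\<And>u v. u \<in> {0..1} \<Longrightarrow> v \<in> {0..1} \<Longrightarrow> dist u v < d \<Longrightarrow> dist (f u) (f v) < h / 4"
    proof -
      have "0 < h / 4" using h by simp
      with \<open>uniformly_continuous_on {0..1} f\<close> show ?thesis
        using that unfolding uniformly_continuous_on_def by blast
    qed
    define mesh where "mesh = min d (h * \<eta> / (8 * (Y + 1)))"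
    have Y0: "0 \<le> Y" using Y[of 1] by simp
    have "mesh > 0" using d h \<eta> Y0 by (simp add: mesh_def)
    then obtain k' where k': "1 / real (Suc k') < mesh" using nat_approx_posE by blast
    define k where "k = Suc k'"
    have k: "k > 0" by (simp add: k_def)
    define \<Delta> where "\<Delta> = (1 - \<eta>) / k"
    have \<Delta>: "0 < \<Delta>" "\<Delta> < mesh"
    proof -
      show "0 < \<Delta>" using \<eta> k by (simp add: \<Delta>_def)
      have "\<Delta> \<le> 1 / real k" unfolding \<Delta>_def using \<eta> by (intro divide_right_mono) auto
      then show "\<Delta> < mesh" using k' by (simp add: k_def)
    qed
    have \<Delta>Y: "\<Delta> * (Y + 1) \<le> h * \<eta> / 8"
    proof -
      have "\<Delta> \<le> h * \<eta> / (8 * (Y + 1))" using \<Delta> by (simp add: mesh_def)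
      then have "\<Delta> * (8 * (Y + 1)) \<le> h * \<eta>" using Y0 by (simp add: pos_le_divide_eq)
      moreover have "\<Delta> * (8 * (Y + 1)) = 8 * (\<Delta> * (Y + 1))" by (rule mult.left_commute)
      ultimately show ?thesis by linarith
    qed
    define \<alpha> where "\<alpha> i = \<eta> + real i * \<Delta>" for i :: nat
    have \<alpha>k: "\<alpha> k = 1" using k by (simp add: \<alpha>_def \<Delta>_def)
    have \<alpha>S: "\<alpha> (Suc i) = \<alpha> i + \<Delta>" for i by (simp add: \<alpha>_def algebra_simps)
    have \<alpha>ge: "\<eta> \<le> \<alpha> i" for i using \<Delta> by (simp add: \<alpha>_def)
    have \<alpha>le: "\<alpha> i \<le> 1" if "i \<le> k" for i
    proof -
      have "\<alpha> i \<le> \<alpha> k" unfolding \<alpha>_def using that \<Delta> by (intro add_left_mono mult_right_mono) auto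
      then show ?thesis by (simp add: \<alpha>k)
    qed
    have fin: "cost_on lam f 0 b \<noteq> \<infinity>" if "0 \<le> b" "b \<le> 1" for b
    proof -
      have "cost_on lam f 0 b \<le> cost_on lam f 0 1"
        using cost_on_split[OF f, of 0 b 1] that by simp
      also have "\<dots> < \<infinity>" using fc by (auto simp: path_cost_eq_cost_on intro: le_less_trans)
      finally show ?thesis by simp
    qed
    \<comment> \<open>Cumulative cost as a real number, so that cell costs are differences and
      telescope.\<close>
    define cc where "cc i = enn2real (cost_on lam f 0 (\<alpha> i))" for i
    have cc: "cost_on lam f 0 (\<alpha> i) = ennreal (cc i)" if "i \<le> k" for i
      using fin[of "\<alpha> i"] \<alpha>ge[of i] \<alpha>le[OF that] \<eta> by (simp add: cc_def less_top)
    have cc0: "0 \<le> cc i" for i by (simp add: cc_def)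
    have cck: "cc k \<le> c" using cc[of k] fc c by (simp add: \<alpha>k path_cost_eq_cost_on)
    have cstep: "cost_on lam f (\<alpha> i) (\<alpha> (Suc i)) \<le> ennreal (cc (Suc i) - cc i) \<and> cc i \<le> cc (Suc i)" if "i < k" for i
    proof -
      have sp: "ennreal (cc (Suc i)) = ennreal (cc i) + cost_on lam f (\<alpha> i) (\<alpha> (Suc i))"
      proof -
        have "0 \<le> \<alpha> i" "\<alpha> i \<le> \<alpha> (Suc i)" "\<alpha> (Suc i) \<le> 1"
          using \<alpha>ge[of i] \<eta> \<Delta> \<alpha>le[of "Suc i"] \<alpha>S[of i] that by auto
        from cost_on_split[OF f order_refl this] show ?thesis
          using cc[of i] cc[of "Suc i"] that by simp
      qed
      have "ennreal (cc i) \<le> ennreal (cc (Suc i))" unfolding sp by simp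
      then have le: "cc i \<le> cc (Suc i)" using cc0 by simp
      have "cost_on lam f (\<alpha> i) (\<alpha> (Suc i)) = ennreal (cc (Suc i)) - ennreal (cc i)"
        unfolding sp by simp
      then show ?thesis using le cc0 by (simp add: ennreal_minus)
    qed
    have "cc 0 \<le> c"
    proof -
      have "cost_on lam f 0 (\<alpha> 0) \<le> cost_on lam f 0 1"
        using cost_on_split[OF f, of 0 "\<alpha> 0" 1] \<alpha>ge[of 0] \<alpha>le[of 0] \<eta> by simp
      then have "ennreal (cc 0) \<le> ennreal c" using cc[of 0] fc by (simp add: path_cost_eq_cost_on)
      then show ?thesis using c by simp
    qed
    have \<alpha>0: "\<alpha> 0 = \<eta>" by (simp add: \<alpha>_def)
    \<comment> \<open>Before \<eta> the rate is only known to lie between 0 and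
      \<open>C\<^sub>0\<close>; the resulting bound is the one that \<open>initial_excess\<close>
      compares with.\<close>
    have w1: "w * ln (w / (C\<^sub>0 * \<eta>)) - w \<le> cc 0"
    proof -
      have "(f \<eta> - f 0) * ln ((f \<eta> - f 0) / (C\<^sub>0 * (\<eta> - 0))) - (f \<eta> - f 0) + 0 * (\<eta> - 0) \<le> cc 0"
      proof (rule cost_on_ge_segment(2)[OF f])
        show "lam (f x / x) \<le> C\<^sub>0" "0 \<le> lam (f x / x)" if "0 < x" "x \<le> \<eta>" for x
          using that \<eta> nonneg[of x] by (auto intro!: lam_bounded lam_nonneg)
        show "cost_on lam f 0 \<eta> \<le> ennreal (cc 0)" using cc[of 0] by (simp add: \<alpha>0)
      qed (use \<eta> cc0 in auto)
      then show ?thesis using AC0_plusD(3)[OF f] by (simp add: w_def)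
    qed
    then have "w \<le> \<delta>" using d0(2)[OF \<eta>(1,3) w0] \<open>cc 0 \<le> c\<close> by simp
    define g where "g = g\<^sub>0 + (w + h) / \<eta>"
    have wh: "0 < w + h" using w0 h by simp
    have "exponent_at_most (\<lambda>t. p (nat \<lfloor>t * (w + h)\<rfloor>) (t * \<eta>)) ((w + h) * (ln g - ln (lam \<gamma>)) + C\<^sub>0 * \<eta>)"
    proof (rule exponent_initial[OF \<eta>(1) wh])
      have "0 \<le> (w + h) / \<eta>" using wh \<eta> by simp
      then show "2 * \<gamma> + 1 \<le> g" by (simp add: g_def g\<^sub>0_def)
      show "(w + h) / \<eta> \<le> g" using g0 by (simp add: g_def)
    qed
    moreover have "(w + h) * (ln g - ln (lam \<gamma>)) + C\<^sub>0 * \<eta> \<le> cc 0 + B * (\<eta> + w)"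
      using initial_excess[OF C0_pos g0 \<eta>(1) _ w0 h, of "lam \<gamma>"] \<eta>(2) w1 unfolding g_def B_def by linarith
    ultimately have E0: "exponent_at_most (\<lambda>t. p (nat \<lfloor>t * (f (\<alpha> 0) + h)\<rfloor>) (t * \<alpha> 0)) (cc 0 + B * (\<eta> + w))"
      unfolding \<alpha>0 w_def[symmetric] by (rule exponent_at_most_weaken) simp
    \<comment> \<open>Each cell pays its share of the cost and a linear error proportional to
      \<Delta>; over total time at most 1 these errors stay bounded however fine the grid
      is.\<close>
    have "exponent_at_most (\<lambda>t. p (nat \<lfloor>t * (f (\<alpha> i) + h)\<rfloor>) (t * \<alpha> i)) (cc i + B * (\<eta> + w) + K * (2 * h / \<eta>) * (real i * \<Delta>))"
      if "i \<le> k" for i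
      using that
    proof (induction i)
      case 0
      then show ?case using E0 by simp
    next
      case (Suc i)
      then have i: "i < k" "i \<le> k" by auto
      have ai: "0 < \<alpha> i" using \<alpha>ge[of i] \<eta> by linarith
      have aS: "\<alpha> i < \<alpha> (Suc i)" "\<alpha> (Suc i) \<le> 1" using \<Delta> \<alpha>S \<alpha>le[OF Suc.prems] by auto
      let ?y0 = "f (\<alpha> i)" and ?y1 = "f (\<alpha> (Suc i))"
      have y: "0 \<le> ?y0" "?y0 \<le> ?y1" "?y1 \<le> Y" using nonneg[of "\<alpha> i"] mono[of "\<alpha> i" "\<alpha> (Suc i)"] ai aS Y by auto
      have "dist (\<alpha> (Suc i)) (\<alpha> i) < d" using \<Delta> \<alpha>S by (simp add: mesh_def dist_real_def)
      then have y4: "?y1 - ?y0 \<le> h / 4"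
      proof -
        have "dist ?y1 ?y0 < h / 4" using d(2)[OF _ _ \<open>dist (\<alpha> (Suc i)) (\<alpha> i) < d\<close>] ai aS by simp
        then show ?thesis unfolding dist_real_def by linarith
      qed
      have hb: "lam (f x / x) \<le> lam (?y1 / \<alpha> i)" if "\<alpha> i < x" "x \<le> \<alpha> (Suc i)" for x
        using that ai aS nonneg[of x] mono[of x "\<alpha> (Suc i)"] by (intro lam_mono frac_le) auto
      have lb: "lam (?y0 / (\<alpha> i + \<Delta>)) \<le> lam (f x / x)" if "\<alpha> i < x" "x \<le> \<alpha> (Suc i)" for x
        using that ai aS y mono[of "\<alpha> i" x] \<alpha>S[of i] nonneg[of x] by (intro lam_mono frac_le) auto
      have l0: "0 \<le> lam (?y0 / (\<alpha> i + \<Delta>))" using y ai \<Delta> by (intro lam_nonneg) auto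
      note seg = cost_on_ge_segment[OF f less_imp_le[OF ai] aS hb lb l0 conjunct1[OF cstep[OF i(1)]]]
      have pos: "?y0 = ?y1 \<or> 0 < lam (?y1 / \<alpha> i)" using seg(1) cstep[OF i(1)] by auto
      have "exponent_at_most (\<lambda>t. p (nat \<lfloor>t * (?y1 + h)\<rfloor>) (t * (\<alpha> i + \<Delta>)))
        ((cc i + B * (\<eta> + w) + K * (2 * h / \<eta>) * (real i * \<Delta>)) +
         ((?y1 - ?y0) * ln ((?y1 - ?y0) / (lam (?y1 / \<alpha> i) * \<Delta>)) - (?y1 - ?y0) + (lam (?y0 / (\<alpha> i + \<Delta>)) + K * (2 * h / \<eta>)) * \<Delta>))"
        by (rule exponent_step[OF \<eta>(1) \<alpha>ge \<Delta>(1) y y4 h(1) \<Delta>Y pos Suc.IH[OF i(2)]])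
      then show ?case
      proof (rule exponent_at_most_weaken)
        have "(?y1 - ?y0) * ln ((?y1 - ?y0) / (lam (?y1 / \<alpha> i) * \<Delta>)) - (?y1 - ?y0) + lam (?y0 / (\<alpha> i + \<Delta>)) * \<Delta> \<le> cc (Suc i) - cc i"
          using seg(2) cstep[OF i(1)] by (simp add: \<alpha>S)
        then show "(cc i + B * (\<eta> + w) + K * (2 * h / \<eta>) * (real i * \<Delta>)) +
         ((?y1 - ?y0) * ln ((?y1 - ?y0) / (lam (?y1 / \<alpha> i) * \<Delta>)) - (?y1 - ?y0) + (lam (?y0 / (\<alpha> i + \<Delta>)) + K * (2 * h / \<eta>)) * \<Delta>)
         \<le> cc (Suc i) + B * (\<eta> + w) + K * (2 * h / \<eta>) * (real (Suc i) * \<Delta>)"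
          by (simp add: distrib_right distrib_left)
      qed (simp add: \<alpha>S)
    qed
    from this[OF order_refl] have "exponent_at_most (\<lambda>t. p (nat \<lfloor>t * (f 1 + h)\<rfloor>) t) (cc k + B * (\<eta> + w) + K * (2 * h / \<eta>) * (real k * \<Delta>))"
      by (simp add: \<alpha>k)
    moreover have "cc k + B * (\<eta> + w) + K * (2 * h / \<eta>) * (real k * \<Delta>) \<le> c + \<epsilon> / 2"
    proof -
      have "B * (\<eta> + w) \<le> B * (2 * \<delta>)" using B \<eta>(4) \<open>w \<le> \<delta>\<close> by (intro mult_left_mono) auto
      also have "\<dots> = \<epsilon> / 4" using B by (simp add: \<delta>_def)
      finally have 1: "B * (\<eta> + w) \<le> \<epsilon> / 4" .
      have "2 * h / \<eta> \<le> 2 * \<eta>" using h \<eta> by (simp add: divide_le_eq power2_eq_square)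
      then have "K * (2 * h / \<eta>) \<le> K * (2 * \<eta>)" using K_pos by (intro mult_left_mono) auto
      then have "K * (2 * h / \<eta>) \<le> \<epsilon> / 4" using K\<eta> by simp
      moreover have "0 \<le> K * (2 * h / \<eta>)" using K_pos h \<eta> by simp
      moreover have "real k * \<Delta> \<le> 1" "0 \<le> real k * \<Delta>" using k \<eta> by (auto simp: \<Delta>_def)
      ultimately have "K * (2 * h / \<eta>) * (real k * \<Delta>) \<le> \<epsilon> / 4 * 1" by (intro mult_mono) auto
      with 1 cck show ?thesis by simp
    qed
    ultimately have "exponent_at_most (\<lambda>t. p (nat \<lfloor>t * (f 1 + h)\<rfloor>) t) (c + \<epsilon> / 2)"
      by (rule exponent_at_most_weaken) simp
    from exponent_at_mostD[OF this, of "\<epsilon> / 2"] show ?thesis using \<epsilon> by (simp add: add.assoc)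
  qed
  show ?thesis by (rule that[of "\<eta>\<^sup>2"]) (use \<eta> main in auto)
qed

end

section \<open>The upper bound\<close>

lemma lipschitz_imp_absolutely_continuous_on:
  assumes lip: "\<And>u v. a \<le> u \<Longrightarrow> u \<le> v \<Longrightarrow> v \<le> b \<Longrightarrow> \<bar>f v - f u\<bar> \<le> B * (v - u)"
  shows "absolutely_continuous_on a b f"
  unfolding absolutely_continuous_on_def
proof (intro allI impI)
  fix e :: real assume e: "e > 0"
  define d where "d = e / (\<bar>B\<bar> + 1)"
  have "(\<Sum>(u, v)\<in>D. \<bar>f v - f u\<bar>) < e"
    if D: "finite D \<and> (\<forall>(u, v)\<in>D. a \<le> u \<and> u \<le> v \<and> v \<le> b) \<and>
      pairwise (\<lambda>(u, v) (u', v'). {u<..<v} \<inter> {u'<..<v'} = {}) D \<and> (\<Sum>(u, v)\<in>D. v - u) < d" for D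
  proof -
    have "(\<Sum>(u, v)\<in>D. \<bar>f v - f u\<bar>) \<le> (\<Sum>(u, v)\<in>D. (\<bar>B\<bar> + 1) * (v - u))"
    proof (rule sum_mono)
      fix q assume "q \<in> D"
      moreover obtain u v where q: "q = (u, v)" by (cases q)
      ultimately have uv: "a \<le> u" "u \<le> v" "v \<le> b" using D by auto
      have "\<bar>f v - f u\<bar> \<le> B * (v - u)" by (rule lip[OF uv])
      also have "\<dots> \<le> (\<bar>B\<bar> + 1) * (v - u)" using uv by (intro mult_right_mono) auto
      finally show "(case q of (u, v) \<Rightarrow> \<bar>f v - f u\<bar>) \<le> (case q of (u, v) \<Rightarrow> (\<bar>B\<bar> + 1) * (v - u))"
        by (simp add: q)
    qed
    also have "\<dots> = (\<bar>B\<bar> + 1) * (\<Sum>(u, v)\<in>D. v - u)"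
      by (simp add: sum_distrib_left split_beta')
    also have "\<dots> < (\<bar>B\<bar> + 1) * d" using D by (intro mult_strict_left_mono) auto
    also have "\<dots> = e" by (simp add: d_def)
    finally show ?thesis .
  qed
  moreover have "d > 0" using e by (simp add: d_def)
  ultimately show "\<exists>d>0. \<forall>D. finite D \<and> (\<forall>(u, v)\<in>D. a \<le> u \<and> u \<le> v \<and> v \<le> b) \<and>
      pairwise (\<lambda>(u, v) (u', v'). {u<..<v} \<inter> {u'<..<v'} = {}) D \<and> (\<Sum>(u, v)\<in>D. v - u) < d \<longrightarrow>
      (\<Sum>(u, v)\<in>D. \<bar>f v - f u\<bar>) < e"
    by (intro exI[of _ d] conjI allI impI)
qed

text \<open>The path is a sum of clamped ramps, one per segment. Monotonicity and a global Lipschitz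
  constant are then immediate, and on a given segment all earlier ramps equal 1 and all later ones
  0.\<close>

lemma polygon_path:
  fixes a y :: "nat \<Rightarrow> real"
  assumes a0: "a 0 = 0" and ak: "a k = 1" and a: "\<And>i. i < k \<Longrightarrow> a i < a (Suc i)"
    and y0: "y 0 = 0" and y: "\<And>i. i < k \<Longrightarrow> y i \<le> y (Suc i)"
  obtains f where "f \<in> AC0_plus"
    "\<And>i x. i < k \<Longrightarrow> a i \<le> x \<Longrightarrow> x \<le> a (Suc i) \<Longrightarrow> f x = y i + (x - a i) * ((y (Suc i) - y i) / (a (Suc i) - a i))"
proof -
  have amono: "a i \<le> a j" if "i \<le> j" "j \<le> k" for i j
    using that
  proof (induction j)
    case (Suc j)
    then show ?case using a[of j] by (cases "i = Suc j") auto
  qed simp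
  define cl where "cl x i = max 0 (min 1 ((x - a i) / (a (Suc i) - a i)))" for x and i :: nat
  define f where "f x = (\<Sum>j<k. (y (Suc j) - y j) * cl x j)" for x
  have clmono: "0 \<le> cl v j - cl u j" "cl v j - cl u j \<le> 1 / (a (Suc j) - a j) * (v - u)"
    if "j < k" "u \<le> v" for u v j
  proof -
    have d: "0 < a (Suc j) - a j" using a[OF that(1)] by simp
    have "(u - a j) / (a (Suc j) - a j) \<le> (v - a j) / (a (Suc j) - a j)"
      using d that by (intro divide_right_mono) auto
    moreover have "(v - a j) / (a (Suc j) - a j) = (u - a j) / (a (Suc j) - a j) + 1 / (a (Suc j) - a j) * (v - u)"
      by (simp add: diff_divide_distrib)
    ultimately show "0 \<le> cl v j - cl u j" "cl v j - cl u j \<le> 1 / (a (Suc j) - a j) * (v - u)"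
      by (auto simp: cl_def max_def min_def)
  qed
  have seg: "f x = y i + (x - a i) * ((y (Suc i) - y i) / (a (Suc i) - a i))"
    if i: "i < k" and x: "a i \<le> x" "x \<le> a (Suc i)" for i x
  proof -
    let ?t = "(x - a i) / (a (Suc i) - a i)"
    have cl1: "cl x j = 1" if "j < i" for j
    proof -
      have "a (Suc j) \<le> x" using amono[of "Suc j" i] that i x by simp
      then have "1 \<le> (x - a j) / (a (Suc j) - a j)" using a[of j] that i by (simp add: le_divide_eq)
      then show ?thesis by (simp add: cl_def)
    qed
    have cl0: "cl x j = 0" if "i < j" "j < k" for j
    proof -
      have "x \<le> a j" using amono[of "Suc i" j] that i x by simp
      then have "(x - a j) / (a (Suc j) - a j) \<le> 0" using a[of j] that by (simp add: divide_le_0_iff)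
      then show ?thesis by (simp add: cl_def)
    qed
    have cli: "cl x i = ?t" using x a[OF i] by (simp add: cl_def)
    have "f x = (\<Sum>j<i. (y (Suc j) - y j) * cl x j) + (\<Sum>j\<in>{i..<k}. (y (Suc j) - y j) * cl x j)"
      unfolding f_def using i by (subst sum.union_disjoint[symmetric]) (auto intro!: sum.cong)
    also have "(\<Sum>j<i. (y (Suc j) - y j) * cl x j) = (\<Sum>j<i. y (Suc j) - y j)"
      by (rule sum.cong) (auto simp: cl1)
    also have "\<dots> = y i" by (simp add: sum_lessThan_telescope y0)
    also have "(\<Sum>j\<in>{i..<k}. (y (Suc j) - y j) * cl x j) = (y (Suc i) - y i) * ?t + (\<Sum>j\<in>{Suc i..<k}. (y (Suc j) - y j) * cl x j)"
      using i by (simp add: sum.atLeast_Suc_lessThan cli)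
    also have "(\<Sum>j\<in>{Suc i..<k}. (y (Suc j) - y j) * cl x j) = 0"
      by (rule sum.neutral) (auto simp: cl0)
    finally show ?thesis by simp
  qed
  define B where "B = (\<Sum>j<k. (y (Suc j) - y j) * (1 / (a (Suc j) - a j)))"
  have lip: "0 \<le> f v - f u" "f v - f u \<le> B * (v - u)" if "u \<le> v" for u v
  proof -
    have diff: "f v - f u = (\<Sum>j<k. (y (Suc j) - y j) * (cl v j - cl u j))"
      by (simp add: f_def sum_subtractf right_diff_distrib)
    show "0 \<le> f v - f u" unfolding diff using y clmono(1)[OF _ that] by (intro sum_nonneg mult_nonneg_nonneg) auto
    have "(\<Sum>j<k. (y (Suc j) - y j) * (cl v j - cl u j)) \<le> (\<Sum>j<k. (y (Suc j) - y j) * (1 / (a (Suc j) - a j) * (v - u)))"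
      using y clmono(2)[OF _ that] by (intro sum_mono mult_left_mono) auto
    then show "f v - f u \<le> B * (v - u)" unfolding diff B_def sum_distrib_right by (simp add: mult.assoc)
  qed
  have k: "0 < k" using a0 ak by (cases k) auto
  have "f \<in> AC0_plus"
    unfolding AC0_plus_def
  proof (intro CollectI conjI)
    show "absolutely_continuous_on 0 1 f"
      by (rule lipschitz_imp_absolutely_continuous_on[of _ _ _ B]) (use lip in auto)
    show "mono_on {0..1} f" by (rule mono_onI) (use lip(1) in force)
    show "f 0 = 0" using seg[OF k, of 0] a[OF k] a0 y0 by simp
  qed
  then show ?thesis using seg by (rule that)
qed

context bounded_rate begin

text \<open>The slope is constant, so the integrand is bounded pointwise, with the smallest rate in
  the logarithm and the largest in the linear term.\<close>

lemma cost_on_linear_segment: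
  assumes f: "\<And>x. a \<le> x \<Longrightarrow> x \<le> b \<Longrightarrow> f x = y + (x - a) * s"
    and ab: "a < b" and s: "0 \<le> s" "s = 0 \<or> 0 < lo" and lo: "0 \<le> lo" "lo \<le> hi"
    and l: "\<And>x. a < x \<Longrightarrow> x < b \<Longrightarrow> lo \<le> lam (f x / x)"
    and h: "\<And>x. a < x \<Longrightarrow> x < b \<Longrightarrow> lam (f x / x) \<le> hi"
  shows "cost_on lam f a b \<le> ennreal ((s * ln (s / lo) - s + hi) * (b - a))"
    "0 \<le> s * ln (s / lo) - s + hi"
proof -
  show nn: "0 \<le> s * ln (s / lo) - s + hi"
  proof (cases "s = 0")
    case False
    then show ?thesis using entropy_ge[of s lo] s lo by simp
  qed (use lo in simp)
  show "cost_on lam f a b \<le> ennreal ((s * ln (s / lo) - s + hi) * (b - a))"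
  proof (rule cost_on_le_const[OF _ less_imp_le[OF ab] nn])
    fix x assume x: "a < x" "x < b"
    have "(f has_real_derivative s) (at x)"
    proof (rule has_field_derivative_transform_within_open[of "\<lambda>x. y + (x - a) * s" _ _ "{a<..<b}"])
      show "((\<lambda>x. y + (x - a) * s) has_real_derivative s) (at x)"
        by (auto intro!: derivative_eq_intros)
    qed (use x f in auto)
    then have d: "deriv f x = s" by (rule DERIV_imp_deriv)
    show "local_cost (deriv f x) (lam (f x / x)) \<le> ennreal (s * ln (s / lo) - s + hi)"
    proof (cases "s = 0")
      case True
      then show ?thesis using h[OF x] by (simp add: d local_cost_def ennreal_leI)
    next
      case False
      then have "0 < lam (f x / x)" using l[OF x] s by auto
      moreover have "s * ln (s / lam (f x / x)) \<le> s * ln (s / lo)"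
        using entropy_antimono[OF s l[OF x]] .
      ultimately show ?thesis using False h[OF x] by (simp add: d local_cost_def ennreal_leI)
    qed
  qed
qed

end

section \<open>Poisson weights and best grid paths\<close>

context active_process begin

text \<open>Weight of a transition from m to n as in \<open>transition_upper\<close>: jumps at the
  rate of the highest state and earliest time, holding at the rate of the lowest state and latest
  time.\<close>

definition step_weight :: "real \<Rightarrow> real \<Rightarrow> nat \<Rightarrow> nat \<Rightarrow> real" where
  "step_weight r r' m n = (rate n r * (r' - r)) ^ (n - m) / fact (n - m) * exp (- rate m r' * (r' - r))"

lemma step_weight_nonneg: "0 \<le> r \<Longrightarrow> r \<le> r' \<Longrightarrow> 0 \<le> step_weight r r' m n"
  using rate_nonneg by (simp add: step_weight_def)

text \<open>A sum of n + 1 terms is at most n + 1 times the largest, which is negligible on the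
  exponential scale.\<close>

lemma p_le_best_step:
  assumes r: "0 \<le> r" "r \<le> r'"
  obtains m where "m \<le> n" "p n r' \<le> (real n + 1) * (p m r * step_weight r r' m n)"
proof -
  have "p n r' \<le> (\<Sum>m\<le>n. p m r * step_weight r r' m n)"
    unfolding step_weight_def
  proof (rule transition_upper[OF r(1) r(2) order_refl])
    show "rate j r \<le> rate n r" if "j < n" for j using that r by (intro rate_mono) auto
  qed (rule rate_nonneg[OF r(1)])
  also have "\<dots> \<le> of_nat (card {..n}) * Max ((\<lambda>m. p m r * step_weight r r' m n) ` {..n})"
    by (rule sum_bounded_above) simp
  finally have 1: "p n r' \<le> (real n + 1) * Max ((\<lambda>m. p m r * step_weight r r' m n) ` {..n})" by (simp add: add.commute)
  have "Max ((\<lambda>m. p m r * step_weight r r' m n) ` {..n}) \<in> (\<lambda>m. p m r * step_weight r r' m n) ` {..n}"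
    by (rule Max_in) auto
  then obtain m where "Max ((\<lambda>m. p m r * step_weight r r' m n) ` {..n}) = p m r * step_weight r r' m n" "m \<in> {..n}"
    by (rule imageE)
  with 1 show ?thesis by (intro that[of m]) auto
qed

lemma p_le_poisson: "0 \<le> t \<Longrightarrow> p n t \<le> (C\<^sub>0 * t) ^ n / fact n"
proof -
  assume t: "0 \<le> t"
  have "p n t \<le> (\<Sum>m\<le>n. p m 0 * ((C\<^sub>0 * (t - 0)) ^ (n - m) / fact (n - m) * exp (- rate m t * (t - 0))))"
    using t rate_le C0_nonneg by (intro transition_upper) auto
  also have "\<dots> = (\<Sum>m\<in>{0}. p m 0 * ((C\<^sub>0 * (t - 0)) ^ (n - m) / fact (n - m) * exp (- rate m t * (t - 0))))"
    by (rule sum.mono_neutral_right) (auto simp: p_zero)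
  also have "\<dots> = (C\<^sub>0 * t) ^ n / fact n * exp (- rate 0 t * t)" by (simp add: p_zero)
  also have "\<dots> \<le> (C\<^sub>0 * t) ^ n / fact n * 1"
    using t C0_nonneg rate_nonneg[OF t, of 0] by (intro mult_left_mono) auto
  finally show ?thesis by simp
qed

text \<open>With a fixed number k of cells, choosing the best step each time costs only a polynomial
  factor. The initial interval gets the crude Poisson bound with \<open>C\<^sub>0\<close>, since
  near time 0 the ratio of height to time varies too much to be frozen.\<close>

lemma p_le_best_path:
  assumes r: "0 \<le> r 0" "\<And>i. r i \<le> r (Suc i)"
  obtains \<nu> where "\<nu> k = n" "\<And>j. j < k \<Longrightarrow> \<nu> j \<le> \<nu> (Suc j)"
    "p n (r k) \<le> (real n + 1) ^ k * ((C\<^sub>0 * r 0) ^ \<nu> 0 / fact (\<nu> 0) * (\<Prod>j<k. step_weight (r j) (r (Suc j)) (\<nu> j) (\<nu> (Suc j))))"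
proof -
  have r0: "0 \<le> r i" for i using r lift_Suc_mono_le[of r 0 i] by (metis order_trans zero_le)
  have "\<exists>\<nu>. \<nu> k = n \<and> (\<forall>j<k. \<nu> j \<le> \<nu> (Suc j)) \<and>
    p n (r k) \<le> (real n + 1) ^ k * ((C\<^sub>0 * r 0) ^ \<nu> 0 / fact (\<nu> 0) * (\<Prod>j<k. step_weight (r j) (r (Suc j)) (\<nu> j) (\<nu> (Suc j))))"
  proof (induction k arbitrary: n)
    case 0
    show ?case using p_le_poisson[OF r(1), of n] by (intro exI[of _ "\<lambda>_. n"]) simp
  next
    case (Suc k)
    obtain m where m: "m \<le> n" "p n (r (Suc k)) \<le> (real n + 1) * (p m (r k) * step_weight (r k) (r (Suc k)) m n)"
      using p_le_best_step[OF r0 r(2)] by blast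
    obtain \<nu> where \<nu>: "\<nu> k = m" "\<And>j. j < k \<Longrightarrow> \<nu> j \<le> \<nu> (Suc j)"
      "p m (r k) \<le> (real m + 1) ^ k * ((C\<^sub>0 * r 0) ^ \<nu> 0 / fact (\<nu> 0) * (\<Prod>j<k. step_weight (r j) (r (Suc j)) (\<nu> j) (\<nu> (Suc j))))"
      using Suc.IH[of m] by blast
    define P where "P = (C\<^sub>0 * r 0) ^ \<nu> 0 / fact (\<nu> 0) * (\<Prod>j<k. step_weight (r j) (r (Suc j)) (\<nu> j) (\<nu> (Suc j)))"
    define \<mu> where "\<mu> = \<nu>(Suc k := n)"
    have P: "0 \<le> P" unfolding P_def using C0_nonneg r0 r(2) by (intro mult_nonneg_nonneg prod_nonneg step_weight_nonneg) auto
    have "p m (r k) \<le> (real n + 1) ^ k * P"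
    proof -
      have "(real m + 1) ^ k * P \<le> (real n + 1) ^ k * P" using m(1) P by (intro mult_right_mono power_mono) auto
      then show ?thesis using \<nu>(3) by (simp add: P_def)
    qed
    then have "p m (r k) * step_weight (r k) (r (Suc k)) m n \<le> (real n + 1) ^ k * P * step_weight (r k) (r (Suc k)) m n"
      using r0 r(2) by (intro mult_right_mono step_weight_nonneg)
    then have "(real n + 1) * (p m (r k) * step_weight (r k) (r (Suc k)) m n) \<le> (real n + 1) * ((real n + 1) ^ k * P * step_weight (r k) (r (Suc k)) m n)"
      by (intro mult_left_mono) auto
    from order_trans[OF m(2) this]
    have le: "p n (r (Suc k)) \<le> (real n + 1) ^ Suc k * (P * step_weight (r k) (r (Suc k)) m n)"
      by (simp only: power_Suc mult.assoc)
    have "(\<Prod>j<k. step_weight (r j) (r (Suc j)) (\<mu> j) (\<mu> (Suc j))) = (\<Prod>j<k. step_weight (r j) (r (Suc j)) (\<nu> j) (\<nu> (Suc j)))"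
      by (rule prod.cong) (auto simp: \<mu>_def)
    then have "(C\<^sub>0 * r 0) ^ \<mu> 0 / fact (\<mu> 0) * (\<Prod>j<Suc k. step_weight (r j) (r (Suc j)) (\<mu> j) (\<mu> (Suc j))) = P * step_weight (r k) (r (Suc k)) m n"
      unfolding P_def by (simp add: \<mu>_def \<nu>(1))
    moreover have "\<mu> (Suc k) = n" by (simp add: \<mu>_def)
    moreover have "\<mu> j \<le> \<mu> (Suc j)" if "j < Suc k" for j
      using that \<nu>(1,2) m(1) by (cases "j = k") (auto simp: \<mu>_def)
    ultimately show ?case using le by (intro exI[of _ \<mu>]) auto
  qed
  then show ?thesis using that by blast
qed

text \<open>\<open>\<alpha>\<close>, \<open>\<Delta>\<close> and \<open>d\<close> are times and heights on the scale of the rate function, that is, divided by \<open>t\<close>.\<close>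

lemma step_weight_le:
  assumes t: "0 < t" and r: "0 \<le> \<alpha>" "0 < \<Delta>" and mn: "m \<le> n"
    and pos: "0 < step_weight (t * \<alpha>) (t * (\<alpha> + \<Delta>)) m n"
  defines "d \<equiv> real n / t - real m / t"
  shows "m = n \<or> 0 < rate n (t * \<alpha>)"
    "step_weight (t * \<alpha>) (t * (\<alpha> + \<Delta>)) m n \<le>
       exp (- t * (d * ln (d / (rate n (t * \<alpha>) * \<Delta>)) - d + rate m (t * (\<alpha> + \<Delta>)) * \<Delta>))"
proof -
  let ?hi = "rate n (t * \<alpha>)" and ?lo = "rate m (t * (\<alpha> + \<Delta>))"
  have len: "t * (\<alpha> + \<Delta>) - t * \<alpha> = t * \<Delta>" by (simp add: algebra_simps)
  have sw: "step_weight (t * \<alpha>) (t * (\<alpha> + \<Delta>)) m n = (?hi * (t * \<Delta>)) ^ (n - m) / fact (n - m) * exp (- t * (?lo * \<Delta>))"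
    unfolding step_weight_def len by (simp add: ac_simps)
  have hi0: "0 \<le> ?hi" using t r by (intro rate_nonneg) auto
  show *: "m = n \<or> 0 < ?hi"
  proof (rule ccontr)
    assume "\<not> (m = n \<or> 0 < ?hi)"
    then have "?hi = 0" "n - m \<noteq> 0" using hi0 mn by auto
    then show False using pos unfolding sw by (simp add: zero_power)
  qed
  show "step_weight (t * \<alpha>) (t * (\<alpha> + \<Delta>)) m n \<le> exp (- t * (d * ln (d / (?hi * \<Delta>)) - d + ?lo * \<Delta>))"
  proof (cases "m = n")
    case True
    then show ?thesis unfolding sw by (simp add: d_def)
  next
    case False
    then have hi: "0 < ?hi * (t * \<Delta>)" using * t r by simp
    have td: "real (n - m) = t * d" using mn t by (simp add: d_def of_nat_diff right_diff_distrib)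
    have "(?hi * (t * \<Delta>)) ^ (n - m) / fact (n - m) \<le> exp (- (t * d * ln (t * d / (?hi * (t * \<Delta>))) - t * d))"
      using poisson_weight_le[OF hi, of "n - m"] unfolding td .
    also have "t * d / (?hi * (t * \<Delta>)) = d / (?hi * \<Delta>)" using t by simp
    finally have "step_weight (t * \<alpha>) (t * (\<alpha> + \<Delta>)) m n \<le> exp (- (t * d * ln (d / (?hi * \<Delta>)) - t * d)) * exp (- t * (?lo * \<Delta>))"
      unfolding sw by (intro mult_right_mono) auto
    also have "\<dots> = exp (- t * (d * ln (d / (?hi * \<Delta>)) - d + ?lo * \<Delta>))"
      unfolding exp_add[symmetric] by (rule arg_cong[where f=exp]) (simp add: algebra_simps)
    finally show ?thesis .
  qed
qed

text \<open>On the steep piece the ratio of height to time is constantly g, at least \<gamma>; on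
  the flat piece up to \<eta> only the linear term costs, at most \<open>C\<^sub>0\<close> per unit
  of time. By \<open>initial_excess\<close> their sum hardly exceeds the exponent of the initial
  Poisson weight.\<close>

lemma raised_polygon:
  assumes \<eta>: "0 < \<eta>" "\<eta> \<le> 1" and h: "0 < h" "h \<le> \<eta>\<^sup>2" and \<Delta>: "0 < \<Delta>" "\<eta> + real k * \<Delta> = 1"
    and y: "0 \<le> y 0" "\<And>j. j < k \<Longrightarrow> y j \<le> y (Suc j)"
  obtains f where "f \<in> AC0_plus" "f 1 = y k + h"
    "\<And>j x. j < k \<Longrightarrow> \<eta> + real j * \<Delta> \<le> x \<Longrightarrow> x \<le> \<eta> + real (Suc j) * \<Delta> \<Longrightarrow>
       f x = (y j + h) + (x - (\<eta> + real j * \<Delta>)) * ((y (Suc j) - y j) / \<Delta>)"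
    "\<exists>A\<ge>0. cost_on lam f 0 \<eta> \<le> ennreal A \<and>
       A \<le> (y 0 * ln (y 0 / (C\<^sub>0 * \<eta>)) - y 0) + (2 * (2 * \<gamma> + 1) + 4 + \<bar>ln C\<^sub>0\<bar> + \<bar>ln (lam \<gamma>)\<bar> + C\<^sub>0) * (\<eta> + y 0)"
proof -
  define w where "w = y 0"
  \<comment> \<open>The quotient makes the climb end before \<eta>; the summand
    \<open>2 * \<gamma> + 1\<close> keeps g above both \<gamma> and 1.\<close>
  define g where "g = (2 * \<gamma> + 1) + (w + h) / \<eta>"
  define b where "b = (w + h) / g"
  have wh: "0 < w + h" using y h by (simp add: w_def)
  have g: "\<gamma> \<le> g" "1 \<le> g" "(w + h) / \<eta> < g"
  proof -
    have "0 \<le> (w + h) / \<eta>" using wh \<eta> by simp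
    then show "\<gamma> \<le> g" "1 \<le> g" "(w + h) / \<eta> < g" using gamma_nonneg by (auto simp: g_def)
  qed
  have b: "0 < b" "b < \<eta>" "b * g = w + h" using g wh \<eta> by (auto simp: b_def field_simps)
  \<comment> \<open>Two vertices precede the grid, hence the index shift by 2. The height w + h
    occurs twice, at the times b and \<eta>.\<close>
  define a where "a i = (case i of 0 \<Rightarrow> 0 | Suc i \<Rightarrow> case i of 0 \<Rightarrow> b | Suc j \<Rightarrow> \<eta> + real j * \<Delta>)" for i
  define z where "z i = (case i of 0 \<Rightarrow> 0 | Suc i \<Rightarrow> case i of 0 \<Rightarrow> w + h | Suc j \<Rightarrow> y j + h)" for i
  have a_simps: "a 0 = 0" "a (Suc 0) = b" "a (Suc (Suc j)) = \<eta> + real j * \<Delta>" for j by (simp_all add: a_def)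
  have z_simps: "z 0 = 0" "z (Suc 0) = w + h" "z (Suc (Suc j)) = y j + h" for j by (simp_all add: z_def)
  have a_mono: "a i < a (Suc i)" for i
  proof (cases i)
    case (Suc i')
    then show ?thesis using b \<Delta> by (cases i') (auto simp: a_simps)
  qed (use b in \<open>simp add: a_simps\<close>)
  have z_mono: "z i \<le> z (Suc i)" if "i < k + 2" for i
  proof (cases i)
    case (Suc i')
    then show ?thesis using y that by (cases i') (auto simp: z_simps w_def)
  qed (use wh in \<open>simp add: z_simps\<close>)
  have ak: "a (k + 2) = 1" using \<Delta>(2) by (simp add: a_simps)
  obtain f where f: "f \<in> AC0_plus" and fseg:
    "\<And>i x. i < k + 2 \<Longrightarrow> a i \<le> x \<Longrightarrow> x \<le> a (Suc i) \<Longrightarrow> f x = z i + (x - a i) * ((z (Suc i) - z i) / (a (Suc i) - a i))"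
    by (rule polygon_path[OF a_simps(1) ak a_mono z_simps(1) z_mono]) (assumption, rule that)
  have seg: "f x = (y j + h) + (x - (\<eta> + real j * \<Delta>)) * ((y (Suc j) - y j) / \<Delta>)"
    if "j < k" "\<eta> + real j * \<Delta> \<le> x" "x \<le> \<eta> + real (Suc j) * \<Delta>" for j x
    using fseg[of "Suc (Suc j)" x] that by (simp add: a_simps z_simps distrib_right)
  have f1: "f 1 = y k + h"
  proof -
    have "f (a (Suc (k + 1))) = z (k + 1) + (a (Suc (k + 1)) - a (k + 1)) * ((z (Suc (k + 1)) - z (k + 1)) / (a (Suc (k + 1)) - a (k + 1)))"
      using a_mono[of "k + 1"] by (intro fseg) auto
    then have "f (a (Suc (k + 1))) = z (Suc (k + 1))" using a_mono[of "k + 1"] by simp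
    then show ?thesis using ak by (simp add: z_simps)
  qed
  have seg0: "f x = 0 + (x - 0) * g" if "0 \<le> x" "x \<le> b" for x
  proof -
    have "f x = x * ((w + h) / b)" using fseg[of 0 x] that by (simp add: a_simps z_simps)
    also have "(w + h) / b = g" using b by (simp add: field_simps)
    finally show ?thesis by simp
  qed
  have seg1: "f x = (w + h) + (x - b) * 0" if "b \<le> x" "x \<le> \<eta>" for x
    using fseg[of "Suc 0" x] that by (simp add: a_simps z_simps w_def)
  have lg: "lam \<gamma> \<le> lam g" using g gamma_nonneg by (intro lam_mono) auto
  have lg0: "0 < lam g" using lg lam_gamma_pos by simp
  have lgC: "lam g \<le> C\<^sub>0" using g by (intro lam_bounded) auto
  have "f x / x = g" if "0 < x" "x < b" for x using seg0[of x] that by simp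
  then have gb: "lam g \<le> lam (f x / x)" "lam (f x / x) \<le> lam g" if "0 < x" "x < b" for x
    using that by auto
  have gp: "0 \<le> g" "g = 0 \<or> 0 < lam g" "0 \<le> lam g" using g lg0 by auto
  note c0 = cost_on_linear_segment[OF seg0 b(1) gp order_refl gb]
  \<comment> \<open>Slope 0 with lower rate 0: the factor 0 removes \<open>ln (0 / 0)\<close>, and
    the linear term remains.\<close>
  have c1: "cost_on lam f b \<eta> \<le> ennreal ((0 * ln (0 / 0) - 0 + C\<^sub>0) * (\<eta> - b))"
  proof (rule cost_on_linear_segment(1)[OF seg1])
    fix x assume x: "b < x" "x < \<eta>"
    have "0 \<le> f x / x" using seg1[of x] x wh b by simp
    then show "0 \<le> lam (f x / x)" "lam (f x / x) \<le> C\<^sub>0" by (auto intro: lam_nonneg lam_bounded)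
  qed (use b C0_nonneg in auto)
  define A where "A = (g * ln (g / lam g) - g + lam g) * b + C\<^sub>0 * (\<eta> - b)"
  have A0: "0 \<le> A" using c0(2) b C0_nonneg by (simp add: A_def)
  have "cost_on lam f 0 \<eta> = cost_on lam f 0 b + cost_on lam f b \<eta>"
    using b \<eta> by (intro cost_on_split[OF f]) auto
  also have "\<dots> \<le> ennreal ((g * ln (g / lam g) - g + lam g) * b) + ennreal (C\<^sub>0 * (\<eta> - b))"
    using c0(1) c1 by (intro add_mono) auto
  also have "\<dots> = ennreal A"
    unfolding A_def using c0(2) b C0_nonneg by (intro ennreal_plus[symmetric]) auto
  finally have cA: "cost_on lam f 0 \<eta> \<le> ennreal A" .
  have "A \<le> (w + h) * (ln g - ln (lam \<gamma>)) + C\<^sub>0 * \<eta>"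
  proof -
    have "ln (g / lam g) \<le> ln g - ln (lam \<gamma>)" using g lg lg0 lam_gamma_pos by (simp add: ln_divide_pos)
    then have "g * ln (g / lam g) \<le> g * (ln g - ln (lam \<gamma>))" using g by (intro mult_left_mono) auto
    then have "g * ln (g / lam g) - g + lam g \<le> g * (ln g - ln (lam \<gamma>)) + C\<^sub>0"
      using g lgC by linarith
    then have "(g * ln (g / lam g) - g + lam g) * b \<le> (g * (ln g - ln (lam \<gamma>)) + C\<^sub>0) * b"
      using b by (intro mult_right_mono) auto
    also have "\<dots> = (b * g) * (ln g - ln (lam \<gamma>)) + C\<^sub>0 * b" by (simp add: algebra_simps)
    finally show ?thesis unfolding A_def b(3) by (simp add: right_diff_distrib)
  qed
  also have "\<dots> \<le> (w * ln (w / (C\<^sub>0 * \<eta>)) - w) + (2 * (2 * \<gamma> + 1) + 4 + \<bar>ln C\<^sub>0\<bar> + \<bar>ln (lam \<gamma>)\<bar> + C\<^sub>0) * (\<eta> + w)"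
    unfolding g_def using \<eta> h y(1) gamma_nonneg by (intro initial_excess[OF C0_pos]) (auto simp: w_def)
  finally have "\<exists>A\<ge>0. cost_on lam f 0 \<eta> \<le> ennreal A \<and>
    A \<le> (y 0 * ln (y 0 / (C\<^sub>0 * \<eta>)) - y 0) + (2 * (2 * \<gamma> + 1) + 4 + \<bar>ln C\<^sub>0\<bar> + \<bar>ln (lam \<gamma>)\<bar> + C\<^sub>0) * (\<eta> + y 0)"
    using A0 cA unfolding w_def by blast
  with f f1 seg show ?thesis by (rule that)
qed

text \<open>Counterpart of \<open>exponent_step\<close>. The transition weight has the rate hi in
  its logarithm, and even the smallest rate along the raised segment is at least hi. So the cost of
  the segment exceeds the exponent of the weight by no more than the linear error.\<close>

lemma raised_segment_cost:
  assumes f: "\<And>x. \<alpha> \<le> x \<Longrightarrow> x \<le> \<alpha> + \<Delta> \<Longrightarrow> f x = (y0 + h) + (x - \<alpha>) * ((y1 - y0) / \<Delta>)"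
    and \<eta>: "0 < \<eta>" "\<eta> \<le> \<alpha>" and \<Delta>: "0 < \<Delta>" and y: "0 \<le> y0" "y0 \<le> y1" "y1 \<le> Y" "y1 - y0 \<le> h / 4"
    and e: "0 \<le> e" "e \<le> h / 8" "e \<le> 1" "(\<Delta> + e) * (Y + 1) \<le> h * \<eta> / 4" and h: "0 < h"
    and hi: "hi \<le> lam ((y1 + e) / \<alpha>)" "y0 = y1 \<or> 0 < hi" and lo: "lam (y0 / (\<alpha> + \<Delta> + e)) \<le> lo"
  shows "\<exists>A\<ge>0. cost_on lam f \<alpha> (\<alpha> + \<Delta>) \<le> ennreal A \<and>
    A \<le> ((y1 - y0) * ln ((y1 - y0) / (hi * \<Delta>)) - (y1 - y0) + lo * \<Delta>) + K * (2 * h / \<eta>) * \<Delta>"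
proof -
  note geo = raised_ratio_bounds[OF \<eta> \<Delta> y e h]
  have \<alpha>: "0 < \<alpha>" using \<eta> by simp
  define l where "l = lam ((y0 + h) / (\<alpha> + \<Delta>))"
  define u where "u = lam ((y1 + h) / \<alpha>)"
  define s where "s = (y1 - y0) / \<Delta>"
  have s0: "0 \<le> s" using y \<Delta> by (simp add: s_def)
  have "(y1 + e) / \<alpha> \<le> (y0 + h) / (\<alpha> + \<Delta>)"
  proof -
    have "(y0 + h - e) / (\<alpha> + \<Delta> + e) \<le> (y0 + h) / (\<alpha> + \<Delta>)"
      using \<alpha> \<Delta> e y h by (intro frac_le) auto
    with geo(1) show ?thesis by simp
  qed
  then have "lam ((y1 + e) / \<alpha>) \<le> l" unfolding l_def using y e \<alpha> by (intro lam_mono) auto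
  with hi have hil: "hi \<le> l" by simp
  have l0: "0 \<le> l" unfolding l_def using y h \<alpha> \<Delta> by (intro lam_nonneg) auto
  have fb: "y0 + h \<le> f x" "f x \<le> y1 + h" if "\<alpha> \<le> x" "x \<le> \<alpha> + \<Delta>" for x
  proof -
    have fx: "f x = (y0 + h) + (x - \<alpha>) * s" using f[OF that] by (simp add: s_def)
    show "y0 + h \<le> f x" unfolding fx using that s0 by simp
    have "(x - \<alpha>) * s \<le> \<Delta> * s" using that s0 by (intro mult_right_mono) auto
    also have "\<dots> = y1 - y0" using \<Delta> by (simp add: s_def)
    finally show "f x \<le> y1 + h" unfolding fx by simp
  qed
  have bnd: "l \<le> lam (f x / x)" "lam (f x / x) \<le> u" if "\<alpha> < x" "x < \<alpha> + \<Delta>" for x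
  proof -
    show "l \<le> lam (f x / x)" unfolding l_def using that fb[of x] y h \<alpha> by (intro lam_mono frac_le) auto
    show "lam (f x / x) \<le> u" unfolding u_def using that fb[of x] y h \<alpha> by (intro lam_mono frac_le) auto
  qed
  have "l \<le> u" unfolding l_def u_def using y h \<alpha> \<Delta> by (intro lam_mono frac_le) auto
  have sp: "s = 0 \<or> 0 < l" using hi(2) hil by (auto simp: s_def)
  have fl: "f x = (y0 + h) + (x - \<alpha>) * s" if "\<alpha> \<le> x" "x \<le> \<alpha> + \<Delta>" for x using f[OF that] by (simp add: s_def)
  have c: "cost_on lam f \<alpha> (\<alpha> + \<Delta>) \<le> ennreal ((s * ln (s / l) - s + u) * (\<alpha> + \<Delta> - \<alpha>))" "0 \<le> s * ln (s / l) - s + u"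
    by (rule cost_on_linear_segment[OF fl _ s0 sp l0 \<open>l \<le> u\<close> bnd]; use \<Delta> in simp)+
  show ?thesis
  proof (intro exI conjI)
    show "cost_on lam f \<alpha> (\<alpha> + \<Delta>) \<le> ennreal ((s * ln (s / l) - s + u) * \<Delta>)" using c(1) by simp
    show "0 \<le> (s * ln (s / l) - s + u) * \<Delta>" using c(2) \<Delta> by simp
    have "u \<le> lo + K * (2 * h / \<eta>)"
    proof -
      have "(y1 + h) / \<alpha> \<le> (y1 + h + e) / \<alpha>" using e \<alpha> by (simp add: divide_right_mono)
      also have "\<dots> \<le> y0 / (\<alpha> + \<Delta> + e) + 2 * h / \<eta>" using geo(2) by simp
      finally have "u \<le> lam (y0 / (\<alpha> + \<Delta> + e) + 2 * h / \<eta>)"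
        unfolding u_def using y h \<alpha> by (intro lam_mono) auto
      also have "\<dots> \<le> lam (y0 / (\<alpha> + \<Delta> + e)) + K * (2 * h / \<eta>)"
        using lam_diff[of "y0 / (\<alpha> + \<Delta> + e)" "y0 / (\<alpha> + \<Delta> + e) + 2 * h / \<eta>"] y \<alpha> \<Delta> h \<eta> e by simp
      finally show ?thesis using lo by simp
    qed
    then have "u * \<Delta> \<le> (lo + K * (2 * h / \<eta>)) * \<Delta>" using \<Delta> by (intro mult_right_mono) auto
    moreover have "s * ln (s / l) * \<Delta> \<le> (y1 - y0) * ln ((y1 - y0) / (hi * \<Delta>))"
    proof -
      have "s * ln (s / l) * \<Delta> = (y1 - y0) * ln ((y1 - y0) / (l * \<Delta>))" using \<Delta> by (simp add: s_def mult.commute)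
      also have "\<dots> \<le> (y1 - y0) * ln ((y1 - y0) / (hi * \<Delta>))"
        using y hi(2) hil \<Delta> by (intro entropy_antimono) auto
      finally show ?thesis .
    qed
    moreover have "s * \<Delta> = y1 - y0" using \<Delta> by (simp add: s_def)
    ultimately show "(s * ln (s / l) - s + u) * \<Delta> \<le> ((y1 - y0) * ln ((y1 - y0) / (hi * \<Delta>)) - (y1 - y0) + lo * \<Delta>) + K * (2 * h / \<eta>) * \<Delta>"
      by (simp add: distrib_right left_diff_distrib)
  qed
qed

text \<open>T is the same for all n up to R t, which allows a union bound over them. The first
  alternative, at an arbitrary level, disposes of grid paths with large exponent; the remaining ones
  have bounded exponent and therefore small increments, as raising requires.\<close>

lemma upper_local_bound:
  assumes R: "0 \<le> R" and M: "0 \<le> M'" and \<epsilon>: "0 < \<epsilon>"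
  obtains T where "0 < T" "\<And>t n. T \<le> t \<Longrightarrow> real n \<le> R * t \<Longrightarrow> p n t \<le> exp (- t * (M' - \<epsilon>)) \<or>
    (\<exists>f C. f \<in> AC0_plus \<and> f 1 = real n / t \<and> 0 \<le> C \<and> path_cost lam f \<le> ennreal C \<and> p n t \<le> exp (- t * (C - \<epsilon>)))"
proof -
  define B where "B = 2 * (2 * \<gamma> + 1) + 4 + \<bar>ln C\<^sub>0\<bar> + \<bar>ln (lam \<gamma>)\<bar> + C\<^sub>0"
  have B: "B > 0" using gamma_nonneg C0_pos by (simp add: B_def)
  \<comment> \<open>Partial exponents may be negative, but in total by no more than
    \<open>C\<^sub>0\<close>; a sum below M' thus bounds each of them by c.\<close>
  define c where "c = M' + C\<^sub>0"
  define \<delta> where "\<delta> = \<epsilon> / (16 * B)"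
  have \<delta>: "\<delta> > 0" using B \<epsilon> by (simp add: \<delta>_def)
  obtain d0 where d0: "0 < d0" "\<And>d w. 0 < d \<Longrightarrow> d < d0 \<Longrightarrow> 0 \<le> w \<Longrightarrow> w * ln (w / (C\<^sub>0 * d)) - w \<le> c \<Longrightarrow> w \<le> \<delta>"
    by (rule small_if_entropy_bounded[OF C0_pos \<delta>, of c]) (rule that)
  define \<eta> where "\<eta> = min (min (1/2) (d0 / 2)) (min \<delta> (\<epsilon> / (16 * K)))"
  have \<eta>: "0 < \<eta>" "\<eta> \<le> 1/2" "\<eta> < d0" "\<eta> \<le> \<delta>" "\<eta> \<le> \<epsilon> / (16 * K)"
    using d0 \<delta> \<epsilon> K_pos by (auto simp: \<eta>_def)
  have K\<eta>: "K * \<eta> \<le> \<epsilon> / 16" using \<eta>(5) K_pos by (simp add: field_simps)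
  \<comment> \<open>The error of \<open>truncate_path\<close> vanishes with h, so h can serve both
    raising and truncation.\<close>
  have "((\<lambda>h. h * \<bar>ln (h / C\<^sub>0)\<bar> + h) \<longlongrightarrow> 0) (at_right 0)" using C0_pos by real_asymp
  then have "\<forall>\<^sub>F h in at_right 0. h * \<bar>ln (h / C\<^sub>0)\<bar> + h < \<epsilon> / 4" using \<epsilon> by (intro order_tendstoD(2)) auto
  moreover have "\<forall>\<^sub>F h in at_right 0. h < \<eta>\<^sup>2" using \<eta> by (intro eventually_at_rightI[of 0 "\<eta>\<^sup>2"]) auto
  moreover have "\<forall>\<^sub>F h in at_right (0::real). 0 < h" by (rule eventually_at_right_less)
  ultimately have "\<forall>\<^sub>F h in at_right 0. h * \<bar>ln (h / C\<^sub>0)\<bar> + h < \<epsilon> / 4 \<and> h < \<eta>\<^sup>2 \<and> 0 < h"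
    by eventually_elim simp
  then obtain h where h: "h * \<bar>ln (h / C\<^sub>0)\<bar> + h < \<epsilon> / 4" "h < \<eta>\<^sup>2" "0 < h"
    using eventually_happens'[OF trivial_limit_at_right_real] by blast
  \<comment> \<open>In cells shorter than \<open>d1\<close> an exponent of at most c permits
    increments of at most h / 4 only.\<close>
  obtain d1 where d1: "0 < d1" "\<And>d w. 0 < d \<Longrightarrow> d < d1 \<Longrightarrow> 0 \<le> w \<Longrightarrow> w * ln (w / (C\<^sub>0 * d)) - w \<le> c \<Longrightarrow> w \<le> h / 4"
    using small_if_entropy_bounded[OF C0_pos, of "h / 4" c] h by (metis zero_less_divide_iff zero_less_numeral)
  define mesh where "mesh = min d1 (h * \<eta> / (8 * (R + 1)))"
  have "mesh > 0" using d1 h \<eta> R by (simp add: mesh_def)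
  then obtain k' where k': "1 / real (Suc k') < mesh" using nat_approx_posE by blast
  define k where "k = Suc k'"
  have k: "k > 0" by (simp add: k_def)
  define \<Delta> where "\<Delta> = (1 - \<eta>) / k"
  have \<Delta>: "0 < \<Delta>" "\<Delta> < mesh"
  proof -
    show "0 < \<Delta>" using \<eta> k by (simp add: \<Delta>_def)
    have "\<Delta> \<le> 1 / real k" unfolding \<Delta>_def using \<eta> by (intro divide_right_mono) auto
    then show "\<Delta> < mesh" using k' by (simp add: k_def)
  qed
  have \<Delta>R: "\<Delta> * (R + 1) \<le> h * \<eta> / 8"
  proof -
    have "\<Delta> \<le> h * \<eta> / (8 * (R + 1))" using \<Delta> by (simp add: mesh_def)
    then have "\<Delta> * (8 * (R + 1)) \<le> h * \<eta>" using R by (simp add: pos_le_divide_eq)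
    moreover have "\<Delta> * (8 * (R + 1)) = 8 * (\<Delta> * (R + 1))" by (rule mult.left_commute)
    ultimately show ?thesis by linarith
  qed
  have k\<Delta>: "\<eta> + real k * \<Delta> = 1" using k by (simp add: \<Delta>_def)
  define \<alpha> where "\<alpha> i = \<eta> + real i * \<Delta>" for i :: nat
  have \<alpha>0: "\<alpha> 0 = \<eta>" and \<alpha>k: "\<alpha> k = 1" using k\<Delta> by (auto simp: \<alpha>_def)
  have \<alpha>S: "\<alpha> (Suc i) = \<alpha> i + \<Delta>" for i by (simp add: \<alpha>_def algebra_simps)
  have \<alpha>ge: "\<eta> \<le> \<alpha> i" for i using \<Delta> by (simp add: \<alpha>_def)
  have \<alpha>le: "\<alpha> i \<le> 1" if "i \<le> k" for i
  proof -
    have "\<alpha> i \<le> \<alpha> k" unfolding \<alpha>_def using that \<Delta> by (intro add_left_mono mult_right_mono) auto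
    then show ?thesis by (simp add: \<alpha>k)
  qed
  have e_lim: "((\<lambda>t. (1 + \<gamma>) / t) \<longlongrightarrow> 0) at_top" by real_asymp
  then have "((\<lambda>t. (\<Delta> + (1 + \<gamma>) / t) * (R + 1)) \<longlongrightarrow> (\<Delta> + 0) * (R + 1)) at_top"
    by (intro tendsto_intros)
  moreover have "(\<Delta> + 0) * (R + 1) < h * \<eta> / 4"
  proof -
    have "0 < h * \<eta>" using h \<eta> by simp
    then show ?thesis using \<Delta>R unfolding add_0_right by linarith
  qed
  ultimately have e3: "\<forall>\<^sub>F t in at_top. (\<Delta> + (1 + \<gamma>) / t) * (R + 1) < h * \<eta> / 4"
    by (rule order_tendstoD)
  have e12: "\<forall>\<^sub>F t in at_top. (1 + \<gamma>) / t < min (h / 8) 1"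
    using h by (intro order_tendstoD(2)[OF e_lim]) auto
  \<comment> \<open>The number k of cells is fixed before t, so the polynomial factor is
    absorbed.\<close>
  have "\<forall>\<^sub>F t in at_top. (R * t + 1) ^ k \<le> exp (t * (\<epsilon> / 4))"
  proof -
    have "((\<lambda>t. (R * t + 1) ^ k / exp (t * (\<epsilon> / 4))) \<longlongrightarrow> 0) at_top"
      using \<epsilon> R by (cases "R = 0") (simp, real_asymp)+
    then have "\<forall>\<^sub>F t in at_top. (R * t + 1) ^ k / exp (t * (\<epsilon> / 4)) < 1" by (intro order_tendstoD(2)) auto
    then show ?thesis by eventually_elim (simp add: divide_less_eq)
  qed
  with e12 e3 eventually_gt_at_top[of 0]
  have "\<forall>\<^sub>F t in at_top. (1 + \<gamma>) / t < min (h / 8) 1 \<and> (\<Delta> + (1 + \<gamma>) / t) * (R + 1) < h * \<eta> / 4 \<and> 0 < t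
     \<and> (R * t + 1) ^ k \<le> exp (t * (\<epsilon> / 4))"
    by eventually_elim blast
  then obtain T where T: "\<And>t. T \<le> t \<Longrightarrow> (1 + \<gamma>) / t < min (h / 8) 1 \<and> (\<Delta> + (1 + \<gamma>) / t) * (R + 1) < h * \<eta> / 4 \<and> 0 < t
     \<and> (R * t + 1) ^ k \<le> exp (t * (\<epsilon> / 4))"
    unfolding eventually_at_top_linorder by blast
  have main: "p n t \<le> exp (- t * (M' - \<epsilon>)) \<or>
    (\<exists>f C. f \<in> AC0_plus \<and> f 1 = real n / t \<and> 0 \<le> C \<and> path_cost lam f \<le> ennreal C \<and> p n t \<le> exp (- t * (C - \<epsilon>)))"
    if Tt: "T \<le> t" and nR: "real n \<le> R * t" for t n
  proof -
    note Tt = T[OF Tt]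
    have t: "0 < t" using Tt by simp
    define e where "e = (1 + \<gamma>) / t"
    have e: "0 \<le> e" "e \<le> h / 8" "e \<le> 1" "(\<Delta> + e) * (R + 1) \<le> h * \<eta> / 4"
      using Tt gamma_nonneg by (auto simp: e_def)
    have te: "t * e = 1 + \<gamma>" using t by (simp add: e_def)
    obtain \<nu> where \<nu>k: "\<nu> k = n" and \<nu>m: "\<And>j. j < k \<Longrightarrow> \<nu> j \<le> \<nu> (Suc j)" and
      pn: "p n (t * \<alpha> k) \<le> (real n + 1) ^ k * ((C\<^sub>0 * (t * \<alpha> 0)) ^ \<nu> 0 / fact (\<nu> 0) *
        (\<Prod>j<k. step_weight (t * \<alpha> j) (t * \<alpha> (Suc j)) (\<nu> j) (\<nu> (Suc j))))"
      using p_le_best_path[of "\<lambda>i. t * \<alpha> i" k n] t \<eta> \<Delta> \<alpha>0 \<alpha>S by auto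
    define W where "W j = step_weight (t * \<alpha> j) (t * \<alpha> (Suc j)) (\<nu> j) (\<nu> (Suc j))" for j
    have W0: "0 \<le> W j" for j
      unfolding W_def using t \<alpha>ge[of j] \<eta> \<Delta> by (intro step_weight_nonneg) (auto simp: \<alpha>S)
    show ?thesis
    proof (cases "\<forall>j<k. 0 < W j")
      \<comment> \<open>A vanishing weight makes the bound zero, and the first alternative holds
        trivially.\<close>
      case False
      then obtain j where "j < k" "W j = 0" using W0 by (metis order_le_less)
      then have "(\<Prod>j<k. W j) = 0" by (intro prod_zero) auto
      then have "p n t \<le> 0"
        using pn[folded W_def] by (simp only: \<alpha>k mult_zero_right mult_1_right)
      then show ?thesis by (smt (verit) exp_gt_zero)
    next
      case True
      define y where "y j = real (\<nu> j) / t" for j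
      have y_mono: "y j \<le> y (Suc j)" if "j < k" for j using \<nu>m[OF that] t by (simp add: y_def divide_right_mono)
      have y0: "0 \<le> y j" for j using t by (simp add: y_def)
      have yk: "y k = real n / t" by (simp add: y_def \<nu>k)
      have y_le: "y j \<le> R" if "j \<le> k" for j
      proof -
        have "y j \<le> y k" using that
        proof (induction rule: inc_induct)
          case (step i) then show ?case using y_mono[of i] by simp
        qed simp
        also have "\<dots> \<le> R" using nR t by (simp add: yk divide_le_eq)
        finally show ?thesis .
      qed
      define hi where "hi j = rate (\<nu> (Suc j)) (t * \<alpha> j)" for j
      define lo where "lo j = rate (\<nu> j) (t * (\<alpha> j + \<Delta>))" for j
      define s where "s j = (y (Suc j) - y j) * ln ((y (Suc j) - y j) / (hi j * \<Delta>)) - (y (Suc j) - y j) + lo j * \<Delta>" for j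
      have \<alpha>pos: "0 < \<alpha> j" for j using \<alpha>ge[of j] \<eta> by linarith
      have hi: "0 \<le> hi j" "hi j \<le> C\<^sub>0" for j
        unfolding hi_def using t \<alpha>pos[of j] by (auto intro!: rate_nonneg rate_le)
      have lo: "0 \<le> lo j" for j unfolding lo_def using t \<alpha>pos[of j] \<Delta> by (intro rate_nonneg) auto
      have Wle: "y j = y (Suc j) \<or> 0 < hi j" "W j \<le> exp (- t * s j)" if "j < k" for j
        using step_weight_le[OF t less_imp_le[OF \<alpha>pos[of j]] \<Delta>(1) \<nu>m[OF that]] True that
        by (auto simp: W_def \<alpha>S hi_def lo_def s_def y_def)
      define s0 where "s0 = y 0 * ln (y 0 / (C\<^sub>0 * \<eta>)) - y 0"
      have init: "(C\<^sub>0 * (t * \<eta>)) ^ \<nu> 0 / fact (\<nu> 0) \<le> exp (- t * s0)"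
      proof -
        have n0: "real (\<nu> 0) = t * y 0" using t by (simp add: y_def)
        have "(C\<^sub>0 * (t * \<eta>)) ^ \<nu> 0 / fact (\<nu> 0) \<le> exp (- (t * y 0 * ln (t * y 0 / (C\<^sub>0 * (t * \<eta>))) - t * y 0))"
          using poisson_weight_le[of "C\<^sub>0 * (t * \<eta>)" "\<nu> 0"] C0_pos t \<eta> unfolding n0 by simp
        also have "t * y 0 / (C\<^sub>0 * (t * \<eta>)) = y 0 / (C\<^sub>0 * \<eta>)" using t by simp
        finally show ?thesis by (simp add: s0_def algebra_simps)
      qed
      define S where "S = s0 + (\<Sum>j<k. s j)"
      have prodle: "(\<Prod>j<k. W j) \<le> exp (- t * (\<Sum>j<k. s j))"
      proof -
        have "(\<Prod>j<k. W j) \<le> (\<Prod>j<k. exp (- t * s j))" using W0 Wle(2) by (intro prod_mono) auto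
        also have "\<dots> = exp (- t * (\<Sum>j<k. s j))" by (simp add: exp_sum[symmetric] sum_distrib_left)
        finally show ?thesis .
      qed
      have pS: "p n t \<le> exp (t * (\<epsilon> / 4) - t * S)"
      proof -
        have "p n t \<le> (real n + 1) ^ k * ((C\<^sub>0 * (t * \<eta>)) ^ \<nu> 0 / fact (\<nu> 0) * (\<Prod>j<k. W j))"
          using pn by (simp add: \<alpha>k \<alpha>0 W_def)
        also have "\<dots> \<le> exp (t * (\<epsilon> / 4)) * (exp (- t * s0) * exp (- t * (\<Sum>j<k. s j)))"
        proof (intro mult_mono init prodle)
          have "(real n + 1) ^ k \<le> (R * t + 1) ^ k" using nR by (intro power_mono) auto
          then show "(real n + 1) ^ k \<le> exp (t * (\<epsilon> / 4))" using Tt by linarith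
          have "0 \<le> (\<Prod>j<k. W j)" using W0 by (intro prod_nonneg) auto
          then show "0 \<le> (C\<^sub>0 * (t * \<eta>)) ^ \<nu> 0 / fact (\<nu> 0) * (\<Prod>j<k. W j)" "0 \<le> (\<Prod>j<k. W j)"
            using C0_pos t \<eta> by auto
        qed auto
        also have "\<dots> = exp (t * (\<epsilon> / 4) - t * S)"
          unfolding exp_add[symmetric] S_def by (rule arg_cong[where f=exp]) (simp add: algebra_simps)
        finally show ?thesis .
      qed
      show ?thesis
      proof (cases "M' \<le> S")
        case True
        have "t * (\<epsilon> / 4) - t * S \<le> - t * (M' - \<epsilon>)"
        proof -
          have "t * (\<epsilon> / 4 - S) \<le> t * (\<epsilon> - M')" using t \<epsilon> True by (intro mult_left_mono) auto
          then show ?thesis by (simp add: algebra_simps)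
        qed
        then have "exp (t * (\<epsilon> / 4) - t * S) \<le> exp (- t * (M' - \<epsilon>))" by simp
        then show ?thesis using pS by linarith
      next
        case False
        \<comment> \<open>The logarithm and the linear term of a weight use different rates, so
          \<open>s j\<close> is not a true cost and may be negative, though never below
          \<open>- C\<^sub>0 * \<Delta>\<close>.\<close>
        have s_ge: "- C\<^sub>0 * \<Delta> \<le> s j" if "j < k" for j
        proof (cases "y j = y (Suc j)")
          case True
          have "- C\<^sub>0 * \<Delta> \<le> 0" "0 \<le> lo j * \<Delta>" using C0_pos \<Delta> lo[of j] by auto
          then show ?thesis using True by (simp add: s_def)
        next
          case False
          then have "0 < hi j" using Wle(1)[OF that] by simp
          then have "- (hi j * \<Delta>) \<le> (y (Suc j) - y j) * ln ((y (Suc j) - y j) / (hi j * \<Delta>)) - (y (Suc j) - y j)"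
            using y_mono[OF that] \<Delta> by (intro entropy_ge) auto
          moreover have "hi j * \<Delta> \<le> C\<^sub>0 * \<Delta>" "0 \<le> lo j * \<Delta>" using hi lo[of j] \<Delta> by (auto intro: mult_right_mono)
          ultimately show ?thesis by (simp add: s_def)
        qed
        have s0_ge: "- C\<^sub>0 * \<eta> \<le> s0" using entropy_ge[of "y 0" "C\<^sub>0 * \<eta>"] y0[of 0] C0_pos \<eta> by (simp add: s0_def)
        have sum_ge: "- C\<^sub>0 * (real (card J) * \<Delta>) \<le> (\<Sum>j\<in>J. s j)" if "J \<subseteq> {..<k}" for J
        proof -
          have "(\<Sum>j\<in>J. - C\<^sub>0 * \<Delta>) \<le> (\<Sum>j\<in>J. s j)" using that s_ge by (intro sum_mono) auto
          then show ?thesis by (simp add: mult.left_commute)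
        qed
        have "C\<^sub>0 * \<eta> + C\<^sub>0 * (real k * \<Delta>) = C\<^sub>0" using k\<Delta> by (simp flip: distrib_left)
        note C0_split = this
        have "0 \<le> C\<^sub>0 * \<eta>" using C0_pos \<eta> by simp
        with C0_split have s0c: "s0 \<le> c" using sum_ge[of "{..<k}"] False unfolding S_def c_def by simp
        \<comment> \<open>The other exponents, including the initial one, together are at least
          \<open>- C\<^sub>0\<close>, because \<eta> and the cells make up time 1.\<close>
        have sc: "s j \<le> c" if "j < k" for j
        proof -
          have "S = s0 + (s j + (\<Sum>i\<in>{..<k} - {j}. s i))" unfolding S_def using that by (subst sum.remove[of _ j]) auto
          moreover have "- C\<^sub>0 * (real k * \<Delta>) \<le> (\<Sum>i\<in>{..<k} - {j}. s i)"
          proof -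
            have "card ({..<k} - {j}) \<le> card {..<k}" by (intro card_mono) auto
            then have "C\<^sub>0 * (real (card ({..<k} - {j})) * \<Delta>) \<le> C\<^sub>0 * (real k * \<Delta>)"
              using C0_pos \<Delta> by (intro mult_left_mono mult_right_mono) auto
            then show ?thesis using sum_ge[of "{..<k} - {j}"] by auto
          qed
          ultimately show ?thesis using False s0_ge C0_split unfolding c_def by simp
        qed
        have w\<delta>: "y 0 \<le> \<delta>" using d0(2)[OF \<eta>(1,3) y0[of 0]] s0c by (simp add: s0_def)
        have jump: "y (Suc j) - y j \<le> h / 4" if "j < k" for j
        proof (rule d1(2)[OF \<Delta>(1)])
          show "\<Delta> < d1" using \<Delta> by (simp add: mesh_def)
          show "0 \<le> y (Suc j) - y j" using y_mono[OF that] by simp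
          have "(y (Suc j) - y j) * ln ((y (Suc j) - y j) / (C\<^sub>0 * \<Delta>)) \<le> (y (Suc j) - y j) * ln ((y (Suc j) - y j) / (hi j * \<Delta>))"
            using y_mono[OF that] Wle(1)[OF that] hi[of j] \<Delta> by (intro entropy_antimono) (auto intro: mult_right_mono)
          moreover have "0 \<le> lo j * \<Delta>" using lo[of j] \<Delta> by simp
          ultimately show "(y (Suc j) - y j) * ln ((y (Suc j) - y j) / (C\<^sub>0 * \<Delta>)) - (y (Suc j) - y j) \<le> c"
            using sc[OF that] by (simp add: s_def)
        qed
        have \<eta>1: "\<eta> \<le> 1" using \<eta> by simp
        \<comment> \<open>Polygon through the raised heights of the best grid path; its cost turns
          out to be at most S + \<epsilon> / 4.\<close>
        obtain f where f: "f \<in> AC0_plus" "f 1 = y k + h"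
          and fseg: "\<And>j x. j < k \<Longrightarrow> \<eta> + real j * \<Delta> \<le> x \<Longrightarrow> x \<le> \<eta> + real (Suc j) * \<Delta> \<Longrightarrow>
            f x = (y j + h) + (x - (\<eta> + real j * \<Delta>)) * ((y (Suc j) - y j) / \<Delta>)"
          and f0: "\<exists>A\<ge>0. cost_on lam f 0 \<eta> \<le> ennreal A \<and> A \<le> s0 + B * (\<eta> + y 0)"
          by (rule raised_polygon[OF \<eta>(1) \<eta>1 h(3) less_imp_le[OF h(2)] \<Delta>(1) k\<Delta> y0[of 0] y_mono, folded s0_def B_def])
            (assumption, rule that)
        have "\<exists>A\<ge>0. cost_on lam f 0 (\<alpha> i) \<le> ennreal A \<and> A \<le> s0 + B * (\<eta> + y 0) + (\<Sum>j<i. s j) + K * (2 * h / \<eta>) * (real i * \<Delta>)"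
          if "i \<le> k" for i
          using that
        proof (induction i)
          case 0
          then show ?case using f0 by (simp add: \<alpha>0)
        next
          case (Suc i)
          then have i: "i < k" by simp
          obtain A where A: "A \<ge> 0" "cost_on lam f 0 (\<alpha> i) \<le> ennreal A"
            "A \<le> s0 + B * (\<eta> + y 0) + (\<Sum>j<i. s j) + K * (2 * h / \<eta>) * (real i * \<Delta>)" using Suc by auto
          have fi: "f x = (y i + h) + (x - \<alpha> i) * ((y (Suc i) - y i) / \<Delta>)" if "\<alpha> i \<le> x" "x \<le> \<alpha> i + \<Delta>" for x
            using fseg[OF i, of x] that \<alpha>S[of i] by (simp add: \<alpha>_def)
          have hib: "hi i \<le> lam ((y (Suc i) + e) / \<alpha> i)"
          proof -
            have "(real (\<nu> (Suc i)) + \<gamma>) / (t * \<alpha> i + 1) \<le> (t * (y (Suc i) + e)) / (t * \<alpha> i)"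
              using t \<alpha>pos[of i] gamma_nonneg te by (intro frac_le) (auto simp: y_def distrib_left)
            also have "\<dots> = (y (Suc i) + e) / \<alpha> i" using t by simp
            finally show ?thesis unfolding hi_def rate_def using t \<alpha>pos[of i] gamma_nonneg
              by (intro lam_mono) auto
          qed
          have lob: "lam (y i / (\<alpha> i + \<Delta> + e)) \<le> lo i"
          proof -
            have "y i / (\<alpha> i + \<Delta> + e) = (t * y i) / (t * (\<alpha> i + \<Delta> + e))" using t by simp
            also have "\<dots> \<le> (real (\<nu> i) + \<gamma>) / (t * (\<alpha> i + \<Delta>) + 1)"
              using t \<alpha>pos[of i] \<Delta> gamma_nonneg te by (intro frac_le) (auto simp: y_def distrib_left add_pos_pos)
            finally show ?thesis unfolding lo_def rate_def using y0[of i] \<alpha>pos[of i] \<Delta> e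
              by (intro lam_mono) auto
          qed
          obtain A' where A': "A' \<ge> 0" "cost_on lam f (\<alpha> i) (\<alpha> i + \<Delta>) \<le> ennreal A'" "A' \<le> s i + K * (2 * h / \<eta>) * \<Delta>"
            using raised_segment_cost[OF fi \<eta>(1) \<alpha>ge \<Delta>(1) y0 y_mono[OF i] y_le jump[OF i] e h(3) hib Wle(1)[OF i] lob] i
            unfolding s_def by auto
          have "cost_on lam f 0 (\<alpha> (Suc i)) = cost_on lam f 0 (\<alpha> i) + cost_on lam f (\<alpha> i) (\<alpha> (Suc i))"
            using \<alpha>pos[of i] \<Delta> \<alpha>S[of i] \<alpha>le[OF Suc.prems] by (intro cost_on_split[OF f(1)]) auto
          also have "\<dots> \<le> ennreal A + ennreal A'" using A A' by (intro add_mono) (auto simp: \<alpha>S)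
          also have "\<dots> = ennreal (A + A')" using A A' by simp
          finally show ?case using A A' by (intro exI[of _ "A + A'"]) (auto simp: distrib_right distrib_left)
        qed
        from this[OF order_refl] obtain A where A: "A \<ge> 0" "cost_on lam f 0 1 \<le> ennreal A"
          "A \<le> s0 + B * (\<eta> + y 0) + (\<Sum>j<k. s j) + K * (2 * h / \<eta>) * (real k * \<Delta>)" by (auto simp: \<alpha>k)
        have "A \<le> S + \<epsilon> / 4"
        proof -
          have "B * (\<eta> + y 0) \<le> B * (2 * \<delta>)" using B \<eta>(4) w\<delta> by (intro mult_left_mono) auto
          also have "\<dots> = \<epsilon> / 8" using B by (simp add: \<delta>_def)
          finally have 1: "B * (\<eta> + y 0) \<le> \<epsilon> / 8" .
          have "2 * h / \<eta> \<le> 2 * \<eta>" using h \<eta> by (simp add: divide_le_eq power2_eq_square)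
          then have "K * (2 * h / \<eta>) \<le> K * (2 * \<eta>)" using K_pos by (intro mult_left_mono) auto
          then have "K * (2 * h / \<eta>) \<le> \<epsilon> / 8" using K\<eta> by simp
          moreover have "0 \<le> K * (2 * h / \<eta>)" using K_pos h \<eta> by simp
          moreover have "real k * \<Delta> \<le> 1" "0 \<le> real k * \<Delta>" using k\<Delta> \<eta> \<Delta> by auto
          ultimately have "K * (2 * h / \<eta>) * (real k * \<Delta>) \<le> \<epsilon> / 8 * 1" by (intro mult_mono) auto
          with 1 A(3) show ?thesis by (simp add: S_def)
        qed
        \<comment> \<open>The raised polygon ends at \<open>y k + h\<close>; truncation brings the
          end point back to n / t.\<close>
        obtain f' where f': "f' \<in> AC0_plus" "f' 1 = y k"
          "path_cost lam f' \<le> path_cost lam f + ennreal (h * \<bar>ln (h / C\<^sub>0)\<bar> + h)"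
          by (rule truncate_path[OF f y0 h(3) C0_pos]) (rule that)
        have "path_cost lam f' \<le> ennreal A + ennreal (\<epsilon> / 4)"
          using f'(3) A(2) h(1) by (auto simp: path_cost_eq_cost_on intro!: order_trans[OF f'(3)[unfolded path_cost_eq_cost_on]] add_mono ennreal_leI)
        also have "\<dots> = ennreal (A + \<epsilon> / 4)" using A \<epsilon> by simp
        finally have fc: "path_cost lam f' \<le> ennreal (A + \<epsilon> / 4)" .
        have "t * (\<epsilon> / 4 - S) \<le> t * (\<epsilon> - (A + \<epsilon> / 4))" using t \<epsilon> \<open>A \<le> S + \<epsilon> / 4\<close> by (intro mult_left_mono) auto
        then have "t * (\<epsilon> / 4) - t * S \<le> - t * ((A + \<epsilon> / 4) - \<epsilon>)" by (simp add: algebra_simps)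
        then have "exp (t * (\<epsilon> / 4) - t * S) \<le> exp (- t * ((A + \<epsilon> / 4) - \<epsilon>))" by simp
        with pS have "p n t \<le> exp (- t * ((A + \<epsilon> / 4) - \<epsilon>))" by linarith
        then show ?thesis using f' fc A \<epsilon> yk by (intro disjI2 exI[of _ f'] exI[of _ "A + \<epsilon> / 4"]) auto
      qed
    qed
  qed
  show ?thesis
  proof (rule that)
    show "0 < max T 1" by simp
    show "p n t \<le> exp (- t * (M' - \<epsilon>)) \<or>
    (\<exists>f C. f \<in> AC0_plus \<and> f 1 = real n / t \<and> 0 \<le> C \<and> path_cost lam f \<le> ennreal C \<and> p n t \<le> exp (- t * (C - \<epsilon>)))"
      if "max T 1 \<le> t" "real n \<le> R * t" for t n
      using that by (intro main) auto
  qed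
qed

end

section \<open>The large deviation principle\<close>

lemma enn2ereal_le_iff: "0 \<le> C \<Longrightarrow> enn2ereal a \<le> ereal C \<longleftrightarrow> a \<le> ennreal C"
  by (metis enn2ereal_ennreal less_eq_ennreal.rep_eq)

lemma self_exciting_rate_le:
  assumes "f \<in> AC0_plus" "f 1 = x" "path_cost lam f \<le> ennreal C" "0 \<le> C"
  shows "self_exciting_rate lam x \<le> ereal C"
proof -
  have "(INF f\<in>{f \<in> AC0_plus. f 1 = x}. path_cost lam f) \<le> path_cost lam f"
    using assms by (intro INF_lower) auto
  then show ?thesis unfolding self_exciting_rate_def using assms by (simp add: enn2ereal_le_iff)
qed

lemma self_exciting_rate_less:
  assumes "self_exciting_rate lam x < ereal c"
  obtains f where "f \<in> AC0_plus" "f 1 = x" "path_cost lam f \<le> ennreal c" "0 < c"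
proof -
  have "0 \<le> self_exciting_rate lam x" by (simp add: self_exciting_rate_def)
  then have "0 < ereal c" using assms by (rule le_less_trans)
  then have c: "0 < c" by simp
  have "(INF f\<in>{f \<in> AC0_plus. f 1 = x}. path_cost lam f) < ennreal c"
    using assms c unfolding self_exciting_rate_def less_ennreal.rep_eq by (simp add: enn2ereal_ennreal)
  then obtain f where "f \<in> AC0_plus" "f 1 = x" "path_cost lam f < ennreal c" by (auto simp: INF_less_iff)
  with c show ?thesis by (intro that[of f]) auto
qed

lemma self_exciting_rate_nonneg: "0 \<le> self_exciting_rate lam x"
  by (simp add: self_exciting_rate_def)

lemma scaled_log_le:
  assumes "0 < t" "0 \<le> P" "P \<le> exp (- t * m)"
  shows "ereal (1 / t) * ereal_log P \<le> ereal (- m)"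
proof (cases "P = 0")
  case False
  then have "ln P \<le> ln (exp (- t * m))" using assms by (subst ln_le_cancel_iff) auto
  then show ?thesis using False assms by (simp add: ereal_log_def field_simps)
qed (use assms in \<open>simp add: ereal_log_def\<close>)

lemma scaled_log_ge:
  assumes "0 < t" "exp (- t * m) \<le> P"
  shows "ereal (- m) \<le> ereal (1 / t) * ereal_log P"
proof -
  have "0 < P" using assms(2) exp_gt_zero[of "- t * m"] by linarith
  then have "- t * m \<le> ln P" using assms by (simp add: ln_ge_iff)
  then show ?thesis using \<open>0 < P\<close> assms by (simp add: ereal_log_def field_simps)
qed

section \<open>The law of the scaled count\<close>

context self_exciting begin

definition law :: "real \<Rightarrow> real measure" where
  "law t = distr M borel (\<lambda>\<omega>. real (count_in N {0<..t} \<omega>) / t)"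

lemma measure_law:
  assumes "A \<in> sets borel"
  shows "measure (law t) A = prob {\<omega>\<in>space M. real (count_in N {0<..t} \<omega>) / t \<in> A}"
proof -
  have "(\<lambda>\<omega>. real (count_in N {0<..t} \<omega>) / t) \<in> borel_measurable M" by measurable
  from measure_distr[OF this assms] show ?thesis
    unfolding law_def by (simp add: vimage_def Int_def conj_commute)
qed

lemma p_le_measure_law:
  assumes "A \<in> sets borel" "real n / t \<in> A"
  shows "p n t \<le> measure (law t) A"
  unfolding p_def measure_law[OF assms(1)]
proof (rule finite_measure_mono)
  show "{\<omega> \<in> space M. real (count_in N {0<..t} \<omega>) / t \<in> A} \<in> events"
    using assms(1) by measurable
qed (use assms in auto)

lemma law_le_one: "A \<in> sets borel \<Longrightarrow> 0 \<le> measure (law t) A \<and> measure (law t) A \<le> 1"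
  by (simp add: measure_law)

lemma Limsup_scaled_log_law_le_zero:
  assumes "A \<in> sets borel"
  shows "Limsup at_top (\<lambda>t. ereal (1 / t) * ereal_log (measure (law t) A)) \<le> 0"
proof (rule Limsup_bounded)
  show "\<forall>\<^sub>F t in at_top. ereal (1 / t) * ereal_log (measure (law t) A) \<le> 0"
    using eventually_gt_at_top[of 0]
  proof eventually_elim
    case (elim t)
    then show ?case
      using scaled_log_le[of t "measure (law t) A" 0] law_le_one[OF assms] by (simp add: zero_ereal_def)
  qed
qed

end

context active_process begin

text \<open>Exponential Chebyshev inequality with parameter 1, carried out on the Poisson bounds:
  \<open>exp (n - R * t)\<close> is at least 1 for the counts concerned.\<close>

lemma tail_le:
  assumes t: "0 \<le> t"
  shows "prob {\<omega>\<in>space M. R * t < real (count_in N {0<..t} \<omega>)} \<le> exp (- t * (R - exp 1 * C\<^sub>0))"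
proof -
  define A where "A n = {\<omega>\<in>space M. count_in N {0<..t} \<omega> = n \<and> R * t < real n}" for n
  have [measurable]: "A n \<in> sets M" for n unfolding A_def by measurable
  have sumsA: "(\<lambda>n. prob (A n)) sums prob (\<Union>n. A n)"
    by (rule finite_measure_UNION) (auto simp: disjoint_family_on_def A_def)
  have UnA: "(\<Union>n. A n) = {\<omega>\<in>space M. R * t < real (count_in N {0<..t} \<omega>)}" by (auto simp: A_def)
  have sumsB: "(\<lambda>n. exp (- R * t) * ((exp 1 * (C\<^sub>0 * t)) ^ n / fact n)) sums (exp (- R * t) * exp (exp 1 * (C\<^sub>0 * t)))"
    using exp_converges[of "exp 1 * (C\<^sub>0 * t)"] by (intro sums_mult) (simp add: scaleR_conv_of_real divide_inverse mult.commute)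
  have le: "prob (A n) \<le> exp (- R * t) * ((exp 1 * (C\<^sub>0 * t)) ^ n / fact n)" for n
  proof (cases "R * t < real n")
    case True
    then have "prob (A n) = p n t" by (simp add: A_def p_def)
    also have "\<dots> \<le> (C\<^sub>0 * t) ^ n / fact n" by (rule p_le_poisson[OF t])
    also have "\<dots> \<le> exp (real n - R * t) * ((C\<^sub>0 * t) ^ n / fact n)"
      using True t C0_nonneg mult_right_mono[of 1 "exp (real n - R * t)" "(C\<^sub>0 * t) ^ n / fact n"] by simp
    also have "exp (real n - R * t) = exp (- R * t) * exp 1 ^ n"
      by (simp add: exp_diff exp_minus exp_of_nat_mult[symmetric] divide_inverse)
    finally show ?thesis by (simp add: power_mult_distrib mult.assoc)
  next
    case False
    then have "A n = {}" by (auto simp: A_def)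
    then show ?thesis using t C0_nonneg by simp
  qed
  have "prob {\<omega>\<in>space M. R * t < real (count_in N {0<..t} \<omega>)} \<le> exp (- R * t) * exp (exp 1 * (C\<^sub>0 * t))"
    using sums_le[OF le sumsA sumsB] unfolding UnA .
  also have "\<dots> = exp (- t * (R - exp 1 * C\<^sub>0))" by (simp add: exp_add[symmetric] algebra_simps)
  finally show ?thesis .
qed

text \<open>A union bound over the counts up to R t, whose number is linear in t, plus the
  tail.\<close>

lemma law_le_sum:
  assumes A: "A \<in> sets borel" and t: "0 < t" and b: "0 \<le> b" "\<And>n. real n \<le> R * t \<Longrightarrow> real n / t \<in> A \<Longrightarrow> p n t \<le> b" and R: "0 \<le> R"
  shows "measure (law t) A \<le> (R * t + 1) * b + exp (- t * (R - exp 1 * C\<^sub>0))"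
proof -
  let ?J = "{n. real n \<le> R * t \<and> real n / t \<in> A}"
  have Jsub: "?J \<subseteq> {..nat \<lfloor>R * t\<rfloor>}" by (auto simp: le_nat_floor)
  then have J: "finite ?J" by (rule finite_subset) simp
  have Jc: "real (card ?J) \<le> R * t + 1"
  proof -
    have "card ?J \<le> Suc (nat \<lfloor>R * t\<rfloor>)" using card_mono[OF _ Jsub] by simp
    moreover have "real (nat \<lfloor>R * t\<rfloor>) \<le> R * t" using R t by simp
    ultimately show ?thesis by linarith
  qed
  let ?E = "\<lambda>n. {\<omega>\<in>space M. count_in N {0<..t} \<omega> = n}"
  let ?T = "{\<omega>\<in>space M. R * t < real (count_in N {0<..t} \<omega>)}"
  have [measurable]: "?E n \<in> sets M" "?T \<in> sets M" for n by measurable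
  have "measure (law t) A \<le> prob ((\<Union>n\<in>?J. ?E n) \<union> ?T)"
    unfolding measure_law[OF A] using J by (intro finite_measure_mono) auto
  also have "\<dots> \<le> prob (\<Union>n\<in>?J. ?E n) + prob ?T" using J by (intro measure_Un_le) auto
  also have "prob (\<Union>n\<in>?J. ?E n) \<le> (\<Sum>n\<in>?J. p n t)"
    unfolding p_def using J by (intro measure_UNION_le) auto
  also have "(\<Sum>n\<in>?J. p n t) \<le> real (card ?J) * b"
    using sum_bounded_above[of ?J "\<lambda>n. p n t" b] b(2) by auto
  also have "\<dots> \<le> (R * t + 1) * b" using Jc b(1) by (intro mult_right_mono)
  finally show ?thesis using tail_le[of t R] t by simp
qed

text \<open>For n / t in A the second alternative of \<open>upper_local_bound\<close> yields a path
  that ends in A and hence costs more than M'. So all relevant point probabilities are small from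
  one T on, and every Borel set is treated at once without a covering argument.\<close>

lemma ldp_upper:
  assumes A: "A \<in> sets borel"
  shows "Limsup at_top (\<lambda>t. ereal (1 / t) * ereal_log (measure (law t) A)) \<le> - (INF x\<in>closure A. self_exciting_rate lam x)"
proof (rule ccontr)
  let ?L = "Limsup at_top (\<lambda>t. ereal (1 / t) * ereal_log (measure (law t) A))"
  let ?J = "INF x\<in>closure A. self_exciting_rate lam x"
  assume "\<not> ?L \<le> - ?J"
  then have "- ?J < ?L" by simp
  then obtain r where r: "- ?J < ereal r" "ereal r < ?L" using ereal_dense2 by blast
  from r(1) obtain r' where r': "- ?J < ereal r'" "ereal r' < ereal r" using ereal_dense2 by blast
  \<comment> \<open>Needed to make M' nonnegative, as \<open>upper_local_bound\<close>
    demands.\<close>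
  have "?L \<le> 0" by (rule Limsup_scaled_log_law_le_zero[OF A])
  with r(2) have "ereal r < 0" by (rule less_le_trans)
  then have "r < 0" by simp
  define M' where "M' = - r'"
  define \<epsilon> where "\<epsilon> = (r - r') / 2"
  have \<epsilon>: "0 < \<epsilon>" using r'(2) by (simp add: \<epsilon>_def)
  have M': "0 \<le> M'" using \<open>r < 0\<close> r'(2) by (simp add: M'_def)
  have J: "ereal M' < ?J" using r'(1) unfolding M'_def by (metis ereal_uminus_less_reorder uminus_ereal.simps(1))
  \<comment> \<open>With this R the tail decays at rate M'.\<close>
  define R where "R = M' + exp 1 * C\<^sub>0"
  have R_pos: "0 < R" using M' C0_pos by (simp add: R_def add_nonneg_pos)
  then have R: "0 \<le> R" by simp
  obtain T where T: "0 < T" "\<And>t n. T \<le> t \<Longrightarrow> real n \<le> R * t \<Longrightarrow> p n t \<le> exp (- t * (M' - \<epsilon>)) \<or>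
    (\<exists>f C. f \<in> AC0_plus \<and> f 1 = real n / t \<and> 0 \<le> C \<and> path_cost lam f \<le> ennreal C \<and> p n t \<le> exp (- t * (C - \<epsilon>)))"
    by (rule upper_local_bound[OF R M' \<epsilon>]) (rule that)
  have pb: "p n t \<le> exp (- t * (M' - \<epsilon>))" if t: "T \<le> t" and n: "real n \<le> R * t" "real n / t \<in> A" for n t
    using T(2)[OF t n(1)]
  proof
    assume "\<exists>f C. f \<in> AC0_plus \<and> f 1 = real n / t \<and> 0 \<le> C \<and> path_cost lam f \<le> ennreal C \<and> p n t \<le> exp (- t * (C - \<epsilon>))"
    then obtain f C where f: "f \<in> AC0_plus" "f 1 = real n / t" "0 \<le> C" "path_cost lam f \<le> ennreal C" "p n t \<le> exp (- t * (C - \<epsilon>))" by blast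
    have "?J \<le> self_exciting_rate lam (real n / t)" using n(2) closure_subset by (intro INF_lower) auto
    also have "\<dots> \<le> ereal C" by (rule self_exciting_rate_le[OF f(1,2,4,3)])
    finally have "M' < C" using J by (metis less_ereal.simps(1) less_le_trans)
    then have "t * (M' - \<epsilon>) \<le> t * (C - \<epsilon>)" using t T(1) by (intro mult_left_mono) auto
    then have "exp (- t * (C - \<epsilon>)) \<le> exp (- t * (M' - \<epsilon>))" by simp
    with f(5) show ?thesis by linarith
  qed
  have "\<forall>\<^sub>F t in at_top. R * t + 2 \<le> exp (t * \<epsilon>)"
  proof -
    have "((\<lambda>t. (R * t + 2) / exp (t * \<epsilon>)) \<longlongrightarrow> 0) at_top"
      using \<epsilon> R_pos by real_asymp
    then have "\<forall>\<^sub>F t in at_top. (R * t + 2) / exp (t * \<epsilon>) < 1" by (intro order_tendstoD(2)) auto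
    then show ?thesis by eventually_elim (simp add: divide_less_eq)
  qed
  then have "\<forall>\<^sub>F t in at_top. ereal (1 / t) * ereal_log (measure (law t) A) \<le> ereal r"
    using eventually_ge_at_top[of T]
  proof eventually_elim
    case (elim t)
    have t: "0 < t" using elim T(1) by simp
    have "measure (law t) A \<le> (R * t + 1) * exp (- t * (M' - \<epsilon>)) + exp (- t * (R - exp 1 * C\<^sub>0))"
      by (rule law_le_sum[OF A t _ pb[OF elim(2)] R]) auto
    also have "exp (- t * (R - exp 1 * C\<^sub>0)) \<le> exp (- t * (M' - \<epsilon>))"
      using t \<epsilon> by (simp add: R_def)
    finally have "measure (law t) A \<le> (R * t + 2) * exp (- t * (M' - \<epsilon>))" by (simp add: distrib_right)
    also have "\<dots> \<le> exp (t * \<epsilon>) * exp (- t * (M' - \<epsilon>))" using elim by (intro mult_right_mono) auto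
    also have "\<dots> = exp (- t * (- r))" unfolding exp_add[symmetric]
      by (rule arg_cong[where f=exp]) (simp add: M'_def \<epsilon>_def field_simps)
    finally have "measure (law t) A \<le> exp (- t * (- r))" .
    from scaled_log_le[OF t _ this] show ?case using law_le_one[OF A, of t] by simp
  qed
  then have "?L \<le> ereal r" by (rule Limsup_bounded)
  with r(2) show False by simp
qed

text \<open>The bound available is for the height x + h instead of x; an open set has room for small
  h, and for t > 1 / h the rounded height stays strictly above t x.\<close>

lemma ldp_lower:
  assumes A: "A \<in> sets borel"
  shows "- (INF x\<in>interior A. self_exciting_rate lam x) \<le> Liminf at_top (\<lambda>t. ereal (1 / t) * ereal_log (measure (law t) A))"
proof -
  let ?L = "Liminf at_top (\<lambda>t. ereal (1 / t) * ereal_log (measure (law t) A))"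
  have pt: "- self_exciting_rate lam x \<le> ?L" if x: "x \<in> interior A" for x
  proof (rule ccontr)
    assume "\<not> - self_exciting_rate lam x \<le> ?L"
    then have "?L < - self_exciting_rate lam x" by simp
    then obtain r where r: "?L < ereal r" "ereal r < - self_exciting_rate lam x" using ereal_dense2 by blast
    from r(2) obtain r' where r': "ereal r < ereal r'" "ereal r' < - self_exciting_rate lam x" using ereal_dense2 by blast
    have "self_exciting_rate lam x < ereal (- r')"
      using r'(2) by (metis ereal_less_uminus_reorder uminus_ereal.simps(1))
    then obtain f where f: "f \<in> AC0_plus" "f 1 = x" "path_cost lam f \<le> ennreal (- r')" "0 < - r'"
      by (rule self_exciting_rate_less)
    obtain h\<^sub>0 where h0: "0 < h\<^sub>0" "\<And>f h. f \<in> AC0_plus \<Longrightarrow> path_cost lam f \<le> ennreal (- r') \<Longrightarrow> 0 < h \<Longrightarrow> h \<le> h\<^sub>0 \<Longrightarrow>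
      \<forall>\<^sub>F t in at_top. exp (- t * (- r' + (r' - r))) \<le> p (nat \<lfloor>t * (f 1 + h)\<rfloor>) t"
      using lower_local_bound[of "- r'" "r' - r"] f(4) r'(1) by auto
    obtain d where d: "d > 0" "ball x d \<subseteq> A" using x by (meson mem_interior)
    define h where "h = min h\<^sub>0 (d / 2)"
    have h: "0 < h" "h \<le> h\<^sub>0" "h < d" using h0(1) d(1) by (auto simp: h_def)
    have x0: "0 \<le> x" using AC0_plus_nonneg[OF f(1), of 1] f(2) by simp
    have "\<forall>\<^sub>F t in at_top. exp (- t * (- r)) \<le> p (nat \<lfloor>t * (x + h)\<rfloor>) t"
      using h0(2)[OF f(1,3) h(1,2)] f(2) by simp
    then have "\<forall>\<^sub>F t in at_top. ereal r \<le> ereal (1 / t) * ereal_log (measure (law t) A)"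
      using eventually_gt_at_top[of "1 / h"]
    proof eventually_elim
      case (elim t)
      have t: "0 < t" using elim(2) h(1) by (meson less_trans zero_less_divide_1_iff)
      let ?n = "nat \<lfloor>t * (x + h)\<rfloor>"
      have "real ?n \<le> t * (x + h)" using t x0 h by simp
      then have up: "real ?n / t \<le> x + h" using t by (simp add: divide_le_eq mult.commute)
      have "1 < t * h" using elim(2) h(1) by (simp add: divide_less_eq)
      then have "t * x < real ?n" using t x0 h by (simp add: distrib_left) linarith
      then have "x < real ?n / t" using t by (simp add: less_divide_eq mult.commute)
      with up h(3) have "real ?n / t \<in> ball x d" by (simp add: dist_real_def)
      then have "real ?n / t \<in> A" using d by blast
      then have "exp (- t * (- r)) \<le> measure (law t) A"
        using p_le_measure_law[OF A] elim(1) by (meson order_trans)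
      from scaled_log_ge[OF t this] show ?case by simp
    qed
    then have "ereal r \<le> ?L" by (rule Liminf_bounded)
    with r(1) show False by simp
  qed
  have "- (INF x\<in>interior A. self_exciting_rate lam x) = (SUP x\<in>interior A. - self_exciting_rate lam x)"
    by (simp add: ereal_SUP_uminus_eq)
  also have "\<dots> \<le> ?L" using pt by (intro SUP_least)
  finally show ?thesis .
qed

text \<open>A cheap path to a nearby x' yields a cheap path to x. If x' lies above x, it is
  truncated. If x' lies below x, nothing is constructed by hand: the lower bound shows that the
  probability of height x is large, and the upper bound extracts from this a path that ends exactly
  at x.\<close>

lemma rate_locally_bounded_below:
  assumes r: "0 \<le> r" "ereal r < self_exciting_rate lam x"
  obtains d where "0 < d" "\<And>x'. \<bar>x' - x\<bar> < d \<Longrightarrow> ereal r < self_exciting_rate lam x'"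
proof (cases "x < 0")
  case True
  have "ereal r < self_exciting_rate lam x'" if "\<bar>x' - x\<bar> < - x" for x'
  proof (rule ccontr)
    assume "\<not> ereal r < self_exciting_rate lam x'"
    then have "self_exciting_rate lam x' < ereal (r + 1)" by (simp add: not_less le_less_trans)
    then obtain f where "f \<in> AC0_plus" "f 1 = x'" by (rule self_exciting_rate_less)
    then show False using AC0_plus_nonneg[of f 1] that by auto
  qed
  then show ?thesis using True by (intro that[of "- x"]) auto
next
  case False
  obtain r1 where r1: "r < r1" "ereal r1 < self_exciting_rate lam x"
    using ereal_dense2[OF r(2)] by auto
  \<comment> \<open>One portion lifts r to c, two are spent on the errors of the lower and the upper
    bound, and one is spare below r1.\<close>
  define \<epsilon> where "\<epsilon> = (r1 - r) / 4"
  have \<epsilon>: "0 < \<epsilon>" using r1 by (simp add: \<epsilon>_def)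
  define c where "c = r + \<epsilon>"
  have c: "0 \<le> c" using r \<epsilon> by (simp add: c_def)
  obtain h\<^sub>0 where h0: "0 < h\<^sub>0" "\<And>f h. f \<in> AC0_plus \<Longrightarrow> path_cost lam f \<le> ennreal c \<Longrightarrow> 0 < h \<Longrightarrow> h \<le> h\<^sub>0 \<Longrightarrow>
      \<forall>\<^sub>F t in at_top. exp (- t * (c + \<epsilon>)) \<le> p (nat \<lfloor>t * (f 1 + h)\<rfloor>) t"
    by (rule lower_local_bound[OF c \<epsilon>]) (rule that)
  have "((\<lambda>h. h * \<bar>ln (h / C\<^sub>0)\<bar> + h) \<longlongrightarrow> 0) (at_right 0)" using C0_pos by real_asymp
  then have "\<forall>\<^sub>F h in at_right 0. h * \<bar>ln (h / C\<^sub>0)\<bar> + h < \<epsilon>" using \<epsilon> by (intro order_tendstoD(2)) auto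
  then obtain h1 where h1: "0 < h1" "\<And>h. 0 < h \<Longrightarrow> h < h1 \<Longrightarrow> h * \<bar>ln (h / C\<^sub>0)\<bar> + h < \<epsilon>"
    unfolding eventually_at_right_field by auto
  have "ereal r < self_exciting_rate lam x'" if x': "\<bar>x' - x\<bar> < min h\<^sub>0 h1" for x'
  proof (rule ccontr)
    assume "\<not> ereal r < self_exciting_rate lam x'"
    then have "self_exciting_rate lam x' < ereal c" using \<epsilon> by (simp add: not_less c_def le_less_trans)
    then obtain f where f: "f \<in> AC0_plus" "f 1 = x'" "path_cost lam f \<le> ennreal c" by (rule self_exciting_rate_less)
    have "self_exciting_rate lam x \<le> ereal r1"
    proof (cases "x' = x")
      case True
      then have "self_exciting_rate lam x \<le> ereal c" using self_exciting_rate_le[OF f c] by simp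
      also have "\<dots> \<le> ereal r1" using \<epsilon> by (simp add: c_def \<epsilon>_def field_simps)
      finally show ?thesis .
    next
      case neq: False
      show ?thesis
      proof (cases "x < x'")
        case True
        define h where "h = x' - x"
        have h: "0 < h" "h < h1" using True x' by (auto simp: h_def)
        have f1: "f 1 = x + h" using f(2) by (simp add: h_def)
        have x0: "0 \<le> x" using False by simp
        obtain f' where f': "f' \<in> AC0_plus" "f' 1 = x" "path_cost lam f' \<le> path_cost lam f + ennreal (h * \<bar>ln (h / C\<^sub>0)\<bar> + h)"
          by (rule truncate_path[OF f(1) f1 x0 h(1) C0_pos]) (rule that)
        have "path_cost lam f' \<le> ennreal c + ennreal \<epsilon>"
          using f'(3) by (rule order_trans) (intro add_mono f(3) ennreal_leI less_imp_le h1(2) h)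
        also have "\<dots> = ennreal (c + \<epsilon>)" using c \<epsilon> by simp
        finally have "self_exciting_rate lam x \<le> ereal (c + \<epsilon>)"
          using f' c \<epsilon> by (intro self_exciting_rate_le) auto
        also have "\<dots> \<le> ereal r1" using \<epsilon> by (simp add: c_def \<epsilon>_def field_simps)
        finally show ?thesis .
      next
        case False
        define h where "h = x - x'"
        have h: "0 < h" "h \<le> h\<^sub>0" using False neq x' by (auto simp: h_def)
        have f1: "f 1 + h = x" using f(2) by (simp add: h_def)
        have "0 \<le> f 1" using AC0_plus_nonneg[OF f(1), of 1] by simp
        then have x0: "0 < x" using f1 h by simp
        obtain T1 where T1: "\<And>t. T1 \<le> t \<Longrightarrow> exp (- t * (c + \<epsilon>)) \<le> p (nat \<lfloor>t * x\<rfloor>) t"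
          using h0(2)[OF f(1,3) h] unfolding f1 eventually_at_top_linorder by blast
        have r1': "0 \<le> r1 + 1" using r r1 by simp
        \<comment> \<open>At the level r1 + 1 the first alternative contradicts the lower
          bound.\<close>
        obtain T2 where T2: "0 < T2" "\<And>t n. T2 \<le> t \<Longrightarrow> real n \<le> x * t \<Longrightarrow> p n t \<le> exp (- t * (r1 + 1 - \<epsilon>)) \<or>
          (\<exists>f C. f \<in> AC0_plus \<and> f 1 = real n / t \<and> 0 \<le> C \<and> path_cost lam f \<le> ennreal C \<and> p n t \<le> exp (- t * (C - \<epsilon>)))"
          by (rule upper_local_bound[OF less_imp_le[OF x0] r1' \<epsilon>]) (rule that)
        obtain n where n: "max T1 T2 * x \<le> real n" using real_arch_simple by blast
        \<comment> \<open>Along these times x is a lattice point, so n / t = x holds without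
          rounding.\<close>
        define t where "t = real n / x"
        have t: "T1 \<le> t" "T2 \<le> t" "0 < t"
        proof -
          have "max T1 T2 \<le> t" using n x0 by (simp add: t_def le_divide_eq)
          then show "T1 \<le> t" "T2 \<le> t" "0 < t" using T2(1) by auto
        qed
        have "0 < real n" using x0 t(3) by (simp add: t_def zero_less_divide_iff)
        then have tx: "t * x = real n" "real n / t = x" using x0 by (auto simp: t_def)
        have lowp: "exp (- t * (c + \<epsilon>)) \<le> p n t" using T1[OF t(1)] by (simp add: tx)
        have cmp: "z - \<epsilon> \<le> c + \<epsilon>" if "p n t \<le> exp (- t * (z - \<epsilon>))" for z
        proof -
          have "exp (- t * (c + \<epsilon>)) \<le> exp (- t * (z - \<epsilon>))" using lowp that by linarith
          then show ?thesis using t(3) by simp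
        qed
        have "real n \<le> x * t" using tx by (simp add: mult.commute)
        from T2(2)[OF t(2) this] show ?thesis
        proof
          assume "p n t \<le> exp (- t * (r1 + 1 - \<epsilon>))"
          from cmp[OF this] show ?thesis using \<epsilon> by (simp add: c_def \<epsilon>_def field_simps)
        next
          assume "\<exists>f C. f \<in> AC0_plus \<and> f 1 = real n / t \<and> 0 \<le> C \<and> path_cost lam f \<le> ennreal C \<and> p n t \<le> exp (- t * (C - \<epsilon>))"
          then obtain f C where f: "f \<in> AC0_plus" "f 1 = x" "0 \<le> C" "path_cost lam f \<le> ennreal C" "p n t \<le> exp (- t * (C - \<epsilon>))"
            unfolding tx by blast
          have "C \<le> r1" using cmp[OF f(5)] \<epsilon> by (simp add: c_def \<epsilon>_def field_simps)
          then show ?thesis using self_exciting_rate_le[OF f(1,2,4,3)] by (meson ereal_less_eq(3) order_trans)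
        qed
      qed
    qed
    with r1(2) show False by simp
  qed
  then show ?thesis using h0(1) h1(1) by (intro that[of "min h\<^sub>0 h1"]) auto
qed

lemma lower_semicont_rate: "lower_semicont (self_exciting_rate lam)"
  unfolding lower_semicont_def
proof
  fix c :: ereal
  have "open {x. c < self_exciting_rate lam x}"
  proof (cases c)
    case (real r)
    show ?thesis
    proof (cases "0 \<le> r")
      case True
      show ?thesis
        unfolding open_dist
      proof
        fix x assume "x \<in> {x. c < self_exciting_rate lam x}"
        then have "ereal r < self_exciting_rate lam x" by (simp add: real)
        from rate_locally_bounded_below[OF True this] obtain d where
          "0 < d" "\<And>x'. \<bar>x' - x\<bar> < d \<Longrightarrow> ereal r < self_exciting_rate lam x'" by blast
        then show "\<exists>e>0. \<forall>y. dist y x < e \<longrightarrow> y \<in> {x. c < self_exciting_rate lam x}"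
          by (auto simp: real dist_real_def)
      qed
    next
      case False
      then have "c < 0" using real by simp
      then have "c < self_exciting_rate lam x" for x
        using self_exciting_rate_nonneg by (rule less_le_trans)
      then show ?thesis by simp
    qed
  next
    case MInf
    then have "c < self_exciting_rate lam x" for x
      using self_exciting_rate_nonneg[of lam x] by (simp add: less_le_trans)
    then show ?thesis by simp
  qed simp
  moreover have "{x. self_exciting_rate lam x \<le> c} = - {x. c < self_exciting_rate lam x}" by auto
  ultimately show "closed {x. self_exciting_rate lam x \<le> c}" by (simp add: closed_Compl)
qed

end

section \<open>The process that never jumps\<close>

context self_exciting begin

text \<open>The law is the unit mass at 0. The rate function is 0 there and infinite elsewhere,
  because any climb at rate 0 has infinite cost.\<close>

lemma degenerate_ldp:
  assumes zero: "\<And>x. 0 \<le> x \<Longrightarrow> lam x = 0"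
  shows "large_deviation_principle law (self_exciting_rate lam)"
proof -
  have "p 0 0 * ((0 * (t - 0)) ^ 0 / fact 0) * exp (- 0 * (t - 0)) \<le> p (0 + 0) t" if "0 \<le> t" for t
    using that gamma_nonneg by (intro transition_lower[where b = t]) (auto simp: rate_def zero)
  then have "1 \<le> p 0 t" if "0 \<le> t" for t using that by (simp add: p_zero)
  moreover have "p 0 t \<le> 1" for t by (simp add: p_def)
  ultimately have p0: "p 0 t = 1" if "0 \<le> t" for t using that by (meson antisym)
  have law1: "measure (law t) A = 1" if "A \<in> sets borel" "0 \<in> A" "0 \<le> t" for A t
    using p_le_measure_law[OF that(1), of 0 t] law_le_one[OF that(1), of t] that p0 by simp
  have law0: "measure (law t) A = 0" if A: "A \<in> sets borel" "0 \<notin> A" and t: "0 \<le> t" for A t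
  proof -
    have "- A \<in> sets borel" "0 \<in> - A" using A by auto
    then have "measure (law t) (- A) = 1" using law1 t by blast
    moreover have "measure (law t) (- A) = 1 - measure (law t) A"
    proof -
      interpret L: prob_space "law t" unfolding law_def by (rule prob_space_distr) measurable
      have "space (law t) = UNIV" "A \<in> sets (law t)" using A by (auto simp: law_def)
      then show ?thesis using L.prob_compl[of A] by (simp add: Compl_eq_Diff_UNIV)
    qed
    ultimately show ?thesis by simp
  qed
  have I0: "self_exciting_rate lam 0 = 0"
  proof -
    have "(\<lambda>_. 0) \<in> AC0_plus"
      by (auto simp: AC0_plus_def absolutely_continuous_on_def mono_on_def split_beta' intro: exI[of _ 1])
    moreover have "path_cost lam (\<lambda>_. 0) = 0"
      by (simp add: path_cost_def local_cost_def zero)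
    ultimately have "self_exciting_rate lam 0 \<le> ereal 0"
      by (intro self_exciting_rate_le[of "\<lambda>_. 0"]) auto
    then show ?thesis using self_exciting_rate_nonneg[of lam 0] by (simp add: zero_ereal_def antisym)
  qed
  have Ix: "self_exciting_rate lam x = \<infinity>" if "x \<noteq> 0" for x
  proof (rule ccontr)
    assume "self_exciting_rate lam x \<noteq> \<infinity>"
    then obtain c where "self_exciting_rate lam x < ereal c"
      using self_exciting_rate_nonneg[of lam x] by (metis less_PInf_Ex_of_nat ereal_infty_less(1))
    then obtain f where f: "f \<in> AC0_plus" "f 1 = x" "path_cost lam f \<le> ennreal c" "0 < c" by (rule self_exciting_rate_less)
    \<comment> \<open>With upper rate 0 the first conclusion of \<open>cost_on_ge_segment\<close>
      leaves no increment at all.\<close>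
    have "f 0 = f 1 \<or> 0 < (0::real)"
    proof (rule cost_on_ge_segment(1)[OF f(1)])
      show "lam (f x / x) \<le> 0" "0 \<le> lam (f x / x)" if "0 < x" "x \<le> 1" for x
        using that AC0_plus_nonneg[OF f(1), of x] zero[of "f x / x"] by auto
      show "cost_on lam f 0 1 \<le> ennreal c" using f(3) by (simp add: path_cost_eq_cost_on)
    qed (use f(4) in auto)
    then show False using AC0_plusD(3)[OF f(1)] f(2) that by simp
  qed
  show ?thesis
    unfolding large_deviation_principle_def
  proof (intro conjI allI ballI)
    show "0 \<le> self_exciting_rate lam x" for x by (rule self_exciting_rate_nonneg)
    show "lower_semicont (self_exciting_rate lam)"
      unfolding lower_semicont_def
    proof
      fix c :: ereal
      have "{x. self_exciting_rate lam x \<le> c} = (if c = \<infinity> then UNIV else if 0 \<le> c then {0} else {})"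
        using Ix I0 by (auto split: if_splits) (metis ereal_infty_less_eq(1))+
      then show "closed {x. self_exciting_rate lam x \<le> c}" by simp
    qed
    fix A :: "real set" assume A: "A \<in> sets borel"
    let ?g = "\<lambda>t. ereal (1 / t) * ereal_log (measure (law t) A)"
    show "- (INF x\<in>interior A. self_exciting_rate lam x) \<le> Liminf at_top ?g"
    proof (cases "0 \<in> interior A")
      case True
      then have "0 \<in> A" using interior_subset by blast
      have "\<forall>\<^sub>F t in at_top. 0 \<le> ?g t"
        using eventually_ge_at_top[of 0] by eventually_elim (simp add: law1[OF A \<open>0 \<in> A\<close>] ereal_log_def zero_ereal_def)
      then have "0 \<le> Liminf at_top ?g" by (rule Liminf_bounded)
      moreover have "0 \<le> (INF x\<in>interior A. self_exciting_rate lam x)"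
        by (intro INF_greatest self_exciting_rate_nonneg)
      ultimately show ?thesis by (meson ereal_uminus_le_0_iff order_trans)
    next
      case False
      then have "\<infinity> \<le> (INF x\<in>interior A. self_exciting_rate lam x)"
        by (intro INF_greatest) (metis Ix order_refl)
      then show ?thesis by simp
    qed
    show "Limsup at_top ?g \<le> - (INF x\<in>closure A. self_exciting_rate lam x)"
    proof (cases "0 \<in> closure A")
      case True
      have "Limsup at_top ?g \<le> 0" by (rule Limsup_scaled_log_law_le_zero[OF A])
      moreover have "(INF x\<in>closure A. self_exciting_rate lam x) \<le> 0"
        using INF_lower[OF True, of "self_exciting_rate lam"] I0 by simp
      ultimately show ?thesis by (meson ereal_0_le_uminus_iff order_trans)
    next
      case False
      then have "0 \<notin> A" using closure_subset by blast
      have "\<forall>\<^sub>F t in at_top. ?g t \<le> - \<infinity>"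
        using eventually_gt_at_top[of 0] by eventually_elim (simp add: law0[OF A \<open>0 \<notin> A\<close>] ereal_log_def)
      then have "Limsup at_top ?g \<le> - \<infinity>" by (rule Limsup_bounded)
      then show ?thesis by simp
    qed
  qed
qed

end

text \<open>The hypothesis \<open>nondegenerate\<close> excludes a genuine failure. If
  \<open>lam \<gamma> = 0\<close> but \<open>lam g > 0\<close> for some g, the process never leaves
  0, since its rate there is at most \<open>lam \<gamma>\<close>; yet the straight path of slope g
  has finite cost, so the lower bound would be false near g.\<close>

theorem corollary8:
  fixes lam lam' :: "real \<Rightarrow> real" and \<gamma> C\<^sub>0 K :: real
    and M :: "'a measure" and N :: "'a \<Rightarrow> real set"
  assumes lam_nonneg: "\<And>x. 0 \<le> x \<Longrightarrow> 0 \<le> lam x"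
    and lam_incr: "mono_on {0..} lam"
    and lam_deriv: "\<And>x. 0 \<le> x \<Longrightarrow> (lam has_real_derivative lam' x) (at x within {0..})"
    and lam_C1: "continuous_on {0..} lam'"
    and fixpoints_finite: "finite {x. 0 \<le> x \<and> x = lam x}"
    and fixpoints_slope: "\<And>x. 0 \<le> x \<Longrightarrow> x = lam x \<Longrightarrow> lam' x < 1 \<or> lam' x > 1"
    and gamma_nonneg: "0 \<le> \<gamma>"
    and nondegenerate: "lam \<gamma> = 0 \<Longrightarrow> (\<forall>x\<ge>0. lam x = 0)"
    and process: "self_exciting_process lam \<gamma> M N"
    and lam_bounded: "\<And>x. 0 \<le> x \<Longrightarrow> lam x \<le> C\<^sub>0"
    and K_pos: "0 < K"
    and lam_lipschitz: "K-lipschitz_on {0..} lam"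
  shows "large_deviation_principle
           (\<lambda>t. distr M borel (\<lambda>\<omega>. real (count_in N {0<..t} \<omega>) / t))
           (self_exciting_rate lam)"
proof -
  interpret self_exciting lam C\<^sub>0 K \<gamma> M N
    by unfold_locales (use assms in auto)
  have law: "law = (\<lambda>t. distr M borel (\<lambda>\<omega>. real (count_in N {0<..t} \<omega>) / t))"
    by (rule ext) (rule law_def)
  show ?thesis
  proof (cases "lam \<gamma> = 0")
    case True
    then have "lam x = 0" if "0 \<le> x" for x using nondegenerate that by blast
    from degenerate_ldp[OF this] show ?thesis unfolding law .
  next
    case False
    then interpret active_process lam C\<^sub>0 K \<gamma> M N
      using lam_nonneg[OF gamma_nonneg] by unfold_locales simp
    show ?thesis
      unfolding large_deviation_principle_def law[symmetric]
      by (intro conjI allI ballI self_exciting_rate_nonneg lower_semicont_rate ldp_lower ldp_upper)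
  qed
qed

end
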